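(* Let $0\le\beta<1$ and let $u_0\in L^2(0,1)$ be real-valued. Let $u$ be the solution of $u_t=iT_\beta u$ with $u(x,0)=u_0(x)$, that is, of the problem $$u_t+u_{xxx}=0,\qquad u(0,t)=u(1,t)=0,\qquad u_x(1,t)=\beta u_x(0,t),\qquad u(\cdot,0)=u_0 .$$ Then for all $t\ge 0$: $$\|u(\cdot,t)\|_{L^2(0,1)}^2\le\|u_0\|_{L^2(0,1)}^2,$$ $$\int_0^t u_x^2(0,s)\,ds\le\frac{1}{1-\beta}\|u_0\|_{L^2(0,1)}^2,$$ $$\int_0^1 x\,u^2(x,t)\,dx+3\int_0^t\int_0^1u_x^2(x,s)\,dx\,ds\le\frac{1}{1-\beta}\|u_0\|_{L^2(0,1)}^2,$$ and moreover $$\lim_{t\to\infty}\|u(\cdot,t)\|_{L^2(0,1)}^2=0 .$$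
   Context: The operator $T_\beta=(-i\partial_x)^3$ acts on $L^2(0,1)$ with domain $\mathcal D_\beta=\{v\in H^3(0,1): v(0)=v(1)=0,\ v_x(1)=\beta v_x(0)\}$, so that formally $iT_\beta u=-u_{xxx}$. For $0\le\beta<1$ the problem is well-posed in $L^2(0,1)$: the solution is $u(\cdot,t)=S(t)u_0$, where $S(t)$ is the $C_0$-semigroup on $L^2(0,1)$ generated by $iT_\beta$ with domain $\mathcal D_\beta$. If $u_0\in\mathcal D_\beta$ then $u\in C([0,\infty);H^3(0,1))\cap C^1([0,\infty);L^2(0,1))$ is a classical solution. For general $u_0\in L^2(0,1)$, the solution and the quantities $u_x(0,\cdot)\in L^2(0,t)$ and $u_x\in L^2((0,1)\times(0,t))$ are understood as limits of those for classical solutions with initial data in $\mathcal D_\beta$ converging to $u_0$ in $L^2(0,1)$. *)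

theory Defs
  imports "HOL-Analysis.Analysis"
begin

text \<open>Elements of \<open>L\<^sup>2\<close> are handled through representatives: a class of functions modulo
  equality almost everywhere is given by any of its members, and equality in \<open>L\<^sup>2\<close> is written
  out as \<open>AE\<close>. The Borel sigma-algebra suffices, since every class has a Borel representative.\<close>

definition L2 :: "'a measure \<Rightarrow> ('a \<Rightarrow> complex) set" where
  "L2 M = {f. f \<in> borel_measurable M \<and> integrable M (\<lambda>x. (cmod (f x))\<^sup>2)}"

definition L2norm :: "'a measure \<Rightarrow> ('a \<Rightarrow> complex) \<Rightarrow> real" where
  "L2norm M f = sqrt (\<integral>x. (cmod (f x))\<^sup>2 \<partial>M)"

text \<open>Membership in \<open>L\<^sup>2\<close> is demanded explicitly because the Bochner integral of a
  non-integrable function is 0.\<close>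

definition L2_tendsto ::
    "'a measure \<Rightarrow> ('b \<Rightarrow> 'a \<Rightarrow> complex) \<Rightarrow> ('a \<Rightarrow> complex) \<Rightarrow> 'b filter \<Rightarrow> bool" where
  "L2_tendsto M F f A \<longleftrightarrow>
     (\<forall>\<^sub>F n in A. F n \<in> L2 M) \<and> f \<in> L2 M \<and>
     ((\<lambda>n. L2norm M (\<lambda>x. F n x - f x)) \<longlongrightarrow> 0) A"

definition lborel_on :: "real \<Rightarrow> real \<Rightarrow> real measure" where
  "lborel_on a b = restrict_space lborel {a<..<b}"

abbreviation I01 :: "real measure" where
  "I01 \<equiv> lborel_on 0 1"

text \<open>Linearity and boundedness together imply that \<open>S t\<close> respects equality almost everywhere.
  The values of \<open>S t f\<close> for \<open>t < 0\<close> or \<open>f\<close> outside \<open>L\<^sup>2\<close> are irrelevant.\<close>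

definition bounded_operator_L2 ::
    "'a measure \<Rightarrow> (('a \<Rightarrow> complex) \<Rightarrow> ('a \<Rightarrow> complex)) \<Rightarrow> bool" where
  "bounded_operator_L2 M B \<longleftrightarrow>
     (\<forall>f\<in>L2 M. B f \<in> L2 M) \<and>
     (\<forall>f\<in>L2 M. \<forall>g\<in>L2 M. AE x in M. B (\<lambda>y. f y + g y) x = B f x + B g x) \<and>
     (\<forall>c. \<forall>f\<in>L2 M. AE x in M. B (\<lambda>y. c * f y) x = c * B f x) \<and>
     (\<exists>C. \<forall>f\<in>L2 M. L2norm M (B f) \<le> C * L2norm M f)"

definition C0_semigroup ::
    "'a measure \<Rightarrow> (real \<Rightarrow> ('a \<Rightarrow> complex) \<Rightarrow> ('a \<Rightarrow> complex)) \<Rightarrow> bool" where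
  "C0_semigroup M S \<longleftrightarrow>
     (\<forall>t\<ge>0. bounded_operator_L2 M (S t)) \<and>
     (\<forall>f\<in>L2 M. AE x in M. S 0 f x = f x) \<and>
     (\<forall>s\<ge>0. \<forall>t\<ge>0. \<forall>f\<in>L2 M. AE x in M. S (s + t) f x = S s (S t f) x) \<and>
     (\<forall>f\<in>L2 M. L2_tendsto M (\<lambda>h. S h f) f (at_right 0))"

text \<open>Unbounded operators are represented by their graphs, saturated under equality almost
  everywhere.\<close>

definition generator ::
    "'a measure \<Rightarrow> (real \<Rightarrow> ('a \<Rightarrow> complex) \<Rightarrow> ('a \<Rightarrow> complex))
       \<Rightarrow> (('a \<Rightarrow> complex) \<times> ('a \<Rightarrow> complex)) set" where
  "generator M S =
     {(f, g). f \<in> L2 M \<and>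
        L2_tendsto M (\<lambda>h x. (S h f x - f x) / complex_of_real h) g (at_right 0)}"

text \<open>As usual in one dimension (e.g. Brezis), weak derivatives are tested against \<open>C\<^sup>1\<close>
  functions with compact support in \<open>(0,1)\<close>, and higher order spaces are defined by iteration.
  Real-valued test functions suffice by linearity.\<close>

definition test_functions :: "(real \<Rightarrow> real) set" where
  "test_functions =
     {\<phi>. \<phi> C1_differentiable_on UNIV \<and>
          (\<exists>K. compact K \<and> K \<subseteq> {0<..<1} \<and> (\<forall>x. x \<notin> K \<longrightarrow> \<phi> x = 0))}"

definition weak_deriv :: "(real \<Rightarrow> complex) \<Rightarrow> (real \<Rightarrow> complex) \<Rightarrow> bool" where
  "weak_deriv f g \<longleftrightarrow> f \<in> L2 I01 \<and> g \<in> L2 I01 \<and>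
     (\<forall>\<phi>\<in>test_functions.
        (\<integral>x. deriv \<phi> x *\<^sub>R f x \<partial>I01) = - (\<integral>x. \<phi> x *\<^sub>R g x \<partial>I01))"

primrec weak_nth_deriv :: "nat \<Rightarrow> (real \<Rightarrow> complex) \<Rightarrow> (real \<Rightarrow> complex) \<Rightarrow> bool" where
  "weak_nth_deriv 0 f g \<longleftrightarrow> f \<in> L2 I01 \<and> g \<in> L2 I01 \<and> (AE x in I01. f x = g x)"
| "weak_nth_deriv (Suc k) f g \<longleftrightarrow> (\<exists>f'. weak_deriv f f' \<and> weak_nth_deriv k f' g)"

definition sobolev_H :: "nat \<Rightarrow> (real \<Rightarrow> complex) set" where
  "sobolev_H k = {f. \<exists>g. weak_nth_deriv k f g}"

text \<open>Point values on \<open>[0,1]\<close> of a Sobolev function are those of its continuous representative,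
  which is unique on \<open>[0,1]\<close>; \<open>point_deriv\<close> is one-sided at the end points.\<close>

definition cont_rep :: "(real \<Rightarrow> complex) \<Rightarrow> real \<Rightarrow> complex" where
  "cont_rep f x =
     (THE c. \<exists>V. continuous_on {0..1} V \<and> (AE y in I01. V y = f y) \<and> c = V x)"

definition point_deriv :: "(real \<Rightarrow> complex) \<Rightarrow> real \<Rightarrow> complex" where
  "point_deriv f x = vector_derivative (cont_rep f) (at x within {0..1})"

definition D_beta :: "real \<Rightarrow> (real \<Rightarrow> complex) set" where
  "D_beta \<beta> = {v \<in> sobolev_H 3. cont_rep v 0 = 0 \<and> cont_rep v 1 = 0 \<and>
                 point_deriv v 1 = complex_of_real \<beta> * point_deriv v 0}"

definition T_beta :: "real \<Rightarrow> ((real \<Rightarrow> complex) \<times> (real \<Rightarrow> complex)) set" where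
  "T_beta \<beta> = {(v, w). v \<in> D_beta \<beta> \<and>
                 (\<exists>v'''. weak_nth_deriv 3 v v''' \<and> w = (\<lambda>x. (- \<i>) ^ 3 * v''' x))}"

definition i_T_beta :: "real \<Rightarrow> ((real \<Rightarrow> complex) \<times> (real \<Rightarrow> complex)) set" where
  "i_T_beta \<beta> = {(v, \<lambda>x. \<i> * w x) | v w. (v, w) \<in> T_beta \<beta>}"

definition approx_data :: "real \<Rightarrow> (real \<Rightarrow> complex) \<Rightarrow> (nat \<Rightarrow> real \<Rightarrow> complex) \<Rightarrow> bool" where
  "approx_data \<beta> f v \<longleftrightarrow> (\<forall>n. v n \<in> D_beta \<beta>) \<and> L2_tendsto I01 v f sequentially"

text \<open>\<open>p\<close> is \<open>u\<^sub>x(0,\<cdot>)\<close> and \<open>q\<close> is \<open>u\<^sub>x\<close> (with arguments \<open>(x,s)\<close>) for \<open>u(\<cdot>,t) = S t f\<close>, as the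
  limits of the same quantities for classical solutions; the limit must be the same along all
  approximating sequences of initial data, and at least one such sequence must exist.\<close>

definition boundary_slope ::
    "real \<Rightarrow> (real \<Rightarrow> (real \<Rightarrow> complex) \<Rightarrow> (real \<Rightarrow> complex)) \<Rightarrow> (real \<Rightarrow> complex)
       \<Rightarrow> (real \<Rightarrow> complex) \<Rightarrow> bool" where
  "boundary_slope \<beta> S f p \<longleftrightarrow> (\<exists>v. approx_data \<beta> f v) \<and>
     (\<forall>v. approx_data \<beta> f v \<longrightarrow> (\<forall>t>0.
        L2_tendsto (lborel_on 0 t) (\<lambda>n s. point_deriv (S s (v n)) 0) p sequentially))"

definition interior_slope ::
    "real \<Rightarrow> (real \<Rightarrow> (real \<Rightarrow> complex) \<Rightarrow> (real \<Rightarrow> complex)) \<Rightarrow> (real \<Rightarrow> complex)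
       \<Rightarrow> (real \<times> real \<Rightarrow> complex) \<Rightarrow> bool" where
  "interior_slope \<beta> S f q \<longleftrightarrow> (\<exists>v. approx_data \<beta> f v) \<and>
     (\<forall>v. approx_data \<beta> f v \<longrightarrow> (\<forall>t>0.
        L2_tendsto (I01 \<Otimes>\<^sub>M lborel_on 0 t) (\<lambda>n (x, s). point_deriv (S s (v n)) x) q sequentially))"

text \<open>A real-valued version \<open>u(x,t)\<close> of the solution \<open>S t u\<^sub>0\<close>, together with \<open>p = u\<^sub>x(0,\<cdot>)\<close> and
  \<open>q = u\<^sub>x\<close>. The three functions are determined by \<open>u\<^sub>0\<close> up to null sets.\<close>

definition real_solution ::
    "real \<Rightarrow> (real \<Rightarrow> (real \<Rightarrow> complex) \<Rightarrow> (real \<Rightarrow> complex)) \<Rightarrow> (real \<Rightarrow> real)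
       \<Rightarrow> (real \<Rightarrow> real \<Rightarrow> real) \<Rightarrow> (real \<Rightarrow> real) \<Rightarrow> (real \<Rightarrow> real \<Rightarrow> real) \<Rightarrow> bool" where
  "real_solution \<beta> S u0 u p q \<longleftrightarrow>
     (\<forall>t\<ge>0. (\<lambda>x. complex_of_real (u x t)) \<in> L2 I01 \<and>
        (AE x in I01. S t (\<lambda>y. complex_of_real (u0 y)) x = complex_of_real (u x t))) \<and>
     boundary_slope \<beta> S (\<lambda>y. complex_of_real (u0 y)) (\<lambda>s. complex_of_real (p s)) \<and>
     interior_slope \<beta> S (\<lambda>y. complex_of_real (u0 y)) (\<lambda>(x, s). complex_of_real (q x s))"

end

theory Submission
  imports Defs
begin

text \<open>The three estimates are energy identities for classical solutions, carried over to all data by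
  density.

  For \<open>v\<close> in the domain, integration by parts and the boundary conditions give
  \<open>2 Re (- v''', v) = - (1 - \<beta>\<^sup>2) \<bar>v'(0)\<bar>\<^sup>2\<close> and, with the multiplier \<open>x\<close>,
  \<open>2 Re (- v''', x v) = - 3 \<parallel>v'\<parallel>\<^sup>2 + \<beta>\<^sup>2 \<bar>v'(0)\<bar>\<^sup>2\<close>. Along a classical solution the left-hand sides
  are the time derivatives of \<open>\<parallel>u\<parallel>\<^sup>2\<close> and of the integral of \<open>x \<bar>u\<bar>\<^sup>2\<close>. Integrating the first identity in
  time gives the contraction and bounds the integral of \<open>\<bar>u\<^sub>x(0,s)\<bar>\<^sup>2\<close> by \<open>\<parallel>u\<^sub>0\<parallel>\<^sup>2 / (1 - \<beta>\<^sup>2)\<close>; inserting this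
  bound in the second one gives the weighted estimate with
  \<open>1 + \<beta>\<^sup>2 / (1 - \<beta>\<^sup>2) = 1 / (1 - \<beta>\<^sup>2) \<le> 1 / (1 - \<beta>)\<close>. These are \<open>energy_identity\<close> and
  \<open>weighted_energy_identity\<close>.

  Decay comes with a rate: \<open>\<parallel>u(s)\<parallel>\<close> is non-increasing and at most \<open>\<parallel>u\<^sub>x(s)\<parallel>\<close> by Poincare's inequality,
  and the weighted estimate bounds the integral of \<open>\<parallel>u\<^sub>x(s)\<parallel>\<^sup>2\<close> over all times, so \<open>t \<parallel>u(t)\<parallel>\<^sup>2\<close> stays
  bounded by a multiple of \<open>\<parallel>u\<^sub>0\<parallel>\<^sup>2\<close>.

  Three things have to be supplied around this computation. First, elements of the domain are given by
  weak derivatives: \<open>weak_deriv_iff_primitive\<close> (du Bois-Reymond) turns them into \<open>C\<^sup>2\<close> functions whose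
  second derivative is a primitive of an \<open>L\<^sup>2\<close> function, and \<open>integral_by_parts_primitive\<close> is integration
  by parts for these. Second, orbits starting in the domain are differentiable in time on both sides,
  which rests on the local boundedness of the semigroup (\<open>locally_bounded\<close>). Third, smooth functions with
  compact support are dense (\<open>bump_functions_dense\<close>), so every real datum is the limit of real data in the
  domain. The same identities, applied to differences of solutions, show that the slopes of the
  approximations form Cauchy sequences in \<open>L\<^sup>2\<close>; completeness (\<open>L2_complete\<close>) provides their limits, and the
  limits do not depend on the sequence (\<open>trace_limit\<close>). Applied to the difference of a solution and its
  complex conjugate they show that real data have real solutions.\<close>

section \<open>Square-integrable functions\<close>

lemma L2D:
  assumes "f \<in> L2 M"
  shows L2_measurable: "f \<in> borel_measurable M"
    and L2_integrable_square: "integrable M (\<lambda>x. (cmod (f x))\<^sup>2)"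
  using assms by (auto simp: L2_def)

lemma L2_iff_nn_integral:
  "f \<in> L2 M \<longleftrightarrow> f \<in> borel_measurable M \<and> (\<integral>\<^sup>+x. ennreal ((cmod (f x))\<^sup>2) \<partial>M) < \<infinity>"
  by (auto simp: L2_def integrable_iff_bounded)

lemma nn_integral_eq_L2norm:
  assumes "f \<in> L2 M"
  shows "(\<integral>\<^sup>+x. ennreal ((cmod (f x))\<^sup>2) \<partial>M) = ennreal ((L2norm M f)\<^sup>2)"
  using L2_integrable_square[OF assms] unfolding L2norm_def
  by (subst nn_integral_eq_integral) auto

lemma L2norm_nonneg [simp]: "0 \<le> L2norm M f"
  unfolding L2norm_def by (intro real_sqrt_ge_zero integral_nonneg) auto

lemma L2norm_square: "(L2norm M f)\<^sup>2 = (\<integral>x. (cmod (f x))\<^sup>2 \<partial>M)"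
  unfolding L2norm_def by (simp add: integral_nonneg)

lemma L2norm_le_iff_nn_integral:
  assumes "f \<in> borel_measurable M" "0 \<le> c"
  shows "f \<in> L2 M \<and> L2norm M f \<le> c \<longleftrightarrow> (\<integral>\<^sup>+x. ennreal ((cmod (f x))\<^sup>2) \<partial>M) \<le> ennreal (c\<^sup>2)"
proof (cases "f \<in> L2 M")
  case True
  then show ?thesis
    using assms by (simp add: nn_integral_eq_L2norm power2_le_iff_abs_le)
next
  case False
  then show ?thesis using assms
    by (auto simp: L2_iff_nn_integral) (meson ennreal_less_top order_le_less_trans)
qed

lemma L2_mult_integrable:
  assumes "f \<in> L2 M" "g \<in> L2 M"
  shows "integrable M (\<lambda>x. f x * g x)"
proof (rule Bochner_Integration.integrable_bound)
  show "integrable M (\<lambda>x. (cmod (f x))\<^sup>2 + (cmod (g x))\<^sup>2)"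
    using assms by (intro Bochner_Integration.integrable_add L2_integrable_square)
  show "(\<lambda>x. f x * g x) \<in> borel_measurable M"
    using assms by (intro borel_measurable_times L2_measurable)
  have "norm (a * b) \<le> norm ((cmod a)\<^sup>2 + (cmod b)\<^sup>2)" for a b :: complex
  proof -
    have "2 * (cmod a * cmod b) \<le> (cmod a)\<^sup>2 + (cmod b)\<^sup>2"
      using sum_squares_bound[of "cmod a" "cmod b"] by simp
    moreover have "0 \<le> cmod a * cmod b" by simp
    ultimately have "cmod a * cmod b \<le> (cmod a)\<^sup>2 + (cmod b)\<^sup>2"
      by linarith
    then show ?thesis by (simp add: norm_mult)
  qed
  then show "AE x in M. norm (f x * g x) \<le> norm ((cmod (f x))\<^sup>2 + (cmod (g x))\<^sup>2)"
    by auto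
qed

lemma L2_cnj:
  assumes "f \<in> L2 M"
  shows "(\<lambda>x. cnj (f x)) \<in> L2 M"
proof -
  have "cnj \<in> borel_measurable borel"
    by (intro borel_measurable_continuous_onI continuous_intros)
  then have "(\<lambda>x. cnj (f x)) \<in> borel_measurable M"
    using measurable_compose[OF L2_measurable[OF assms]] by blast
  then show ?thesis
    using assms by (simp add: L2_def)
qed

lemma L2_scale: "f \<in> L2 M \<Longrightarrow> (\<lambda>x. c * f x) \<in> L2 M"
  unfolding L2_def by (auto simp: norm_mult power_mult_distrib)

lemma L2_add:
  assumes "f \<in> L2 M" "g \<in> L2 M"
  shows "(\<lambda>x. f x + g x) \<in> L2 M"
proof -
  have "integrable M (\<lambda>x. (cmod (f x + g x))\<^sup>2)"
  proof (rule Bochner_Integration.integrable_bound)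
    show "integrable M (\<lambda>x. 2 * (cmod (f x))\<^sup>2 + 2 * (cmod (g x))\<^sup>2)"
      using assms by (intro Bochner_Integration.integrable_add integrable_mult_right L2_integrable_square)
    show "(\<lambda>x. (cmod (f x + g x))\<^sup>2) \<in> borel_measurable M"
      using assms[THEN L2_measurable] by measurable
    have "norm ((cmod (a + b))\<^sup>2) \<le> norm (2 * (cmod a)\<^sup>2 + 2 * (cmod b)\<^sup>2)" for a b
    proof -
      have "(cmod (a + b))\<^sup>2 \<le> (cmod a + cmod b)\<^sup>2"
        by (intro power_mono norm_triangle_ineq) auto
      then show ?thesis
        using sum_squares_bound[of "cmod a" "cmod b"] by (simp add: power2_sum)
    qed
    then show "AE x in M. norm ((cmod (f x + g x))\<^sup>2) \<le> norm (2 * (cmod (f x))\<^sup>2 + 2 * (cmod (g x))\<^sup>2)"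
      by auto
  qed
  then show ?thesis
    using assms[THEN L2_measurable] by (auto simp: L2_def)
qed

lemma L2_minus: "f \<in> L2 M \<Longrightarrow> (\<lambda>x. - f x) \<in> L2 M"
  using L2_scale[of f M "-1"] by simp

lemma L2_diff: "f \<in> L2 M \<Longrightarrow> g \<in> L2 M \<Longrightarrow> (\<lambda>x. f x - g x) \<in> L2 M"
  using L2_add[OF _ L2_minus, of f M g] by simp

lemma L2_0: "(\<lambda>x. 0) \<in> L2 M"
  by (simp add: L2_def)

lemma L2_cong_AE:
  assumes "f \<in> L2 M" "g \<in> borel_measurable M" "AE x in M. f x = g x"
  shows "g \<in> L2 M"
proof -
  have "integrable M (\<lambda>x. (cmod (f x))\<^sup>2) \<longleftrightarrow> integrable M (\<lambda>x. (cmod (g x))\<^sup>2)"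
    using assms L2_measurable[OF assms(1)] by (intro integrable_cong_AE) auto
  then show ?thesis using assms by (auto simp: L2_def)
qed

lemma L2norm_cong_AE:
  assumes "f \<in> borel_measurable M" "g \<in> borel_measurable M" "AE x in M. f x = g x"
  shows "L2norm M f = L2norm M g"
proof -
  have "(\<integral>x. (cmod (f x))\<^sup>2 \<partial>M) = (\<integral>x. (cmod (g x))\<^sup>2 \<partial>M)"
    using assms by (intro integral_cong_AE) auto
  then show ?thesis by (simp add: L2norm_def)
qed

lemma L2norm_minus_commute: "L2norm M (\<lambda>x. f x - g x) = L2norm M (\<lambda>x. g x - f x)"
  unfolding L2norm_def by (simp add: norm_minus_commute)

lemma L2norm_eq_0D:
  assumes "f \<in> L2 M" "L2norm M f = 0"
  shows "AE x in M. f x = 0"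
proof -
  have "(\<integral>x. (cmod (f x))\<^sup>2 \<partial>M) = 0"
    using assms(2) by (simp add: L2norm_def)
  then show ?thesis
    using integral_nonneg_eq_0_iff_AE[OF L2_integrable_square[OF assms(1)]] by auto
qed

text \<open>Minkowski's inequality. With \<open>a > \<parallel>f\<parallel>\<close> and \<open>b > \<parallel>g\<parallel>\<close> the cross term is split by the
  weighted inequality \<open>2 s t \<le> (b/a) s\<^sup>2 + (a/b) t\<^sup>2\<close>, whose integral is exactly what the square of
  \<open>a + b\<close> allows.\<close>

lemma L2norm_triangle:
  assumes f: "f \<in> L2 M" and g: "g \<in> L2 M"
  shows "L2norm M (\<lambda>x. f x + g x) \<le> L2norm M f + L2norm M g"
proof (rule field_le_epsilon)
  fix e :: real assume e: "0 < e"
  define a where "a = L2norm M f + e / 2"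
  define b where "b = L2norm M g + e / 2"
  have ab: "0 < a" "0 < b" "L2norm M f \<le> a" "L2norm M g \<le> b"
    unfolding a_def b_def using e by (auto intro: add_nonneg_pos)
  have pw: "(cmod (u + v))\<^sup>2 \<le> (1 + b / a) * (cmod u)\<^sup>2 + (1 + a / b) * (cmod v)\<^sup>2" for u v
  proof -
    have "0 \<le> (b * cmod u - a * cmod v)\<^sup>2 / (a * b)" using ab by simp
    also have "\<dots> = b / a * (cmod u)\<^sup>2 + a / b * (cmod v)\<^sup>2 - 2 * cmod u * cmod v"
      using ab by (simp add: field_simps power2_eq_square)
    finally have "(cmod u + cmod v)\<^sup>2 \<le> (1 + b / a) * (cmod u)\<^sup>2 + (1 + a / b) * (cmod v)\<^sup>2"
      by (simp add: power2_sum algebra_simps)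
    moreover have "(cmod (u + v))\<^sup>2 \<le> (cmod u + cmod v)\<^sup>2"
      by (intro power_mono norm_triangle_ineq) auto
    ultimately show ?thesis by linarith
  qed
  have "(L2norm M (\<lambda>x. f x + g x))\<^sup>2 \<le> (\<integral>x. (1 + b / a) * (cmod (f x))\<^sup>2 + (1 + a / b) * (cmod (g x))\<^sup>2 \<partial>M)"
    unfolding L2norm_square
    using L2_integrable_square[OF L2_add[OF f g]] L2_integrable_square[OF f] L2_integrable_square[OF g]
    by (intro integral_mono Bochner_Integration.integrable_add integrable_mult_right pw)
  also have "\<dots> = (1 + b / a) * (L2norm M f)\<^sup>2 + (1 + a / b) * (L2norm M g)\<^sup>2"
    using L2_integrable_square[OF f] L2_integrable_square[OF g] by (simp add: L2norm_square)
  also have "\<dots> \<le> (1 + b / a) * a\<^sup>2 + (1 + a / b) * b\<^sup>2"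
    using ab by (intro add_mono mult_left_mono power_mono) auto
  also have "\<dots> = (a + b)\<^sup>2"
    using ab by (simp add: field_simps power2_eq_square)
  finally have "L2norm M (\<lambda>x. f x + g x) \<le> a + b"
    using ab by (simp add: power2_le_iff_abs_le)
  then show "L2norm M (\<lambda>x. f x + g x) \<le> L2norm M f + L2norm M g + e"
    by (simp add: a_def b_def)
qed

lemma L2norm_diff_triangle:
  assumes "f \<in> L2 M" "g \<in> L2 M" "h \<in> L2 M"
  shows "L2norm M (\<lambda>x. f x - h x) \<le> L2norm M (\<lambda>x. f x - g x) + L2norm M (\<lambda>x. g x - h x)"
  using L2norm_triangle[OF L2_diff[OF assms(1,2)] L2_diff[OF assms(2,3)]] by simp

lemma L2norm_diff_abs_le:
  assumes "f \<in> L2 M" "g \<in> L2 M"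
  shows "\<bar>L2norm M f - L2norm M g\<bar> \<le> L2norm M (\<lambda>x. f x - g x)"
  using L2norm_triangle[OF L2_diff[OF assms] assms(2)]
    L2norm_triangle[OF L2_diff[OF assms(2,1)] assms(1)]
  by (simp add: L2norm_minus_commute[of M f g])

lemma L2_tendsto_L2norm:
  assumes "L2_tendsto M F f A"
  shows "((\<lambda>n. L2norm M (F n)) \<longlongrightarrow> L2norm M f) A"
proof -
  have "\<forall>\<^sub>F n in A. norm (L2norm M (F n) - L2norm M f) \<le> L2norm M (\<lambda>x. F n x - f x)"
    using assms unfolding L2_tendsto_def
    by (auto elim!: eventually_mono intro: L2norm_diff_abs_le)
  then have "((\<lambda>n. L2norm M (F n) - L2norm M f) \<longlongrightarrow> 0) A"
    by (rule Lim_null_comparison) (use assms in \<open>simp add: L2_tendsto_def\<close>)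
  then show ?thesis by (simp add: LIM_zero_iff)
qed

text \<open>The Riesz--Fischer theorem. Along a subsequence the increments \<open>d k\<close> have \<open>\<parallel>d k\<parallel> < 2\<^sup>-\<^sup>k\<close>, so
  \<open>\<Sum> 2\<^sup>k \<bar>d k\<bar>\<^sup>2\<close> has a finite integral and is finite almost everywhere; hence the increments
  decay geometrically at almost every point and the subsequence converges there. Fatou's lemma
  turns the pointwise limit into an \<open>L\<^sup>2\<close> limit of the whole sequence.\<close>

lemma L2_complete:
  fixes F :: "nat \<Rightarrow> 'a \<Rightarrow> complex"
  assumes F: "\<And>n. F n \<in> L2 M"
    and Cauchy: "\<And>e. 0 < e \<Longrightarrow> \<exists>N. \<forall>m\<ge>N. \<forall>n\<ge>N. L2norm M (\<lambda>x. F m x - F n x) < e"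
  shows "\<exists>f. L2_tendsto M F f sequentially"
proof -
  have "\<forall>k. \<exists>N. \<forall>m\<ge>N. \<forall>n\<ge>N. L2norm M (\<lambda>x. F m x - F n x) < (1/2)^k"
    using Cauchy by simp
  then obtain N where N: "\<And>k m n. m \<ge> N k \<Longrightarrow> n \<ge> N k \<Longrightarrow> L2norm M (\<lambda>x. F m x - F n x) < (1/2)^k"
    by metis
  \<comment> \<open>The sum makes \<open>r k\<close> at least \<open>N k\<close> and monotone in \<open>k\<close>, the summand \<open>k\<close> makes it unbounded.\<close>
  define r where "r k = k + (\<Sum>i\<le>k. N i)" for k
  have rN: "N k \<le> r k" for k
    unfolding r_def by (simp add: trans_le_add2 member_le_sum)
  have rmono: "r k \<le> r (Suc k)" and rge: "k \<le> r k" for k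
    unfolding r_def by auto
  define d where "d k x = F (r (Suc k)) x - F (r k) x" for k x
  have dm[measurable]: "d k \<in> borel_measurable M" for k
    unfolding d_def using F[THEN L2_measurable] by measurable
  have dL: "d k \<in> L2 M" for k
    unfolding d_def using F by (intro L2_diff)
  have dn: "L2norm M (d k) < (1/2)^k" for k
    unfolding d_def using N[of k "r (Suc k)" "r k"] rN[of k] rmono[of k] by auto
  have "(\<integral>\<^sup>+x. (\<Sum>k. ennreal (2^k * (cmod (d k x))\<^sup>2)) \<partial>M)
      = (\<Sum>k. \<integral>\<^sup>+x. ennreal (2^k * (cmod (d k x))\<^sup>2) \<partial>M)"
    by (intro nn_integral_suminf) measurable
  also have "\<dots> \<le> (\<Sum>k. ennreal ((1/2)^k))"
  proof (intro suminf_le summableI)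
    fix k
    have "(\<integral>\<^sup>+x. ennreal (2^k * (cmod (d k x))\<^sup>2) \<partial>M) = ennreal (2^k) * ennreal ((L2norm M (d k))\<^sup>2)"
      by (simp add: ennreal_mult nn_integral_cmult nn_integral_eq_L2norm[OF dL])
    also have "\<dots> \<le> ennreal (2^k) * ennreal (((1/2)^k)\<^sup>2)"
      using dn[of k] by (intro mult_left_mono ennreal_leI power_mono) auto
    also have "\<dots> = ennreal ((1/2)^k)"
      by (simp add: ennreal_mult[symmetric] power2_eq_square power_mult_distrib[symmetric] mult.assoc[symmetric])
    finally show "(\<integral>\<^sup>+x. ennreal (2^k * (cmod (d k x))\<^sup>2) \<partial>M) \<le> ennreal ((1/2)^k)" .
  qed
  also have "\<dots> < \<infinity>"
    by (subst suminf_ennreal2) (auto simp: summable_geometric)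
  finally have "AE x in M. (\<Sum>k. ennreal (2^k * (cmod (d k x))\<^sup>2)) \<noteq> \<infinity>"
    by (intro nn_integral_PInf_AE) auto
  moreover have "convergent (\<lambda>k. F (r k) x)" if fin: "(\<Sum>k. ennreal (2^k * (cmod (d k x))\<^sup>2)) \<noteq> \<infinity>" for x
  proof -
    have "summable (\<lambda>k. 2^k * (cmod (d k x))\<^sup>2)"
      using fin by (intro summable_suminf_not_top) auto
    then have "(\<lambda>k. 2^k * (cmod (d k x))\<^sup>2) \<longlonglongrightarrow> 0"
      by (rule summable_LIMSEQ_zero)
    then have ev: "\<forall>\<^sub>F k in sequentially. 2^k * (cmod (d k x))\<^sup>2 < 1"
      by (rule order_tendstoD) simp
    have "\<forall>\<^sub>F k in sequentially. norm (d k x) \<le> (sqrt (1/2))^k"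
      using ev
    proof (eventually_elim)
      case (elim k)
      \<comment> \<open>From \<open>2\<^sup>k \<bar>d k\<bar>\<^sup>2 < 1\<close> the increments are dominated by a geometric series of ratio \<open>sqrt (1/2)\<close>.\<close>
      have "((sqrt (1/2))^k)\<^sup>2 = ((sqrt (1/2))\<^sup>2)^k"
        by (simp only: power_mult[symmetric] mult.commute)
      also have "\<dots> = (1/2)^k" by simp
      finally have "(cmod (d k x))\<^sup>2 \<le> ((sqrt (1/2))^k)\<^sup>2"
        using elim by (simp only:) (simp add: power_one_over field_simps)
      then show ?case by (rule power2_le_imp_le) simp
    qed
    then have "summable (\<lambda>k. d k x)"
      by (rule summable_comparison_test_ev) (auto intro!: summable_geometric)
    then have "convergent (\<lambda>n. \<Sum>k<n. d k x)"
      by (simp add: summable_iff_convergent)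
    then have "convergent (\<lambda>n. (\<Sum>k<n. d k x) + F (r 0) x)"
      by (rule convergent_add) (rule convergent_const)
    then show ?thesis
      unfolding d_def by (subst (asm) sum_lessThan_telescope) simp
  qed
  ultimately have conv: "AE x in M. convergent (\<lambda>k. F (r k) x)"
    by auto
  define f where "f x = lim (\<lambda>k. F (r k) x)" for x
  have fm[measurable]: "f \<in> borel_measurable M"
    unfolding f_def using F[THEN L2_measurable] by measurable
  have est: "F n \<in> L2 M \<and> (\<lambda>x. F n x - f x) \<in> L2 M \<and> L2norm M (\<lambda>x. F n x - f x) \<le> (1/2)^k"
    if n: "n \<ge> N k" for n k
  proof -
    have "(\<integral>\<^sup>+x. ennreal ((cmod (F n x - f x))\<^sup>2) \<partial>M)
        = (\<integral>\<^sup>+x. liminf (\<lambda>j. ennreal ((cmod (F n x - F (r j) x))\<^sup>2)) \<partial>M)"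
      using conv
    proof (intro nn_integral_cong_AE, eventually_elim)
      case (elim x)
      then have "(\<lambda>j. F (r j) x) \<longlonglongrightarrow> f x"
        unfolding f_def by (simp add: convergent_LIMSEQ_iff)
      then have "(\<lambda>j. ennreal ((cmod (F n x - F (r j) x))\<^sup>2)) \<longlonglongrightarrow> ennreal ((cmod (F n x - f x))\<^sup>2)"
        by (intro tendsto_ennrealI tendsto_intros)
      then show ?case
        using lim_imp_Liminf[OF sequentially_bot] by metis
    qed
    also have "\<dots> \<le> liminf (\<lambda>j. \<integral>\<^sup>+x. ennreal ((cmod (F n x - F (r j) x))\<^sup>2) \<partial>M)"
      using F[THEN L2_measurable] by (intro nn_integral_liminf) measurable
    also have "\<dots> \<le> ennreal (((1/2)^k)\<^sup>2)"
    proof (rule Liminf_le)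
      show "\<forall>\<^sub>F j in sequentially. (\<integral>\<^sup>+x. ennreal ((cmod (F n x - F (r j) x))\<^sup>2) \<partial>M) \<le> ennreal (((1/2)^k)\<^sup>2)"
        using eventually_ge_at_top[of "N k"]
      proof eventually_elim
        case (elim j)
        have "L2norm M (\<lambda>x. F n x - F (r j) x) \<le> (1/2)^k"
          using N[of k n "r j"] n elim rge[of j] by simp
        then show ?case
          by (subst nn_integral_eq_L2norm) (auto intro!: L2_diff F ennreal_leI power_mono)
      qed
    qed simp
    finally show ?thesis
      using F L2norm_le_iff_nn_integral[of "\<lambda>x. F n x - f x" M "(1/2)^k"] L2_measurable[OF F] by auto
  qed
  have fL: "f \<in> L2 M"
    using L2_diff[of "F (N 0)" M "\<lambda>x. F (N 0) x - f x"] est[of 0 "N 0"] by simp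
  have "(\<lambda>n. L2norm M (\<lambda>x. F n x - f x)) \<longlonglongrightarrow> 0"
  proof (rule LIMSEQ_I)
    fix e :: real assume "0 < e"
    then obtain k where k: "(1/2)^k < e"
      using real_arch_pow_inv[of e "1/2"] by auto
    show "\<exists>no. \<forall>n\<ge>no. norm (L2norm M (\<lambda>x. F n x - f x) - 0) < e"
      using est[of k] k by (intro exI[of _ "N k"]) force
  qed
  then show ?thesis
    using F fL unfolding L2_tendsto_def by auto
qed

text \<open>The measure \<open>M\<close> is dominated by \<open>N\<close>; this is how limits on an unbounded time interval are restricted
  to bounded ones.\<close>

lemma L2_mono_measure:
  assumes meas: "\<And>f :: 'a \<Rightarrow> complex. f \<in> borel_measurable N \<Longrightarrow> f \<in> borel_measurable M"
    and le: "\<And>f :: 'a \<Rightarrow> ennreal. f \<in> borel_measurable N \<Longrightarrow> (\<integral>\<^sup>+x. f x \<partial>M) \<le> (\<integral>\<^sup>+x. f x \<partial>N)"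
    and f: "f \<in> L2 N"
  shows "f \<in> L2 M \<and> L2norm M f \<le> L2norm N f"
proof -
  have "(\<integral>\<^sup>+x. ennreal ((cmod (f x))\<^sup>2) \<partial>M) \<le> (\<integral>\<^sup>+x. ennreal ((cmod (f x))\<^sup>2) \<partial>N)"
    using L2_measurable[OF f] by (intro le) measurable
  also have "\<dots> = ennreal ((L2norm N f)\<^sup>2)"
    using f by (rule nn_integral_eq_L2norm)
  finally show ?thesis
    using L2norm_le_iff_nn_integral[OF meas[OF L2_measurable[OF f]], of "L2norm N f"] by auto
qed

lemma L2_tendsto_mono_measure:
  fixes M N :: "'a measure"
  assumes meas: "\<And>f :: 'a \<Rightarrow> complex. f \<in> borel_measurable N \<Longrightarrow> f \<in> borel_measurable M"
    and le: "\<And>f :: 'a \<Rightarrow> ennreal. f \<in> borel_measurable N \<Longrightarrow> (\<integral>\<^sup>+x. f x \<partial>M) \<le> (\<integral>\<^sup>+x. f x \<partial>N)"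
    and lim: "L2_tendsto N F f A"
  shows "L2_tendsto M F f A"
proof -
  note mono = L2_mono_measure[of N M, OF meas le]
  have "\<forall>\<^sub>F n in A. norm (L2norm M (\<lambda>x. F n x - f x)) \<le> L2norm N (\<lambda>x. F n x - f x)"
    using lim unfolding L2_tendsto_def
    by (auto elim!: eventually_mono intro: L2_diff mono[THEN conjunct2])
  then have "((\<lambda>n. L2norm M (\<lambda>x. F n x - f x)) \<longlongrightarrow> 0) A"
    by (rule Lim_null_comparison) (use lim in \<open>simp add: L2_tendsto_def\<close>)
  moreover have "\<forall>\<^sub>F n in A. F n \<in> L2 M"
    using lim unfolding L2_tendsto_def by (auto elim!: eventually_mono intro: mono[THEN conjunct1])
  ultimately show ?thesis
    using lim mono unfolding L2_tendsto_def by auto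
qed

text \<open>This is what makes limits independent of the approximating sequence.\<close>

lemma L2_tendsto_transfer:
  assumes F: "L2_tendsto M F f A" and G: "\<And>n. G n \<in> L2 M"
    and close: "((\<lambda>n. L2norm M (\<lambda>x. G n x - F n x)) \<longlongrightarrow> 0) A"
  shows "L2_tendsto M G f A"
proof -
  have "\<forall>\<^sub>F n in A. norm (L2norm M (\<lambda>x. G n x - f x))
      \<le> L2norm M (\<lambda>x. G n x - F n x) + L2norm M (\<lambda>x. F n x - f x)"
    using F unfolding L2_tendsto_def
    by (auto elim!: eventually_mono intro!: L2norm_diff_triangle G)
  moreover have "((\<lambda>n. L2norm M (\<lambda>x. G n x - F n x) + L2norm M (\<lambda>x. F n x - f x)) \<longlongrightarrow> 0) A"
    using F close unfolding L2_tendsto_def by (intro tendsto_add_zero) auto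
  ultimately have "((\<lambda>n. L2norm M (\<lambda>x. G n x - f x)) \<longlongrightarrow> 0) A"
    by (rule Lim_null_comparison)
  then show ?thesis
    using F G unfolding L2_tendsto_def by auto
qed

lemma L2_cong_space:
  assumes "\<And>x. x \<in> space M \<Longrightarrow> f x = g x"
  shows "f \<in> L2 M \<longleftrightarrow> g \<in> L2 M" "L2norm M f = L2norm M g"
proof -
  have "f \<in> borel_measurable M \<longleftrightarrow> g \<in> borel_measurable M"
    using assms by (rule measurable_cong)
  moreover have "integrable M (\<lambda>x. (cmod (f x))\<^sup>2) \<longleftrightarrow> integrable M (\<lambda>x. (cmod (g x))\<^sup>2)"
    by (intro Bochner_Integration.integrable_cong refl) (simp add: assms)
  ultimately show "f \<in> L2 M \<longleftrightarrow> g \<in> L2 M" by (simp add: L2_def)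
  have "(\<integral>x. (cmod (f x))\<^sup>2 \<partial>M) = (\<integral>x. (cmod (g x))\<^sup>2 \<partial>M)"
    by (intro Bochner_Integration.integral_cong refl) (simp add: assms)
  then show "L2norm M f = L2norm M g" by (simp add: L2norm_def)
qed

lemma L2_tendsto_cong_space:
  assumes "\<And>n x. x \<in> space M \<Longrightarrow> F n x = G n x"
  shows "L2_tendsto M F f A \<longleftrightarrow> L2_tendsto M G f A"
proof -
  have "F n \<in> L2 M \<longleftrightarrow> G n \<in> L2 M" "L2norm M (\<lambda>x. F n x - f x) = L2norm M (\<lambda>x. G n x - f x)" for n
    using assms by (intro L2_cong_space; simp)+
  then show ?thesis by (simp add: L2_tendsto_def)
qed

text \<open>Replacing the limit by its real part does not increase its distance to a real function.\<close>

lemma L2_tendsto_Re: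
  assumes lim: "L2_tendsto M F f A" and F: "\<And>n x. x \<in> space M \<Longrightarrow> Im (F n x) = 0"
  shows "L2_tendsto M F (\<lambda>x. complex_of_real (Re (f x))) A"
proof -
  have f: "f \<in> L2 M" using lim by (simp add: L2_tendsto_def)
  have Ref: "(\<lambda>x. complex_of_real (Re (f x))) \<in> L2 M"
  proof -
    have "(\<lambda>x. (1 / 2) * (f x + cnj (f x))) \<in> L2 M" by (intro L2_scale L2_add L2_cnj f)
    moreover have "(1 / 2) * (z + cnj z) = complex_of_real (Re z)" for z by (simp add: complex_eq_iff)
    ultimately show ?thesis by simp
  qed
  have "\<forall>\<^sub>F n in A. norm (L2norm M (\<lambda>x. F n x - complex_of_real (Re (f x)))) \<le> L2norm M (\<lambda>x. F n x - f x)"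
    using lim[unfolded L2_tendsto_def, THEN conjunct1]
  proof eventually_elim
    case (elim n)
    have "(L2norm M (\<lambda>x. F n x - complex_of_real (Re (f x))))\<^sup>2 \<le> (L2norm M (\<lambda>x. F n x - f x))\<^sup>2"
      unfolding L2norm_square
    proof (rule integral_mono)
      show "integrable M (\<lambda>x. (cmod (F n x - complex_of_real (Re (f x))))\<^sup>2)" "integrable M (\<lambda>x. (cmod (F n x - f x))\<^sup>2)"
        using elim f Ref by (auto intro!: L2_integrable_square L2_diff)
      fix x assume "x \<in> space M"
      then have "F n x - complex_of_real (Re (f x)) = complex_of_real (Re (F n x - f x))"
        using F by (simp add: complex_eq_iff)
      then show "(cmod (F n x - complex_of_real (Re (f x))))\<^sup>2 \<le> (cmod (F n x - f x))\<^sup>2"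
        using abs_Re_le_cmod[of "F n x - f x"] by (simp add: power2_le_iff_abs_le del: minus_complex.sel)
    qed
    then show ?case by (simp add: power2_le_iff_abs_le)
  qed
  then have "((\<lambda>n. L2norm M (\<lambda>x. F n x - complex_of_real (Re (f x)))) \<longlongrightarrow> 0) A"
    by (rule Lim_null_comparison) (use lim in \<open>simp add: L2_tendsto_def\<close>)
  then show ?thesis using lim Ref by (simp add: L2_tendsto_def)
qed

section \<open>The Hilbert space \<open>L\<^sup>2(0,1)\<close>\<close>

text \<open>Passing to classes modulo equality almost everywhere gives a complete inner product space as a
  type, so that vector-valued derivatives and limits become available for the semigroup.
  The inner product is the real part of the usual one, since
  energy identities are statements about real parts.\<close>

quotient_type l2 = "real \<Rightarrow> complex" / partial:
  "\<lambda>f g. f \<in> L2 I01 \<and> g \<in> L2 I01 \<and> (AE x in I01. f x = g x)"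
  morphisms rep cls
proof (rule part_equivpI)
  show "\<exists>f. f \<in> L2 I01 \<and> f \<in> L2 I01 \<and> (AE x in I01. f x = f x)"
    using L2_0 by blast
qed (auto intro!: sympI transpI)

lemma cls_eq_iff:
  assumes "f \<in> L2 I01" "g \<in> L2 I01"
  shows "cls f = cls g \<longleftrightarrow> (AE x in I01. f x = g x)"
  using Quotient3_rel[OF Quotient3_l2, of f g] assms by auto

lemma cls_rep [simp]: "cls (rep F) = F"
  using Quotient3_abs_rep[OF Quotient3_l2] .

lemma rep_L2 [simp]: "rep F \<in> L2 I01"
  using Quotient3_rep_reflp[OF Quotient3_l2, of F] by auto

lemma rep_cls:
  assumes "f \<in> L2 I01"
  shows "AE x in I01. rep (cls f) x = f x"
  using cls_eq_iff[OF rep_L2 assms, of "cls f"] by simp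

lemma inner_integrable:
  assumes "f \<in> L2 M" "g \<in> L2 M"
  shows "integrable M (\<lambda>x. Re (f x * cnj (g x)))"
  by (rule integrable_Re[OF L2_mult_integrable[OF assms(1) L2_cnj[OF assms(2)]]])

instantiation l2 :: real_inner
begin

lift_definition zero_l2 :: l2 is "\<lambda>x. 0"
  by (simp add: L2_0)

lift_definition plus_l2 :: "l2 \<Rightarrow> l2 \<Rightarrow> l2" is "\<lambda>f g x. f x + g x"
  by (auto intro: L2_add)

lift_definition minus_l2 :: "l2 \<Rightarrow> l2 \<Rightarrow> l2" is "\<lambda>f g x. f x - g x"
  by (auto intro: L2_diff)

lift_definition uminus_l2 :: "l2 \<Rightarrow> l2" is "\<lambda>f x. - f x"
  by (auto intro: L2_minus)

lift_definition scaleR_l2 :: "real \<Rightarrow> l2 \<Rightarrow> l2" is "\<lambda>r f x. complex_of_real r * f x"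
  by (auto intro: L2_scale)

lift_definition inner_l2 :: "l2 \<Rightarrow> l2 \<Rightarrow> real" is "\<lambda>f g. \<integral>x. Re (f x * cnj (g x)) \<partial>I01"
proof -
  fix f f' g g' :: "real \<Rightarrow> complex"
  assume f: "f \<in> L2 I01 \<and> f' \<in> L2 I01 \<and> (AE x in I01. f x = f' x)"
    and g: "g \<in> L2 I01 \<and> g' \<in> L2 I01 \<and> (AE x in I01. g x = g' x)"
  have "AE x in I01. f x = f' x" "AE x in I01. g x = g' x"
    using f g by auto
  then have "AE x in I01. Re (f x * cnj (g x)) = Re (f' x * cnj (g' x))"
    by eventually_elim simp
  then show "(\<integral>x. Re (f x * cnj (g x)) \<partial>I01) = (\<integral>x. Re (f' x * cnj (g' x)) \<partial>I01)"
    using f g by (intro integral_cong_AE borel_measurable_integrable inner_integrable) auto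
qed

definition norm_l2 :: "l2 \<Rightarrow> real" where "norm_l2 F = sqrt (inner F F)"
definition dist_l2 :: "l2 \<Rightarrow> l2 \<Rightarrow> real" where "dist_l2 F G = norm (F - G)"
definition sgn_l2 :: "l2 \<Rightarrow> l2" where "sgn_l2 F = inverse (norm F) *\<^sub>R F"
definition uniformity_l2 :: "(l2 \<times> l2) filter" where
  "uniformity_l2 = (INF e\<in>{0<..}. principal {(x, y). dist x y < e})"
definition open_l2 :: "l2 set \<Rightarrow> bool" where
  "open_l2 U \<longleftrightarrow> (\<forall>x\<in>U. eventually (\<lambda>(x', y). x' = x \<longrightarrow> y \<in> U) uniformity)"

instance
proof
  fix F G H :: l2 and a b r :: real
  show "F + G + H = F + (G + H)"
    by transfer (auto intro!: L2_add simp: add.assoc)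
  show "F + G = G + F"
    by transfer (auto intro!: L2_add simp: add.commute)
  show "0 + F = F"
    by transfer auto
  show "- F + F = 0"
    by transfer (auto intro!: L2_0)
  show "F - G = F + - G"
    by transfer (auto intro!: L2_diff)
  show "a *\<^sub>R (F + G) = a *\<^sub>R F + a *\<^sub>R G"
    by transfer (auto intro!: L2_add L2_scale simp: distrib_left distrib_right mult.assoc)
  show "(a + b) *\<^sub>R F = a *\<^sub>R F + b *\<^sub>R F"
    by transfer (auto intro!: L2_add L2_scale simp: distrib_left distrib_right mult.assoc)
  show "a *\<^sub>R b *\<^sub>R F = (a * b) *\<^sub>R F"
    by transfer (auto intro!: L2_add L2_scale simp: distrib_left distrib_right mult.assoc)
  show "1 *\<^sub>R F = F"
    by transfer auto
  show "inner F G = inner G F"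
    by transfer (auto intro!: Bochner_Integration.integral_cong simp: algebra_simps)
  show "inner (F + G) H = inner F H + inner G H"
  proof transfer
    fix f g h :: "real \<Rightarrow> complex"
    assume "f \<in> L2 I01 \<and> f \<in> L2 I01 \<and> (AE x in I01. f x = f x)"
      "g \<in> L2 I01 \<and> g \<in> L2 I01 \<and> (AE x in I01. g x = g x)"
      "h \<in> L2 I01 \<and> h \<in> L2 I01 \<and> (AE x in I01. h x = h x)"
    then have "integrable I01 (\<lambda>x. Re (f x * cnj (h x)))" "integrable I01 (\<lambda>x. Re (g x * cnj (h x)))"
      using inner_integrable by blast+
    from Bochner_Integration.integral_add[OF this]
    show "(\<integral>x. Re ((f x + g x) * cnj (h x)) \<partial>I01)
      = (\<integral>x. Re (f x * cnj (h x)) \<partial>I01) + (\<integral>x. Re (g x * cnj (h x)) \<partial>I01)"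
      by (simp only: distrib_right plus_complex.sel)
  qed
  show "inner (r *\<^sub>R F) G = r * inner F G"
  proof transfer
    fix r :: real and f g :: "real \<Rightarrow> complex"
    have "Re (complex_of_real r * f x * cnj (g x)) = r * Re (f x * cnj (g x))" for x
      by (simp add: algebra_simps)
    then show "(\<integral>x. Re (complex_of_real r * f x * cnj (g x)) \<partial>I01)
      = r * (\<integral>x. Re (f x * cnj (g x)) \<partial>I01)"
      by (simp only: integral_mult_right_zero)
  qed
  have sq: "Re (z * cnj z) = (cmod z)\<^sup>2" for z
    by (simp only: complex_norm_square[symmetric] Re_complex_of_real)
  show "0 \<le> inner F F"
    by transfer (simp only: sq, simp add: integral_nonneg)
  show "inner F F = 0 \<longleftrightarrow> F = 0"
  proof transfer
    fix f :: "real \<Rightarrow> complex"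
    assume "f \<in> L2 I01 \<and> f \<in> L2 I01 \<and> (AE x in I01. f x = f x)"
    then have f: "f \<in> L2 I01" by simp
    show "(\<integral>x. Re (f x * cnj (f x)) \<partial>I01) = 0
      \<longleftrightarrow> f \<in> L2 I01 \<and> (\<lambda>x. 0) \<in> L2 I01 \<and> (AE x in I01. f x = 0)"
      unfolding sq using f integral_nonneg_eq_0_iff_AE[OF L2_integrable_square[OF f]] L2_0 by auto
  qed
qed (simp_all add: norm_l2_def dist_l2_def sgn_l2_def uniformity_l2_def open_l2_def)

end

lemma Re_mult_cnj_self: "Re (z * cnj z) = (cmod z)\<^sup>2"
  by (simp only: complex_norm_square[symmetric] Re_complex_of_real)

lemma inner_cls:
  assumes "f \<in> L2 I01" "g \<in> L2 I01"
  shows "inner (cls f) (cls g) = (\<integral>x. Re (f x * cnj (g x)) \<partial>I01)"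
  using assms by (intro inner_l2.abs_eq) (auto simp: eq_onp_def)

lemma norm_cls:
  assumes "f \<in> L2 I01"
  shows "norm (cls f) = L2norm I01 f"
  by (simp only: norm_eq_sqrt_inner[where 'a = l2] inner_cls assms Re_mult_cnj_self L2norm_def)

lemma cls_add: "f \<in> L2 I01 \<Longrightarrow> g \<in> L2 I01 \<Longrightarrow> cls (\<lambda>x. f x + g x) = cls f + cls g"
  by (subst plus_l2.abs_eq) (auto simp: eq_onp_def)

lemma cls_diff: "f \<in> L2 I01 \<Longrightarrow> g \<in> L2 I01 \<Longrightarrow> cls (\<lambda>x. f x - g x) = cls f - cls g"
  by (subst minus_l2.abs_eq) (auto simp: eq_onp_def)

lemma cls_scaleR: "f \<in> L2 I01 \<Longrightarrow> cls (\<lambda>x. complex_of_real r * f x) = r *\<^sub>R cls f"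
  by (subst scaleR_l2.abs_eq) (auto simp: eq_onp_def)

lemma cls_zero: "cls (\<lambda>x. 0) = 0"
  by (simp add: zero_l2.abs_eq)

lemma norm_cls_diff:
  assumes "f \<in> L2 I01" "g \<in> L2 I01"
  shows "norm (cls f - cls g) = L2norm I01 (\<lambda>x. f x - g x)"
  using norm_cls[OF L2_diff[OF assms]] cls_diff[OF assms] by simp

lemma L2_tendsto_imp_cls_tendsto:
  assumes "L2_tendsto I01 F f A"
  shows "((\<lambda>n. cls (F n)) \<longlongrightarrow> cls f) A"
proof -
  have "\<forall>\<^sub>F n in A. norm (cls (F n) - cls f) \<le> L2norm I01 (\<lambda>x. F n x - f x)"
    using assms unfolding L2_tendsto_def
    by (auto elim!: eventually_mono simp: norm_cls_diff)
  then have "((\<lambda>n. cls (F n) - cls f) \<longlongrightarrow> 0) A"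
    by (rule Lim_null_comparison) (use assms in \<open>simp add: L2_tendsto_def\<close>)
  then show ?thesis by (simp add: LIM_zero_iff)
qed

lemma cls_tendsto_imp_L2_tendsto:
  assumes F: "\<And>n. F n \<in> L2 I01" and f: "f \<in> L2 I01" and lim: "((\<lambda>n. cls (F n)) \<longlongrightarrow> cls f) A"
  shows "L2_tendsto I01 F f A"
proof -
  have "((\<lambda>n. norm (cls (F n) - cls f)) \<longlongrightarrow> 0) A"
    using lim by (simp add: LIM_zero_iff tendsto_norm_zero)
  then show ?thesis
    using F f by (simp add: L2_tendsto_def norm_cls_diff)
qed

instance l2 :: banach
proof
  fix X :: "nat \<Rightarrow> l2"
  assume "Cauchy X"
  then have "\<exists>N. \<forall>m\<ge>N. \<forall>n\<ge>N. L2norm I01 (\<lambda>x. rep (X m) x - rep (X n) x) < e" if "0 < e" for e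
    using that by (auto simp: Cauchy_iff norm_cls_diff[symmetric])
  from L2_complete[OF rep_L2 this]
  obtain f where "L2_tendsto I01 (\<lambda>n. rep (X n)) f sequentially" by blast
  from L2_tendsto_imp_cls_tendsto[OF this] show "convergent X"
    by (auto simp: convergent_def)
qed

lift_definition conj_l2 :: "l2 \<Rightarrow> l2" is "\<lambda>f x. cnj (f x)"
  by (auto intro: L2_cnj)

lemma cls_cnj: "f \<in> L2 I01 \<Longrightarrow> cls (\<lambda>x. cnj (f x)) = conj_l2 (cls f)"
  by (subst conj_l2.abs_eq) (auto simp: eq_onp_def)

lemma space_I01 [simp]: "space I01 = {0<..<1}"
  by (simp add: lborel_on_def)

lemma AE_I01_bounds: "AE x in I01. 0 < x \<and> x < 1"
  using AE_space[of I01] by auto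

lemma L2_I01_weight:
  assumes "f \<in> L2 I01"
  shows "(\<lambda>x. complex_of_real x * f x) \<in> L2 I01"
proof -
  have [measurable]: "(\<lambda>x. x) \<in> borel_measurable I01"
    unfolding lborel_on_def by (intro measurable_restrict_space1) simp
  have m: "(\<lambda>x. complex_of_real x * f x) \<in> borel_measurable I01"
    using L2_measurable[OF assms] by measurable
  have "integrable I01 (\<lambda>x. (cmod (complex_of_real x * f x))\<^sup>2)"
  proof (rule Bochner_Integration.integrable_bound[OF L2_integrable_square[OF assms]])
    show "(\<lambda>x. (cmod (complex_of_real x * f x))\<^sup>2) \<in> borel_measurable I01"
      using m by measurable
    show "AE x in I01. norm ((cmod (complex_of_real x * f x))\<^sup>2) \<le> norm ((cmod (f x))\<^sup>2)"
      using AE_I01_bounds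
    proof eventually_elim
      case (elim x)
      then have "cmod (complex_of_real x * f x) \<le> cmod (f x)"
        by (simp add: norm_mult mult_left_le_one_le)
      then show ?case by (simp add: power_mono)
    qed
  qed
  with m show ?thesis by (simp add: L2_def)
qed

lift_definition weight_l2 :: "l2 \<Rightarrow> l2" is "\<lambda>f x. complex_of_real x * f x"
  by (auto intro: L2_I01_weight)

lemma cls_weight: "f \<in> L2 I01 \<Longrightarrow> cls (\<lambda>x. complex_of_real x * f x) = weight_l2 (cls f)"
  by (subst weight_l2.abs_eq) (auto simp: eq_onp_def)

lemma bounded_linear_conj_l2: "bounded_linear conj_l2"
proof (rule bounded_linear_intro[where K = 1])
  fix F G :: l2 and r :: real
  show "conj_l2 (F + G) = conj_l2 F + conj_l2 G"
    by transfer (auto intro!: L2_add L2_cnj)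
  show "conj_l2 (r *\<^sub>R F) = r *\<^sub>R conj_l2 F"
    by transfer (auto intro!: L2_scale L2_cnj)
  have "norm (conj_l2 F) = norm F"
    unfolding norm_eq_sqrt_inner by transfer (simp add: mult.commute)
  then show "norm (conj_l2 F) \<le> norm F * 1" by simp
qed

lemma weight_l2_le:
  "0 \<le> inner (weight_l2 F) F" "inner (weight_l2 F) F \<le> (norm F)\<^sup>2"
proof -
  define f where "f = rep F"
  have f: "f \<in> L2 I01" and F: "F = cls f" by (simp_all add: f_def)
  have eq: "inner (weight_l2 F) F = (\<integral>x. x * (cmod (f x))\<^sup>2 \<partial>I01)"
    unfolding F cls_weight[OF f, symmetric] inner_cls[OF L2_I01_weight[OF f] f]
    by (simp only: mult.assoc Re_complex_of_real complex_norm_square[symmetric] of_real_mult[symmetric])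
  have int: "integrable I01 (\<lambda>x. x * (cmod (f x))\<^sup>2)"
    using inner_integrable[OF L2_I01_weight[OF f] f]
    by (simp only: mult.assoc Re_complex_of_real complex_norm_square[symmetric] of_real_mult[symmetric])
  have nonneg: "AE x in I01. 0 \<le> x * (cmod (f x))\<^sup>2" and le: "AE x in I01. x * (cmod (f x))\<^sup>2 \<le> (cmod (f x))\<^sup>2"
    using AE_I01_bounds by (auto simp: mult_left_le_one_le)
  show "0 \<le> inner (weight_l2 F) F"
    unfolding eq by (rule integral_nonneg_AE[OF nonneg])
  have "(norm F)\<^sup>2 = (\<integral>x. (cmod (f x))\<^sup>2 \<partial>I01)"
    unfolding F norm_cls[OF f] by (rule L2norm_square)
  then show "inner (weight_l2 F) F \<le> (norm F)\<^sup>2"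
    unfolding eq using integral_mono_AE[OF int L2_integrable_square[OF f] le] by simp
qed

lemma inner_weight_l2:
  assumes "f \<in> L2 I01" "g \<in> L2 I01"
  shows "inner (weight_l2 (cls f)) (cls g) = (\<integral>x. x * Re (f x * cnj (g x)) \<partial>I01)"
  unfolding cls_weight[OF assms(1), symmetric] inner_cls[OF L2_I01_weight[OF assms(1)] assms(2)]
  by (simp add: algebra_simps)

lemma inner_weight_l2_commute: "inner (weight_l2 F) G = inner (weight_l2 G) F"
  by transfer (auto intro!: Bochner_Integration.integral_cong simp: algebra_simps)

lemma bounded_linear_weight_l2: "bounded_linear weight_l2"
proof (rule bounded_linear_intro[where K = 1])
  fix F G :: l2 and r :: real
  show "weight_l2 (F + G) = weight_l2 F + weight_l2 G"
    by transfer (auto intro!: L2_add L2_I01_weight simp: distrib_left)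
  show "weight_l2 (r *\<^sub>R F) = r *\<^sub>R weight_l2 F"
    by transfer (auto intro!: L2_scale L2_I01_weight)
  define f where "f = rep F"
  have f: "f \<in> L2 I01" and F: "F = cls f" by (simp_all add: f_def)
  have le: "AE x in I01. (cmod (complex_of_real x * f x))\<^sup>2 \<le> (cmod (f x))\<^sup>2"
    using AE_I01_bounds
    by eventually_elim (auto intro!: power_mono simp: norm_mult mult_left_le_one_le)
  have "(L2norm I01 (\<lambda>x. complex_of_real x * f x))\<^sup>2 \<le> (L2norm I01 f)\<^sup>2"
    unfolding L2norm_square
    by (rule integral_mono_AE[OF L2_integrable_square[OF L2_I01_weight[OF f]] L2_integrable_square[OF f] le])
  then show "norm (weight_l2 F) \<le> norm F * 1"
    unfolding F cls_weight[OF f, symmetric] norm_cls[OF L2_I01_weight[OF f]] norm_cls[OF f]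
    by (simp add: power2_le_iff_abs_le)
qed

section \<open>Strongly continuous semigroups\<close>

locale strongly_continuous_semigroup =
  fixes T :: "real \<Rightarrow> 'a::banach \<Rightarrow> 'a"
  assumes bounded_linear_T: "0 \<le> t \<Longrightarrow> bounded_linear (T t)"
    and T_zero [simp]: "T 0 f = f"
    and T_add: "0 \<le> s \<Longrightarrow> 0 \<le> t \<Longrightarrow> T (s + t) f = T s (T t f)"
    and T_tendsto_right: "((\<lambda>h. T h f) \<longlongrightarrow> f) (at_right 0)"
begin

text \<open>Boundedness of \<open>T\<close> near time \<open>0\<close> is an instance of the uniform boundedness principle. If it
  failed, there would be times \<open>t n\<close> tending to \<open>0\<close> with \<open>\<parallel>T (t n)\<parallel> > 4\<^sup>n\<close>. Moving by \<open>3\<^sup>-\<^sup>n\<close> in a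
  suitable direction at step \<open>n\<close> makes \<open>\<parallel>T (t n) x\<parallel>\<close> comparable to \<open>3\<^sup>-\<^sup>n \<parallel>T (t n)\<parallel>\<close>, and all later moves
  together are too short to undo this; the limit \<open>y\<close> then has \<open>T (t n) y\<close> unbounded, against
  continuity at \<open>0\<close>.\<close>

lemma locally_bounded:
  "\<exists>\<delta>>0. \<exists>K. \<forall>h. 0 \<le> h \<and> h \<le> \<delta> \<longrightarrow> (\<forall>f. norm (T h f) \<le> K * norm f)"
proof (rule ccontr)
  assume neg: "\<not> ?thesis"
  have "\<exists>h f. 0 \<le> h \<and> h \<le> 1 / real (Suc n) \<and> norm (T h f) > 4 ^ n * norm f" for n
    using neg by (meson not_le zero_less_divide_1_iff of_nat_0_less_iff zero_less_Suc)
  then obtain t where t: "\<And>n. 0 \<le> t n" "\<And>n. t n \<le> 1 / real (Suc n)"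
    and "\<forall>n. \<exists>f. norm (T (t n) f) > 4 ^ n * norm f"
    by metis
  then have big: "\<exists>f. norm (T (t n) f) > 4 ^ n * norm f" for n by blast
  have tpos: "0 < t n" for n
  proof (rule ccontr)
    assume "\<not> 0 < t n"
    then have "t n = 0" using t(1)[of n] by simp
    then obtain f :: 'a where "norm f > 4 ^ n * norm f" using big[of n] by auto
    moreover have "1 * norm f \<le> 4 ^ n * norm f" by (intro mult_right_mono) auto
    ultimately show False by simp
  qed
  have harmonic: "(\<lambda>n. 1 / real (Suc n)) \<longlonglongrightarrow> 0"
    using LIMSEQ_inverse_real_of_nat by (simp add: inverse_eq_divide)
  have "t \<longlonglongrightarrow> 0"
    by (rule tendsto_sandwich[OF _ _ tendsto_const harmonic]) (use t in \<open>auto intro!: always_eventually\<close>)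
  then have tlim: "filterlim t (at_right 0) sequentially"
    using tpos less_imp_neq[OF tpos] by (auto simp: filterlim_at intro!: always_eventually)
  \<comment> \<open>The gliding hump: from any \<open>x\<close> one of \<open>x + y\<close> and \<open>x - y\<close> has an image at least as long as that of \<open>y\<close>,
    and \<open>y\<close> of length \<open>r\<close> may be chosen with image longer than two thirds of \<open>r \<parallel>T (t n)\<parallel>\<close>.\<close>
  define N where "N n = onorm (T (t n))" for n
  have bl: "bounded_linear (T (t n))" for n using t(1) by (rule bounded_linear_T)
  have N_gt: "4 ^ n < N n" for n
  proof -
    obtain f where f: "norm (T (t n) f) > 4 ^ n * norm f" using big by blast
    also have "norm (T (t n) f) \<le> N n * norm f" unfolding N_def by (rule onorm[OF bl])
    finally have "(4 ^ n - N n) * norm f < 0" by (simp add: algebra_simps)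
    then show ?thesis by (simp add: mult_less_0_iff)
  qed
  then have N_pos: "0 < N n" for n using less_trans[OF zero_less_power] by (metis zero_less_numeral)
  have step: "\<exists>x'. norm (x' - x) \<le> r \<and> norm (T (t n) x') \<ge> 2 / 3 * r * N n" if r: "0 < r" for r x n
  proof -
    have "\<exists>f. norm (T (t n) f) > 2 / 3 * N n * norm f"
    proof (rule ccontr)
      assume "\<not> ?thesis"
      then have "N n \<le> 2 / 3 * N n"
        unfolding N_def using N_pos[of n] by (intro onorm_bound) (auto simp: not_less N_def)
      then show False using N_pos[of n] by simp
    qed
    then obtain f where f: "norm (T (t n) f) > 2 / 3 * N n * norm f" by blast
    have f0: "norm f > 0" using f bounded_linear.linear[OF bl, THEN linear_0] by fastforce
    define y where "y = (r / norm f) *\<^sub>R f"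
    have ny: "norm y = r" using f0 r by (simp add: y_def)
    have "norm (T (t n) y) = r / norm f * norm (T (t n) f)"
      using f0 r by (simp add: y_def linear_scale[OF bounded_linear.linear[OF bl]])
    moreover have "r / norm f * (2 / 3 * N n * norm f) \<le> r / norm f * norm (T (t n) f)"
      using f f0 r by (intro mult_left_mono) auto
    moreover have "r / norm f * (2 / 3 * N n * norm f) = 2 / 3 * r * N n"
      using f0 by simp
    ultimately have Ty: "norm (T (t n) y) \<ge> 2 / 3 * r * N n"
      by linarith
    have "T (t n) (x + y) - T (t n) (x - y) = 2 *\<^sub>R T (t n) y"
      by (simp add: linear_add[OF bounded_linear.linear[OF bl]]
          linear_diff[OF bounded_linear.linear[OF bl]] scaleR_2)
    then have "2 * norm (T (t n) y) \<le> norm (T (t n) (x + y)) + norm (T (t n) (x - y))"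
      by (metis norm_triangle_ineq4 norm_scaleR abs_numeral)
    then have "norm (T (t n) (x + y)) \<ge> 2 / 3 * r * N n \<or> norm (T (t n) (x - y)) \<ge> 2 / 3 * r * N n"
      using Ty by linarith
    then show ?thesis
    proof
      assume "norm (T (t n) (x + y)) \<ge> 2 / 3 * r * N n"
      then show ?thesis using ny by (intro exI[of _ "x + y"]) simp
    next
      assume "norm (T (t n) (x - y)) \<ge> 2 / 3 * r * N n"
      then show ?thesis using ny by (intro exI[of _ "x - y"]) simp
    qed
  qed
  have "\<exists>x. \<forall>n. True \<and> (norm (x (Suc n) - x n) \<le> (1/3) ^ Suc n
      \<and> norm (T (t n) (x (Suc n))) \<ge> 2 / 3 * (1/3) ^ Suc n * N n)"
  proof (rule dependent_nat_choice)
    fix x n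
    show "\<exists>y. True \<and> (norm (y - x) \<le> (1/3) ^ Suc n \<and> norm (T (t n) y) \<ge> 2 / 3 * (1/3) ^ Suc n * N n)"
      using step[of "(1/3) ^ Suc n" x n] by simp
  qed simp
  then obtain x where x1: "\<And>n. norm (x (Suc n) - x n) \<le> (1/3) ^ Suc n"
    and x2: "\<And>n. norm (T (t n) (x (Suc n))) \<ge> 2 / 3 * (1/3) ^ Suc n * N n"
    by blast
  have tail: "norm (x (n + k) - x n) \<le> (1/3) ^ n / 2 * (1 - (1/3) ^ k)" for n k
  proof (induction k)
    case (Suc k)
    have "norm (x (n + Suc k) - x n) \<le> norm (x (Suc (n + k)) - x (n + k)) + norm (x (n + k) - x n)"
      using norm_triangle_ineq[of "x (Suc (n + k)) - x (n + k)" "x (n + k) - x n"] by simp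
    also have "\<dots> \<le> (1/3) ^ Suc (n + k) + (1/3) ^ n / 2 * (1 - (1/3) ^ k)"
      using x1[of "n + k"] Suc by (rule add_mono)
    also have "\<dots> = (1/3) ^ n / 2 * (1 - (1/3) ^ Suc k)"
      by (simp add: power_add field_simps)
    finally show ?case .
  qed simp
  have tail': "norm (x m - x n) \<le> (1/3) ^ n / 2" if "n \<le> m" for m n
  proof -
    have "norm (x m - x n) \<le> (1/3) ^ n / 2 * (1 - (1/3) ^ (m - n))"
      using tail[of n "m - n"] that by simp
    also have "\<dots> \<le> (1/3) ^ n / 2 * 1" by (intro mult_left_mono) auto
    finally show ?thesis by simp
  qed
  have "Cauchy x"
  proof (rule metric_CauchyI)
    fix e :: real assume "0 < e"
    then obtain n where n: "(1/3) ^ n < e" using real_arch_pow_inv[of e "1/3"] by auto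
    have "dist (x i) (x j) < e" if "n \<le> i" "n \<le> j" for i j
      using tail'[OF that(1)] tail'[OF that(2)] n dist_triangle2[of "x i" "x j" "x n"]
      by (simp add: dist_norm)
    then show "\<exists>M. \<forall>m\<ge>M. \<forall>n\<ge>M. dist (x m) (x n) < e" by blast
  qed
  then obtain y where y: "x \<longlonglongrightarrow> y" using Cauchy_convergent_iff convergentD by blast
  have y_tail: "norm (y - x n) \<le> (1/3) ^ n / 2" for n
  proof (rule Lim_bounded)
    show "(\<lambda>m. norm (x m - x n)) \<longlonglongrightarrow> norm (y - x n)" by (intro tendsto_intros y)
    show "\<forall>m\<ge>n. norm (x m - x n) \<le> (1/3) ^ n / 2" using tail' by blast
  qed
  \<comment> \<open>The image of all later moves together is at most half of \<open>(1/3)^(n+1) \<parallel>T (t n)\<parallel>\<close>, which leaves a sixth of the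
    two thirds gained at step \<open>n\<close>.\<close>
  have lower: "(4/3) ^ n / 18 \<le> norm (T (t n) y)" for n
  proof -
    have "norm (T (t n) (y - x (Suc n))) \<le> N n * norm (y - x (Suc n))"
      unfolding N_def by (rule onorm[OF bl])
    also have "\<dots> \<le> N n * ((1/3) ^ Suc n / 2)"
      using N_pos[of n] y_tail[of "Suc n"] by (intro mult_left_mono) auto
    finally have "norm (T (t n) (y - x (Suc n))) \<le> 1 / 2 * (1/3) ^ Suc n * N n"
      by (simp add: mult_ac)
    moreover have "norm (T (t n) (x (Suc n))) \<le> norm (T (t n) y) + norm (T (t n) (y - x (Suc n)))"
      using norm_triangle_ineq4[of "T (t n) y" "T (t n) (y - x (Suc n))"]
      by (simp add: linear_diff[OF bounded_linear.linear[OF bl]])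
    ultimately have "1 / 6 * (1/3) ^ Suc n * N n \<le> norm (T (t n) y)"
      using x2[of n] by linarith
    moreover have "1 / 6 * (1/3) ^ Suc n * 4 ^ n \<le> 1 / 6 * (1/3) ^ Suc n * N n"
      using N_gt[of n] by (intro mult_left_mono) auto
    moreover have "1 / 6 * (1/3) ^ Suc n * 4 ^ n = (4/3 :: real) ^ n / 18"
      by (simp add: power_divide)
    ultimately show ?thesis by linarith
  qed
  have "(\<lambda>n. norm (T (t n) y)) \<longlonglongrightarrow> norm y"
    by (intro tendsto_norm filterlim_compose[OF T_tendsto_right tlim])
  then have "Bseq (\<lambda>n. norm (T (t n) y))" by (intro convergent_imp_Bseq convergentI)
  then obtain B where B: "\<And>n. norm (T (t n) y) \<le> B" unfolding Bseq_def by auto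
  obtain n where "(4/3 :: real) ^ n > 18 * B" using real_arch_pow[of "4/3"] by auto
  then show False using lower[of n] B[of n] by simp
qed

lemma bounded_on_intervals:
  "\<exists>K\<ge>0. \<forall>h. 0 \<le> h \<and> h \<le> b \<longrightarrow> (\<forall>f. norm (T h f) \<le> K * norm f)"
proof -
  obtain \<delta> K0 where \<delta>: "0 < \<delta>" and K0: "\<And>h f. 0 \<le> h \<Longrightarrow> h \<le> \<delta> \<Longrightarrow> norm (T h f) \<le> K0 * norm f"
    using locally_bounded by blast
  define K where "K = max 1 K0"
  have K: "norm (T h f) \<le> K * norm f" if "0 \<le> h" "h \<le> \<delta>" for h f
    using K0[OF that, of f] mult_right_mono[of K0 K "norm f"] by (simp add: K_def)
  have K1: "1 \<le> K" by (simp add: K_def)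
  have "norm (T h f) \<le> K ^ Suc n * norm f" if "0 \<le> h" "h \<le> real (Suc n) * \<delta>" for n h f
    using that
  proof (induction n arbitrary: h)
    case (Suc n)
    show ?case
    proof (cases "h \<le> \<delta>")
      case True
      have "norm (T h f) \<le> K * norm f" using K Suc True by simp
      also have "\<dots> \<le> K ^ Suc (Suc n) * norm f"
        using K1 power_increasing[of 1 "Suc (Suc n)" K] by (intro mult_right_mono) auto
      finally show ?thesis .
    next
      case False
      have "T h f = T \<delta> (T (h - \<delta>) f)" using T_add[of \<delta> "h - \<delta>" f] False \<delta> by simp
      then have "norm (T h f) \<le> K * norm (T (h - \<delta>) f)" using K[of \<delta>] \<delta> by simp
      also have "\<dots> \<le> K * (K ^ Suc n * norm f)"
        using K1 False Suc by (intro mult_left_mono Suc.IH) (auto simp: algebra_simps)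
      finally show ?thesis by (simp add: mult_ac)
    qed
  qed (use K in simp)
  moreover obtain n where "b / \<delta> \<le> real n" using real_arch_simple by blast
  then have "b \<le> real (Suc n) * \<delta>" using \<delta> by (simp add: field_simps)
  ultimately show ?thesis using K1
    by (intro exI[of _ "K ^ Suc n"]) (auto intro: order_trans)
qed

text \<open>Differences between the times \<open>s\<close> and \<open>t\<close> are written as the image under \<open>T (min s t)\<close> of a
  difference at time \<open>\<bar>s - t\<bar>\<close>, so that both sides of \<open>t\<close> are treated at once; the following bound is the
  uniform control which this requires.\<close>

lemma bounded_near:
  "\<exists>K\<ge>0. \<forall>s f. 0 \<le> s \<and> \<bar>s - t\<bar> \<le> 1 \<longrightarrow> norm (T (min s t) f) \<le> K * norm f" if "0 \<le> t"
proof -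
  obtain K where "0 \<le> K" and K: "\<And>h f. 0 \<le> h \<Longrightarrow> h \<le> t \<Longrightarrow> norm (T h f) \<le> K * norm f"
    using bounded_on_intervals[of t] by blast
  then show ?thesis using that by (intro exI[of _ K]) auto
qed

lemma filterlim_abs_diff_at_right:
  "filterlim (\<lambda>s :: real. \<bar>s - t\<bar>) (at_right 0) (at t within S)"
proof -
  have "((\<lambda>s. \<bar>s - t\<bar>) \<longlongrightarrow> \<bar>t - t\<bar>) (at t within S)"
    by (intro tendsto_intros)
  then show ?thesis
    by (auto simp: filterlim_at eventually_at_filter)
qed

lemma eventually_near: "\<forall>\<^sub>F s in at t within {0..}. 0 \<le> s \<and> s \<noteq> t \<and> \<bar>s - t\<bar> \<le> (1::real)"
  by (auto simp: eventually_at dist_real_def intro!: exI[of _ 1])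

lemma T_split:
  assumes "0 \<le> s" "0 \<le> t"
  shows "T (max s t) f = T (min s t) (T \<bar>s - t\<bar> f)"
  using T_add[of "min s t" "\<bar>s - t\<bar>" f] assms by (auto simp: min_def max_def abs_if)

lemma continuous_orbit: "continuous_on {0..} (\<lambda>t. T t f)"
  unfolding continuous_on_def
proof
  fix t :: real assume t: "t \<in> {0..}"
  obtain K where K: "\<And>s f. 0 \<le> s \<Longrightarrow> \<bar>s - t\<bar> \<le> 1 \<Longrightarrow> norm (T (min s t) f) \<le> K * norm f"
    using bounded_near[of t] t by auto
  have "\<forall>\<^sub>F s in at t within {0..}. norm (T s f - T t f) \<le> K * norm (T \<bar>s - t\<bar> f - f)"
    using eventually_near
  proof eventually_elim
    case (elim s)
    have "norm (T s f - T t f) = norm (T (max s t) f - T (min s t) f)"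
      by (auto simp: min_def max_def norm_minus_commute)
    also have "\<dots> = norm (T (min s t) (T \<bar>s - t\<bar> f - f))"
      using elim t by (simp add: T_split linear_diff[OF bounded_linear.linear[OF bounded_linear_T]])
    also have "\<dots> \<le> K * norm (T \<bar>s - t\<bar> f - f)"
      using elim by (intro K) auto
    finally show ?case .
  qed
  moreover have "((\<lambda>s. K * norm (T \<bar>s - t\<bar> f - f)) \<longlongrightarrow> K * norm (f - f)) (at t within {0..})"
    by (intro tendsto_intros filterlim_compose[OF T_tendsto_right filterlim_abs_diff_at_right])
  ultimately have "((\<lambda>s. T s f - T t f) \<longlongrightarrow> 0) (at t within {0..})"
    by (intro Lim_null_comparison[where f = "\<lambda>s. T s f - T t f"]) auto
  then show "((\<lambda>s. T s f) \<longlongrightarrow> T t f) (at t within {0..})"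
    by (simp add: LIM_zero_iff)
qed

lemma generator_invariant:
  assumes g: "((\<lambda>h. (T h f - f) /\<^sub>R h) \<longlongrightarrow> g) (at_right 0)" and t: "0 \<le> t"
  shows "((\<lambda>h. (T h (T t f) - T t f) /\<^sub>R h) \<longlongrightarrow> T t g) (at_right 0)"
proof (rule Lim_transform_eventually)
  show "((\<lambda>h. T t ((T h f - f) /\<^sub>R h)) \<longlongrightarrow> T t g) (at_right 0)"
    using bounded_linear.tendsto[OF bounded_linear_T[OF t] g] .
  show "\<forall>\<^sub>F h in at_right 0. T t ((T h f - f) /\<^sub>R h) = (T h (T t f) - T t f) /\<^sub>R h"
    using eventually_at_right_less[of "0::real"]
  proof eventually_elim
    case (elim h)
    then show ?case
      using t T_add[of t h f] T_add[of h t f]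
      by (simp add: linear_diff[OF bounded_linear.linear[OF bounded_linear_T]]
          linear_scale[OF bounded_linear.linear[OF bounded_linear_T]] add.commute)
  qed
qed

text \<open>The generator is defined by derivatives from the right at time \<open>0\<close> only. To the left of \<open>t\<close> the
  difference quotient of the orbit is \<open>T s\<close>, with \<open>s < t\<close> varying, applied to the quotient at \<open>0\<close>; it
  converges because these operators are uniformly bounded and \<open>T s g\<close> is continuous in \<open>s\<close>.\<close>

lemma orbit_has_vector_derivative:
  assumes g: "((\<lambda>h. (T h f - f) /\<^sub>R h) \<longlongrightarrow> g) (at_right 0)" and t: "0 \<le> t"
  shows "((\<lambda>s. T s f) has_vector_derivative T t g) (at t within {0..})"
proof -
  obtain K where K: "\<And>s f. 0 \<le> s \<Longrightarrow> \<bar>s - t\<bar> \<le> 1 \<Longrightarrow> norm (T (min s t) f) \<le> K * norm f"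
    using bounded_near[of t] t by auto
  let ?e = "\<lambda>s. (1 / norm (s - t)) *\<^sub>R (T s f - (T t f + (s - t) *\<^sub>R T t g))"
  have "\<forall>\<^sub>F s in at t within {0..}. norm (?e s)
      \<le> K * norm ((T \<bar>s - t\<bar> f - f) /\<^sub>R \<bar>s - t\<bar> - g) + norm (T (min s t) g - T t g)"
    using eventually_near
  proof eventually_elim
    case (elim s)
    define h where "h = \<bar>s - t\<bar>"
    have h: "0 < h" using elim by (simp add: h_def)
    have m: "0 \<le> min s t" using elim t by simp
    note lin = bounded_linear.linear[OF bounded_linear_T[OF m]]
    have split: "T (max s t) f = T (min s t) (T h f)"
      unfolding h_def using elim t by (intro T_split) auto
    have "norm (T s f - (T t f + (s - t) *\<^sub>R T t g)) = norm (T (max s t) f - T (min s t) f - h *\<^sub>R T t g)"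
    proof (cases "s \<le> t")
      case True
      then have "T s f - (T t f + (s - t) *\<^sub>R T t g) = - (T (max s t) f - T (min s t) f - h *\<^sub>R T t g)"
        by (simp add: h_def algebra_simps)
      then show ?thesis by (simp only: norm_minus_cancel)
    next
      case False
      then show ?thesis by (simp add: h_def algebra_simps)
    qed
    then have "norm (?e s) = norm ((1 / h) *\<^sub>R (T (max s t) f - T (min s t) f - h *\<^sub>R T t g))"
      by (simp add: h_def)
    also have "(1 / h) *\<^sub>R (T (max s t) f - T (min s t) f - h *\<^sub>R T t g)
        = T (min s t) ((T h f - f) /\<^sub>R h - g) + (T (min s t) g - T t g)"
      using h by (simp add: split linear_add[OF lin] linear_diff[OF lin] linear_scale[OF lin] algebra_simps inverse_eq_divide)
    also have "norm \<dots> \<le> norm (T (min s t) ((T h f - f) /\<^sub>R h - g)) + norm (T (min s t) g - T t g)"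
      by (rule norm_triangle_ineq)
    also have "\<dots> \<le> K * norm ((T h f - f) /\<^sub>R h - g) + norm (T (min s t) g - T t g)"
      using elim by (intro add_right_mono K) auto
    finally show ?case by (simp only: h_def)
  qed
  moreover have "((\<lambda>s. K * norm ((T \<bar>s - t\<bar> f - f) /\<^sub>R \<bar>s - t\<bar> - g) + norm (T (min s t) g - T t g))
      \<longlongrightarrow> K * norm (g - g) + norm (T t g - T t g)) (at t within {0..})"
  proof (intro tendsto_intros filterlim_compose[OF g filterlim_abs_diff_at_right])
    have "continuous_on {0..} (\<lambda>s. T (min s t) g)"
      by (rule continuous_on_compose2[OF continuous_orbit[of g]]) (use t in \<open>auto intro!: continuous_intros\<close>)
    then show "((\<lambda>s. T (min s t) g) \<longlongrightarrow> T t g) (at t within {0..})"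
      using t by (auto simp: continuous_on_def dest!: bspec[of _ _ t])
  qed
  ultimately have "(?e \<longlongrightarrow> 0) (at t within {0..})"
    by (intro Lim_null_comparison[where f = ?e]) auto
  then show ?thesis
    unfolding has_vector_derivative_def has_derivative_within
    by (simp add: bounded_linear_scaleR_left)
qed

end

section \<open>Integration over the unit interval\<close>

lemma sets_lborel_on: "sets (lborel_on a b) = sets (restrict_space borel {a<..<b})"
  unfolding lborel_on_def by (rule sets_restrict_space_cong) simp

lemma space_lborel_on [simp]: "space (lborel_on a b) = {a<..<b}"
  by (simp add: lborel_on_def)

lemma measurable_lborel_on_continuous:
  assumes "continuous_on {a<..<b} f"
  shows "f \<in> borel_measurable (lborel_on a b)"
  using borel_measurable_continuous_on_restrict[OF assms]
  by (simp add: measurable_cong_sets[OF sets_lborel_on refl])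

lemma finite_measure_lborel_on: "finite_measure (lborel_on a b)"
  unfolding lborel_on_def
  using emeasure_bounded_finite[of "{a<..<b}"]
  by (intro finite_measureI) (simp add: emeasure_restrict_space)

interpretation I01: finite_measure I01
  by (rule finite_measure_lborel_on)

interpretation I01_pair: pair_sigma_finite I01 I01
  by (simp add: pair_sigma_finite_def I01.sigma_finite_measure_axioms)

lemma measure_I01 [simp]: "measure I01 {0<..<1} = 1"
  by (simp add: lborel_on_def measure_restrict_space)

lemma AE_I01_neq: "AE y in I01. y \<noteq> x"
  unfolding lborel_on_def using AE_lborel_singleton[of x]
  by (subst AE_restrict_space_iff) (auto elim: eventually_mono)

lemma const_L2_I01: "(\<lambda>x. c) \<in> L2 I01"
  by (simp add: L2_def I01.integrable_const)

lemma L2_I01_dominated: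
  assumes w: "w \<in> L2 I01" and f: "f \<in> borel_measurable I01"
    and le: "AE x in I01. cmod (f x) \<le> C * cmod (w x)"
  shows "f \<in> L2 I01"
proof -
  have "integrable I01 (\<lambda>x. (cmod (f x))\<^sup>2)"
  proof (rule Bochner_Integration.integrable_bound)
    show "integrable I01 (\<lambda>x. C\<^sup>2 * (cmod (w x))\<^sup>2)"
      using L2_integrable_square[OF w] by simp
    show "AE x in I01. norm ((cmod (f x))\<^sup>2) \<le> norm (C\<^sup>2 * (cmod (w x))\<^sup>2)"
      using le
    proof eventually_elim
      case (elim x)
      from power_mono[OF this, of 2] show ?case by (simp add: power_mult_distrib)
    qed
  qed (use f in measurable)
  then show ?thesis using f by (simp add: L2_def)
qed

lemma bounded_L2_I01:
  assumes "f \<in> borel_measurable I01" "\<And>x. 0 < x \<Longrightarrow> x < 1 \<Longrightarrow> cmod (f x) \<le> B"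
  shows "f \<in> L2 I01"
  by (rule L2_I01_dominated[OF const_L2_I01[of 1] assms(1), of B])
    (use AE_I01_bounds assms(2) in auto)

lemma continuous_L2_I01:
  assumes "continuous_on {0..1} f"
  shows "f \<in> L2 I01"
proof -
  have "bounded (f ` {0..1})"
    by (intro compact_imp_bounded compact_continuous_image assms compact_Icc)
  then have "\<exists>B. \<forall>x\<in>{0..1}. cmod (f x) \<le> B"
    unfolding bounded_iff by auto
  then obtain B where "\<And>x. x \<in> {0..1} \<Longrightarrow> cmod (f x) \<le> B"
    by blast
  then show ?thesis
    by (intro bounded_L2_I01[where B = B] measurable_lborel_on_continuous continuous_on_subset[OF assms]) auto
qed

lemma L2_imp_integrable:
  assumes "f \<in> L2 I01"
  shows "integrable I01 f"
  using L2_mult_integrable[OF assms const_L2_I01[of 1]] by simp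

text \<open>The Cauchy-Schwarz inequality against a constant function, on a space of total mass one; the
  constant is the integral itself, which fixes the phase.\<close>

lemma cmod_integral_le_L2norm:
  assumes f: "f \<in> L2 I01"
  shows "cmod (\<integral>x. f x \<partial>I01) \<le> L2norm I01 f"
proof -
  define z where "z = (\<integral>x. f x \<partial>I01)"
  have "(cmod z)\<^sup>2 = Re (z * cnj z)"
    by (simp only: Re_mult_cnj_self)
  also have "\<dots> = Re (\<integral>x. f x * cnj z \<partial>I01)"
    by (simp only: integral_mult_left_zero z_def)
  also have "\<dots> = (\<integral>x. Re (f x * cnj z) \<partial>I01)"
    using L2_imp_integrable[OF f] by (intro integral_Re[symmetric] integrable_mult_left)
  also have "\<dots> = inner (cls f) (cls (\<lambda>_. z))"
    by (rule inner_cls[OF f const_L2_I01, symmetric])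
  also have "\<dots> \<le> L2norm I01 f * L2norm I01 (\<lambda>_. z)"
    using norm_cauchy_schwarz[of "cls f" "cls (\<lambda>_. z)"] by (simp add: norm_cls f const_L2_I01)
  also have "L2norm I01 (\<lambda>_. z) = cmod z"
    by (simp add: L2norm_def)
  finally have "cmod z * cmod z \<le> L2norm I01 f * cmod z"
    by (simp add: power2_eq_square)
  then show ?thesis
    by (cases "z = 0") (auto simp: z_def)
qed

lemma L2_dominated_convergence:
  assumes w: "w \<in> L2 I01" and F: "\<And>n. F n \<in> borel_measurable I01" and f: "f \<in> borel_measurable I01"
    and le: "\<And>n x. 0 < x \<Longrightarrow> x < 1 \<Longrightarrow> cmod (F n x) \<le> C * cmod (w x)"
    and lim: "AE x in I01. (\<lambda>n. F n x) \<longlonglongrightarrow> f x"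
  shows "f \<in> L2 I01" "(\<lambda>n. cls (F n)) \<longlonglongrightarrow> cls f"
proof -
  have FL: "F n \<in> L2 I01" for n
    by (rule L2_I01_dominated[OF w F, where C = C]) (use AE_I01_bounds le in auto)
  have fle: "AE x in I01. cmod (f x) \<le> C * cmod (w x)"
    using lim AE_I01_bounds
  proof eventually_elim
    case (elim x)
    then show ?case by (intro Lim_bounded[OF tendsto_norm[OF elim(1)]]) (use le in auto)
  qed
  show fL: "f \<in> L2 I01"
    by (rule L2_I01_dominated[OF w f fle])
  have "(\<lambda>n. \<integral>x. (cmod (F n x - f x))\<^sup>2 \<partial>I01) \<longlonglongrightarrow> (\<integral>x. 0 \<partial>I01)"
  proof (rule integral_dominated_convergence)
    show "integrable I01 (\<lambda>x. (2 * C)\<^sup>2 * (cmod (w x))\<^sup>2)"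
      using L2_integrable_square[OF w] by simp
    show "AE x in I01. (\<lambda>n. (cmod (F n x - f x))\<^sup>2) \<longlonglongrightarrow> 0"
      using lim
    proof eventually_elim
      case (elim x)
      have "(\<lambda>n. (cmod (F n x - f x))\<^sup>2) \<longlonglongrightarrow> (cmod (f x - f x))\<^sup>2"
        by (intro tendsto_intros elim)
      then show ?case by simp
    qed
    show "AE x in I01. norm ((cmod (F n x - f x))\<^sup>2) \<le> (2 * C)\<^sup>2 * (cmod (w x))\<^sup>2" for n
      using fle AE_I01_bounds
    proof eventually_elim
      case (elim x)
      have "cmod (F n x - f x) \<le> cmod (F n x) + cmod (f x)"
        by (rule norm_triangle_ineq4)
      also have "\<dots> \<le> C * cmod (w x) + C * cmod (w x)"
        using elim by (intro add_mono le) auto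
      finally have "cmod (F n x - f x) \<le> 2 * C * cmod (w x)" by simp
      from power_mono[OF this, of 2] show ?case by (simp add: power_mult_distrib)
    qed
  qed (use F f in measurable)
  then have "(\<lambda>n. sqrt (\<integral>x. (cmod (F n x - f x))\<^sup>2 \<partial>I01)) \<longlonglongrightarrow> sqrt 0"
    by (intro tendsto_real_sqrt) simp
  then have "L2_tendsto I01 F f sequentially"
    using FL fL by (simp add: L2_tendsto_def L2norm_def)
  then show "(\<lambda>n. cls (F n)) \<longlonglongrightarrow> cls f"
    by (rule L2_tendsto_imp_cls_tendsto)
qed

section \<open>Density of smooth functions with compact support\<close>

primrec smooth :: "nat \<Rightarrow> (real \<Rightarrow> complex) \<Rightarrow> bool" where
  "smooth 0 f \<longleftrightarrow> continuous_on UNIV f"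
| "smooth (Suc k) f \<longleftrightarrow> (\<exists>f'. (\<forall>x. (f has_vector_derivative f' x) (at x)) \<and> smooth k f')"

lemma smooth_continuous: "smooth k f \<Longrightarrow> continuous_on UNIV f"
proof (cases k)
  case (Suc j)
  moreover assume "smooth k f"
  ultimately obtain f' where "\<And>x. (f has_vector_derivative f' x) (at x)" by auto
  then have "isCont f x" for x by (rule has_vector_derivative_continuous)
  then show ?thesis by (simp add: continuous_at_imp_continuous_on)
qed simp

lemma smooth_SucD: "smooth (Suc k) f \<Longrightarrow> smooth k f"
proof (induction k arbitrary: f)
  case 0
  then show ?case using smooth_continuous[of 1 f] by simp
next
  case (Suc k)
  then obtain f' where f': "\<forall>x. (f has_vector_derivative f' x) (at x)" "smooth (Suc k) f'"
    by (simp only: smooth.simps(2)[of "Suc k"]) blast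
  then show ?case using Suc.IH[of f'] by auto
qed

lemma smooth_const: "smooth k (\<lambda>x. c)"
proof (induction k arbitrary: c)
  case (Suc k)
  then show ?case by (subst smooth.simps(2)) (intro exI[of _ "\<lambda>_. 0"] conjI allI has_vector_derivative_const)
qed simp

lemma smooth_add: "smooth k f \<Longrightarrow> smooth k g \<Longrightarrow> smooth k (\<lambda>x. f x + g x)"
proof (induction k arbitrary: f g)
  case (Suc k)
  then obtain f' g' where "\<forall>x. (f has_vector_derivative f' x) (at x)" "smooth k f'"
    "\<forall>x. (g has_vector_derivative g' x) (at x)" "smooth k g'" by auto
  then show ?case
    using Suc.IH[of f' g'] by (auto intro!: exI[of _ "\<lambda>x. f' x + g' x"] has_vector_derivative_add)
qed (auto intro: continuous_on_add)

lemma smooth_mult: "smooth k f \<Longrightarrow> smooth k g \<Longrightarrow> smooth k (\<lambda>x. f x * g x)"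
proof (induction k arbitrary: f g)
  case (Suc k)
  then obtain f' g' where d: "\<forall>x. (f has_vector_derivative f' x) (at x)" "smooth k f'"
    "\<forall>x. (g has_vector_derivative g' x) (at x)" "smooth k g'" by auto
  have "smooth k (\<lambda>x. f x * g' x + f' x * g x)"
    using d Suc.prems[THEN smooth_SucD] by (intro smooth_add Suc.IH)
  moreover have "\<forall>x. ((\<lambda>x. f x * g x) has_vector_derivative f x * g' x + f' x * g x) (at x)"
    using d by (auto intro!: has_vector_derivative_mult)
  ultimately show ?case by (auto simp: smooth.simps(2))
qed (auto intro: continuous_on_mult)

lemma smooth_power: "smooth k f \<Longrightarrow> smooth k (\<lambda>x. f x ^ n)"
  by (induction n) (auto intro: smooth_const smooth_mult)

text \<open>Truncated powers are the building blocks of bump functions: a product of two of them vanishes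
  exactly outside an interval, and each has one continuous derivative less than its exponent.\<close>

lemma truncated_power_has_derivative:
  "((\<lambda>x. max 0 (c + d * x) ^ Suc (Suc k)) has_real_derivative
      real (Suc (Suc k)) * max 0 (c + d * x) ^ Suc k * d) (at x)"
proof -
  have aux: "((\<lambda>y::real. max 0 y ^ Suc (Suc k)) has_real_derivative
      real (Suc (Suc k)) * max 0 y ^ Suc k) (at y)" for y
  proof -
    consider "0 < y" | "y < 0" | "y = 0" by linarith
    then show ?thesis
    proof cases
      case 1
      have "((\<lambda>y::real. y ^ Suc (Suc k)) has_real_derivative real (Suc (Suc k)) * y ^ Suc k) (at y)"
        using DERIV_pow[of "Suc (Suc k)" y] by simp
      moreover have ev: "\<forall>\<^sub>F z in nhds y. max 0 z ^ Suc (Suc k) = z ^ Suc (Suc k)"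
        using 1 eventually_nhds_in_open[of "{0<..}" y] by (auto elim!: eventually_mono)
      ultimately have "((\<lambda>z::real. max 0 z ^ Suc (Suc k)) has_real_derivative real (Suc (Suc k)) * y ^ Suc k) (at y)"
        by (simp only: DERIV_cong_ev[OF refl ev refl])
      then show ?thesis using 1 by simp
    next
      case 2
      have ev: "\<forall>\<^sub>F z in nhds y. max 0 z ^ Suc (Suc k) = 0"
        using 2 eventually_nhds_in_open[of "{..<0}" y] by (auto elim!: eventually_mono)
      have "((\<lambda>z::real. max 0 z ^ Suc (Suc k)) has_real_derivative 0) (at y)"
        by (simp only: DERIV_cong_ev[OF refl ev refl] DERIV_const)
      then show ?thesis using 2 by simp
    next
      case 3
      have "((\<lambda>h::real. max 0 h ^ Suc (Suc k) / h) \<longlongrightarrow> 0) (at 0)"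
      proof (rule Lim_null_comparison)
        have "((\<lambda>h::real. \<bar>h\<bar> ^ Suc k) \<longlongrightarrow> \<bar>0\<bar> ^ Suc k) (at 0)"
          by (intro tendsto_intros)
        then show "((\<lambda>h::real. \<bar>h\<bar> ^ Suc k) \<longlongrightarrow> 0) (at 0)" by simp
        show "\<forall>\<^sub>F h::real in at 0. norm (max 0 h ^ Suc (Suc k) / h) \<le> \<bar>h\<bar> ^ Suc k"
        proof (intro always_eventually allI)
          fix h :: real
          show "norm (max 0 h ^ Suc (Suc k) / h) \<le> \<bar>h\<bar> ^ Suc k"
          proof (cases "0 < h")
            case False
            then have "max 0 h = 0" by simp
            then show ?thesis by (simp del: power_Suc add: power_0_Suc)
          qed (simp add: abs_mult)
        qed
      qed
      then show ?thesis
        using 3 by (simp add: DERIV_def)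
    qed
  qed
  have "((\<lambda>x. c + d * x) has_real_derivative d) (at x)"
    by (auto intro!: derivative_eq_intros)
  from DERIV_chain2[OF aux this] show ?thesis by simp
qed

lemma smooth_truncated_power: "smooth k (\<lambda>x. complex_of_real (max 0 (c + d * x) ^ Suc k))"
proof (induction k)
  case 0
  show ?case by (auto intro!: continuous_intros)
next
  case (Suc k)
  let ?f' = "\<lambda>x. complex_of_real (real (Suc (Suc k)) * max 0 (c + d * x) ^ Suc k * d)"
  have "smooth k ?f'"
    using smooth_mult[OF smooth_const[of k "complex_of_real (real (Suc (Suc k)) * d)"] Suc]
    by (simp add: mult_ac)
  moreover have "((\<lambda>x. complex_of_real (max 0 (c + d * x) ^ Suc (Suc k))) has_vector_derivative ?f' x) (at x)" for x
    using truncated_power_has_derivative[of c d k x]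
    by (rule has_vector_derivative_of_real)
  ultimately show ?case by (subst smooth.simps(2)) (intro exI[of _ ?f'] conjI allI)
qed

definition bump_functions :: "(real \<Rightarrow> complex) set" where
  "bump_functions = {f. smooth 3 f \<and> (\<exists>a b. 0 < a \<and> b < 1 \<and> (\<forall>x. x \<notin> {a..b} \<longrightarrow> f x = 0))}"

lemma bump_L2: "f \<in> bump_functions \<Longrightarrow> f \<in> L2 I01"
  unfolding bump_functions_def
  by (auto intro!: continuous_L2_I01 continuous_on_subset[OF smooth_continuous])

lemma bump_add:
  assumes "f \<in> bump_functions" "g \<in> bump_functions"
  shows "(\<lambda>x. f x + g x) \<in> bump_functions"
proof -
  obtain a b c d where *: "0 < a" "b < 1" "\<And>x. x \<notin> {a..b} \<Longrightarrow> f x = 0"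
    "0 < c" "d < 1" "\<And>x. x \<notin> {c..d} \<Longrightarrow> g x = 0"
    using assms unfolding bump_functions_def by auto
  have "f x + g x = 0" if "x \<notin> {min a c..max b d}" for x
  proof -
    have "x \<notin> {a..b}" "x \<notin> {c..d}" using that by auto
    then show ?thesis using * by simp
  qed
  then have "\<exists>a b. 0 < a \<and> b < 1 \<and> (\<forall>x. x \<notin> {a..b} \<longrightarrow> f x + g x = 0)"
    using * by (intro exI[of _ "min a c"] exI[of _ "max b d"]) simp
  then show ?thesis
    using assms unfolding bump_functions_def by (auto intro: smooth_add)
qed

lemma bump_scale: "f \<in> bump_functions \<Longrightarrow> (\<lambda>x. c * f x) \<in> bump_functions"
  unfolding bump_functions_def by (auto intro!: smooth_mult smooth_const)

text \<open>The set of limits of bump functions is a closed subspace; it is built up from indicators of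
  intervals to Borel sets by Dynkin's argument, and from there to all of \<open>L\<^sup>2\<close>. An indicator of
  an interval is the limit of \<open>1 - (1 - \<phi>)\<^sup>n\<close> for any \<open>\<phi>\<close> with values in \<open>[0,1]\<close> that is positive
  exactly on the interval.\<close>

definition bump_closure :: "(real \<Rightarrow> complex) set" where
  "bump_closure = {f. f \<in> L2 I01 \<and> cls f \<in> closure (cls ` bump_functions)}"

lemma bump_closure_limit:
  assumes w: "w \<in> L2 I01" and F: "\<And>n. F n \<in> bump_closure" and f: "f \<in> borel_measurable I01"
    and le: "\<And>n x. 0 < x \<Longrightarrow> x < 1 \<Longrightarrow> cmod (F n x) \<le> C * cmod (w x)"
    and lim: "AE x in I01. (\<lambda>n. F n x) \<longlonglongrightarrow> f x"
  shows "f \<in> bump_closure"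
proof -
  have "F n \<in> borel_measurable I01" for n
    using F[of n] by (auto simp: bump_closure_def L2_def)
  note conv = L2_dominated_convergence[OF w this f le lim]
  have "cls f \<in> closure (cls ` bump_functions)"
    by (rule closed_sequentially[OF closed_closure _ conv(2)]) (use F in \<open>simp add: bump_closure_def\<close>)
  then show ?thesis using conv(1) by (simp add: bump_closure_def)
qed

lemma bump_subset_closure: "f \<in> bump_functions \<Longrightarrow> f \<in> bump_closure"
  unfolding bump_closure_def using closure_subset[of "cls ` bump_functions"] by (auto simp: bump_L2)

lemma bump_closure_add:
  assumes "f \<in> bump_closure" "g \<in> bump_closure"
  shows "(\<lambda>x. f x + g x) \<in> bump_closure"
proof -
  obtain F G where F: "\<And>n. F n \<in> cls ` bump_functions" "F \<longlonglongrightarrow> cls f"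
    and G: "\<And>n. G n \<in> cls ` bump_functions" "G \<longlonglongrightarrow> cls g"
    using assms unfolding bump_closure_def closure_sequential by blast
  have fg: "f \<in> L2 I01" "g \<in> L2 I01" using assms by (auto simp: bump_closure_def)
  have "F n + G n \<in> cls ` bump_functions" for n
  proof -
    obtain u v where "u \<in> bump_functions" "v \<in> bump_functions" "F n = cls u" "G n = cls v"
      using F(1)[of n] G(1)[of n] by auto
    then have "F n + G n = cls (\<lambda>x. u x + v x)" "(\<lambda>x. u x + v x) \<in> bump_functions"
      by (simp_all add: cls_add bump_L2 bump_add)
    then show ?thesis by blast
  qed
  moreover have "(\<lambda>n. F n + G n) \<longlonglongrightarrow> cls (\<lambda>x. f x + g x)"
    unfolding cls_add[OF fg] by (intro tendsto_add F G)
  ultimately have "cls (\<lambda>x. f x + g x) \<in> closure (cls ` bump_functions)"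
    unfolding closure_sequential by (intro exI[of _ "\<lambda>n. F n + G n"]) blast
  then show ?thesis
    using fg unfolding bump_closure_def by (auto intro: L2_add)
qed

lemma bump_closure_scale:
  assumes "f \<in> bump_closure"
  shows "(\<lambda>x. c * f x) \<in> bump_closure"
proof -
  obtain F where F: "\<And>n. F n \<in> cls ` bump_functions" "F \<longlonglongrightarrow> cls f"
    using assms unfolding bump_closure_def closure_sequential by blast
  have f: "f \<in> L2 I01" using assms by (auto simp: bump_closure_def)
  from F(1) obtain u where u: "\<And>n. u n \<in> bump_functions" "\<And>n. F n = cls (u n)"
    unfolding image_iff by metis
  have "F = (\<lambda>n. cls (u n))" using u by auto
  then have "L2_tendsto I01 u f sequentially"
    using F(2) u(1) f by (intro cls_tendsto_imp_L2_tendsto) (auto simp: bump_L2)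
  then have "(\<lambda>n. L2norm I01 (\<lambda>x. u n x - f x)) \<longlonglongrightarrow> 0" by (simp add: L2_tendsto_def)
  then have "(\<lambda>n. cmod c * L2norm I01 (\<lambda>x. u n x - f x)) \<longlonglongrightarrow> 0"
    by (rule tendsto_mult_right_zero)
  moreover have "L2norm I01 (\<lambda>x. c * u n x - c * f x) = cmod c * L2norm I01 (\<lambda>x. u n x - f x)" for n
    unfolding right_diff_distrib[symmetric] L2norm_def
    by (simp add: norm_mult power_mult_distrib real_sqrt_mult)
  ultimately have "L2_tendsto I01 (\<lambda>n x. c * u n x) (\<lambda>x. c * f x) sequentially"
    using u f by (simp add: L2_tendsto_def L2_scale bump_L2)
  from L2_tendsto_imp_cls_tendsto[OF this]
  show ?thesis
    using f u bump_scale unfolding bump_closure_def closure_sequential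
    by (auto intro!: L2_scale exI[of _ "\<lambda>n. cls (\<lambda>x. c * u n x)"])
qed

lemma bump_closure_sum:
  assumes "\<And>i. i \<in> A \<Longrightarrow> f i \<in> bump_closure"
  shows "(\<lambda>x. \<Sum>i\<in>A. f i x) \<in> bump_closure"
proof (cases "finite A")
  case True
  then show ?thesis using assms
  proof (induction A rule: finite_induct)
    case empty
    have "(\<lambda>x. 0) \<in> bump_functions"
      unfolding bump_functions_def by (auto intro!: smooth_const exI[of _ "1/2"])
    then show ?case by (simp add: bump_subset_closure)
  qed (auto intro: bump_closure_add)
next
  case False
  have "(\<lambda>x. 0) \<in> bump_functions"
    unfolding bump_functions_def by (auto intro!: smooth_const exI[of _ "1/2"])
  then show ?thesis using False by (simp add: bump_subset_closure)
qed

lemma indicator_measurable_I01: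
  assumes "A \<in> sets borel"
  shows "(\<lambda>x. complex_of_real (indicator A x)) \<in> borel_measurable I01"
proof -
  have "(\<lambda>x. complex_of_real (indicator A x)) \<in> borel_measurable lborel"
    using assms by measurable
  then show ?thesis unfolding lborel_on_def by (rule measurable_restrict_space1)
qed

lemma compact_interval_in_bump_closure:
  assumes "0 < a" "b < 1"
  shows "(\<lambda>x. complex_of_real (indicator {a<..<b} x)) \<in> bump_closure"
proof -
  \<comment> \<open>The exponent \<open>4\<close> makes \<open>\<phi>\<close> three times continuously differentiable.\<close>
  define \<phi> :: "real \<Rightarrow> real" where "\<phi> x = max 0 (- a + 1 * x) ^ Suc 3 * max 0 (b + - 1 * x) ^ Suc 3" for x
  have \<phi>01: "0 \<le> \<phi> x" "\<phi> x \<le> 1" if "0 < x" "x < 1" for x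
    unfolding \<phi>_def using assms that by (auto intro!: mult_le_one power_le_one)
  have \<phi>0: "\<phi> x = 0" if "x \<notin> {a<..<b}" for x
    using that by (auto simp: \<phi>_def max_def)
  have \<phi>pos: "0 < \<phi> x" if "x \<in> {a<..<b}" for x
    using that by (auto simp: \<phi>_def max_def)
  define F where "F n x = 1 + (- 1) * (1 + (- 1) * complex_of_real (\<phi> x)) ^ n" for n :: nat and x
  have F_real: "F n x = complex_of_real (1 - (1 - \<phi> x) ^ n)" for n x
    by (simp add: F_def)
  show ?thesis
  proof (rule bump_closure_limit[OF const_L2_I01[of 1]])
    show "F n \<in> bump_closure" for n
    proof (rule bump_subset_closure)
      have "smooth 3 (\<lambda>x. complex_of_real (\<phi> x))"
        unfolding \<phi>_def of_real_mult by (intro smooth_mult smooth_truncated_power)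
      then have "smooth 3 (F n)"
        unfolding F_def by (intro smooth_add smooth_mult smooth_power smooth_const)
      moreover have "F n x = 0" if "x \<notin> {a..b}" for x
      proof -
        have "\<phi> x = 0" by (rule \<phi>0) (use that in auto)
        then show ?thesis by (simp add: F_def)
      qed
      ultimately show "F n \<in> bump_functions"
        using assms by (auto simp: bump_functions_def)
    qed
    show "(\<lambda>x. complex_of_real (indicator {a<..<b} x)) \<in> borel_measurable I01"
      by (rule indicator_measurable_I01) simp
    show "cmod (F n x) \<le> 1 * cmod 1" if "0 < x" "x < 1" for n x
    proof -
      have "0 \<le> (1 - \<phi> x) ^ n" "(1 - \<phi> x) ^ n \<le> 1"
        using \<phi>01[OF that] by (auto intro: power_le_one)
      then show ?thesis unfolding F_real norm_of_real by simp
    qed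
    show "AE x in I01. (\<lambda>n. F n x) \<longlonglongrightarrow> complex_of_real (indicator {a<..<b} x)"
      using AE_I01_bounds
    proof eventually_elim
      case (elim x)
      show ?case
      proof (cases "x \<in> {a<..<b}")
        case True
        have "(\<lambda>n. (1 - \<phi> x) ^ n) \<longlonglongrightarrow> 0"
          using \<phi>01[of x] \<phi>pos[OF True] elim by (intro LIMSEQ_power_zero) auto
        then have "(\<lambda>n. 1 - (1 - \<phi> x) ^ n) \<longlonglongrightarrow> 1 - 0" by (intro tendsto_diff tendsto_const)
        then show ?thesis
          unfolding F_real using True by (intro tendsto_of_real) auto
      qed (simp add: F_def \<phi>0)
    qed
  qed
qed

text \<open>An interval that reaches or exceeds the end points is exhausted by compactly contained ones.\<close>

lemma interval_in_bump_closure: "(\<lambda>x. complex_of_real (indicator {a..b} x)) \<in> bump_closure"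
proof (rule bump_closure_limit[OF const_L2_I01[of 1]])
  define c where "c n = max a (1 / real (Suc n))" for n
  define d where "d n = min b (1 - 1 / real (Suc n))" for n
  show "(\<lambda>x. complex_of_real (indicator {c n<..<d n} x)) \<in> bump_closure" for n
    by (rule compact_interval_in_bump_closure) (auto simp: c_def d_def less_max_iff_disj min_less_iff_disj)
  show "(\<lambda>x. complex_of_real (indicator {a..b} x)) \<in> borel_measurable I01"
    by (rule indicator_measurable_I01) simp
  show "cmod (complex_of_real (indicator {c n<..<d n} x)) \<le> 1 * cmod 1" for n x
    by (simp add: indicator_def)
  show "AE x in I01. (\<lambda>n. complex_of_real (indicator {c n<..<d n} x)) \<longlonglongrightarrow> complex_of_real (indicator {a..b} x)"
    using AE_I01_bounds AE_I01_neq[of a] AE_I01_neq[of b]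
  proof eventually_elim
    case (elim x)
    have harmonic: "(\<lambda>n. 1 / real (Suc n)) \<longlonglongrightarrow> 0"
      using LIMSEQ_inverse_real_of_nat by (simp add: inverse_eq_divide)
    have "(\<lambda>n. 1 - 1 / real (Suc n)) \<longlonglongrightarrow> 1 - 0"
      by (intro tendsto_diff tendsto_const harmonic)
    then have "\<forall>\<^sub>F n in sequentially. x < 1 - 1 / real (Suc n)"
      using elim by (intro order_tendstoD) auto
    moreover have "\<forall>\<^sub>F n in sequentially. 1 / real (Suc n) < x"
      using elim by (intro order_tendstoD[OF harmonic]) auto
    ultimately have "\<forall>\<^sub>F n in sequentially.
        complex_of_real (indicator {c n<..<d n} x) = complex_of_real (indicator {a..b} x)"
      by eventually_elim (use elim in \<open>auto simp: c_def d_def indicator_def\<close>)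
    then show ?case by (rule tendsto_eventually)
  qed
qed

lemma borel_set_in_bump_closure:
  assumes "A \<in> sets borel"
  shows "(\<lambda>x. complex_of_real (indicator A x)) \<in> bump_closure"
  using assms
proof (induction A rule: borel_set_induct)
  case empty
  show ?case using bump_closure_sum[of "{}"] by simp
next
  case (interval a b)
  show ?case by (rule interval_in_bump_closure)
next
  case (compl A)
  let ?F = "\<lambda>x. complex_of_real (indicator {0..1} x) + (- 1) * complex_of_real (indicator A x)"
  have F: "?F \<in> bump_closure"
    by (intro bump_closure_add bump_closure_scale interval_in_bump_closure compl)
  have eq: "?F x = complex_of_real (indicator (- A) x)" if "0 < x" "x < 1" for x
    using that by (simp add: indicator_def)
  show ?case
  proof (rule bump_closure_limit[OF const_L2_I01[of 1] F])
    show "(\<lambda>x. complex_of_real (indicator (- A) x)) \<in> borel_measurable I01"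
      using compl by (intro indicator_measurable_I01) auto
    show "cmod (?F x) \<le> 1 * cmod 1" if "0 < x" "x < 1" for x
      unfolding eq[OF that] by (simp add: indicator_def)
    show "AE x in I01. (\<lambda>n::nat. ?F x) \<longlonglongrightarrow> complex_of_real (indicator (- A) x)"
      using AE_I01_bounds by eventually_elim (simp only: eq tendsto_const)
  qed
next
  case (union A)
  show ?case
  proof (rule bump_closure_limit[OF const_L2_I01[of 1]])
    show "(\<lambda>x. \<Sum>i<n. complex_of_real (indicator (A i) x)) \<in> bump_closure" for n
      by (intro bump_closure_sum union)
    show "(\<lambda>x. complex_of_real (indicator (\<Union>i. A i) x)) \<in> borel_measurable I01"
      using union by (intro indicator_measurable_I01) auto
    have eq: "(\<Sum>i<n. complex_of_real (indicator (A i) x)) = complex_of_real (indicator (\<Union>i<n. A i) x)" for n x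
      using union(1) by (subst indicator_UN_disjoint)
        (auto simp: disjoint_family_on_def)
    show "cmod (\<Sum>i<n. complex_of_real (indicator (A i) x)) \<le> 1 * cmod 1" for n x
      unfolding eq by (simp add: indicator_def)
    show "AE x in I01. (\<lambda>n. \<Sum>i<n. complex_of_real (indicator (A i) x))
        \<longlonglongrightarrow> complex_of_real (indicator (\<Union>i. A i) x)"
      unfolding eq by (intro AE_I2 tendsto_of_real LIMSEQ_indicator_UN)
  qed
qed

lemma bump_closure_eq_L2: "f \<in> L2 I01 \<Longrightarrow> f \<in> bump_closure"
proof -
  assume f: "f \<in> L2 I01"
  obtain F where F: "\<And>i. simple_function I01 (F i)"
    and lim: "\<And>x. x \<in> space I01 \<Longrightarrow> (\<lambda>i. F i x) \<longlonglongrightarrow> f x"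
    and le: "\<And>i x. x \<in> space I01 \<Longrightarrow> dist (F i x) 0 \<le> 2 * dist (f x) 0"
    using borel_measurable_implies_sequence_metric[OF L2_measurable[OF f], of 0] by blast
  have "F i \<in> bump_closure" for i
  proof -
    let ?G = "\<lambda>x. \<Sum>y\<in>F i ` space I01. y * complex_of_real (indicator (F i -` {y} \<inter> space I01) x)"
    have fin: "finite (F i ` space I01)" by (rule simple_functionD(1)[OF F])
    have meas: "F i -` {y} \<inter> space I01 \<in> sets borel" for y
    proof -
      have "F i -` {y} \<inter> space I01 \<in> sets I01" by (rule simple_functionD(2)[OF F])
      then show ?thesis by (auto simp: sets_lborel_on sets_restrict_space)
    qed
    have G: "?G \<in> bump_closure"
      by (intro bump_closure_sum bump_closure_scale borel_set_in_bump_closure meas)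
    have eq: "?G x = F i x" if "x \<in> space I01" for x
    proof -
      have "?G x = (\<Sum>y\<in>F i ` space I01. if y = F i x then y else 0)"
        using that by (intro sum.cong) (auto simp: indicator_def)
      then show ?thesis using fin that by (simp add: sum.delta)
    qed
    show ?thesis
    proof (rule bump_closure_limit[where F = "\<lambda>_. ?G", OF _ G])
      show "?G \<in> L2 I01" using G by (simp add: bump_closure_def)
      show "F i \<in> borel_measurable I01" by (rule borel_measurable_simple_function[OF F])
      show "AE x in I01. (\<lambda>n::nat. ?G x) \<longlonglongrightarrow> F i x"
        by (intro AE_I2) (simp only: eq tendsto_const)
      show "cmod (?G x) \<le> 1 * cmod (?G x)" for x by simp
    qed
  qed
  then show ?thesis
    by (rule bump_closure_limit[OF f _ L2_measurable[OF f], of F 2])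
      (use lim le in \<open>auto intro!: AE_I2\<close>)
qed

theorem bump_functions_dense: "closure (cls ` bump_functions) = UNIV"
proof -
  have "F \<in> closure (cls ` bump_functions)" for F
    using bump_closure_eq_L2[OF rep_L2[of F]] by (simp add: bump_closure_def)
  then show ?thesis by blast
qed

lemma conj_l2_cls_real: "(\<lambda>x. complex_of_real (f x)) \<in> L2 I01 \<Longrightarrow>
    conj_l2 (cls (\<lambda>x. complex_of_real (f x))) = cls (\<lambda>x. complex_of_real (f x))"
  by (simp add: cls_cnj[symmetric])

lemma smooth_Re: "smooth k f \<Longrightarrow> smooth k (\<lambda>x. complex_of_real (Re (f x)))"
proof (induction k arbitrary: f)
  case 0
  then show ?case by (auto intro!: continuous_intros)
next
  case (Suc k)
  then obtain f' where f': "\<And>x. (f has_vector_derivative f' x) (at x)" "smooth k f'" by auto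
  have "((\<lambda>x. complex_of_real (Re (f x))) has_vector_derivative complex_of_real (Re (f' x))) (at x)" for x
    using bounded_linear.has_vector_derivative[OF bounded_linear_Re f'(1)]
    by (intro has_vector_derivative_of_real) (simp add: has_real_derivative_iff_has_vector_derivative)
  then show ?case
    using Suc.IH[OF f'(2)] by (subst smooth.simps) (intro exI[of _ "\<lambda>x. complex_of_real (Re (f' x))"] conjI allI)
qed

lemma bump_Re: "f \<in> bump_functions \<Longrightarrow> (\<lambda>x. complex_of_real (Re (f x))) \<in> bump_functions"
  unfolding bump_functions_def using smooth_Re by fastforce

text \<open>Averaging an approximation with its complex conjugate makes it real.\<close>

lemma real_bump_approximation:
  assumes "conj_l2 F = F"
  shows "\<exists>b. (\<forall>n. b n \<in> bump_functions \<and> conj_l2 (cls (b n)) = cls (b n)) \<and> (\<lambda>n. cls (b n)) \<longlonglongrightarrow> F"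
proof -
  have "F \<in> closure (cls ` bump_functions)" by (simp add: bump_functions_dense)
  then obtain X where X: "\<And>n. X n \<in> cls ` bump_functions" "X \<longlonglongrightarrow> F"
    unfolding closure_sequential by blast
  from X(1) obtain c where c: "\<And>n. c n \<in> bump_functions" "\<And>n. X n = cls (c n)"
    unfolding image_iff by metis
  let ?b = "\<lambda>n x. complex_of_real (Re (c n x))"
  have b: "?b n \<in> bump_functions" for n by (rule bump_Re[OF c(1)])
  have eq: "cls (?b n) = (1 / 2) *\<^sub>R (X n + conj_l2 (X n))" for n
  proof -
    note L = bump_L2[OF c(1), of n]
    have "?b n = (\<lambda>x. complex_of_real (1 / 2) * (c n x + cnj (c n x)))"
      by (simp add: fun_eq_iff complex_eq_iff)
    then show ?thesis
      by (simp only: c(2) cls_scaleR[OF L2_add[OF L L2_cnj[OF L]]] cls_add[OF L L2_cnj[OF L]] cls_cnj[OF L])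
  qed
  have "(\<lambda>n. (1 / 2) *\<^sub>R (X n + conj_l2 (X n))) \<longlonglongrightarrow> (1 / 2) *\<^sub>R (F + conj_l2 F)"
    by (intro tendsto_intros X(2) bounded_linear.tendsto[OF bounded_linear_conj_l2])
  moreover have "(1 / 2) *\<^sub>R (F + conj_l2 F) = F"
    by (simp add: assms scaleR_2[symmetric])
  ultimately have "(\<lambda>n. cls (?b n)) \<longlonglongrightarrow> F" by (simp add: eq)
  then show ?thesis
    using b conj_l2_cls_real[OF bump_L2[OF b]] by (intro exI[of _ ?b]) simp
qed

section \<open>Primitives and weak derivatives\<close>

definition primitive :: "(real \<Rightarrow> complex) \<Rightarrow> real \<Rightarrow> complex" where
  "primitive g x = (\<integral>y. indicator {..<x} y *\<^sub>R g y \<partial>I01)"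

lemma borel_measurable_imp_I01: "f \<in> borel_measurable borel \<Longrightarrow> f \<in> borel_measurable I01"
  unfolding lborel_on_def by (rule measurable_restrict_space1) simp

lemma L2_indicator:
  assumes "g \<in> L2 I01"
  shows "(\<lambda>y. indicator {..<x::real} y *\<^sub>R g y) \<in> L2 I01"
proof (rule L2_I01_dominated[OF assms, where C = 1])
  have [measurable]: "(indicator {..<x} :: real \<Rightarrow> real) \<in> borel_measurable I01"
    by (rule borel_measurable_imp_I01) simp
  show "(\<lambda>y. indicator {..<x} y *\<^sub>R g y) \<in> borel_measurable I01"
    using L2_measurable[OF assms] by measurable
qed (simp add: indicator_def)

lemma primitive_0 [simp]: "primitive g 0 = 0"
  unfolding primitive_def
  by (subst Bochner_Integration.integral_cong[OF refl, of _ _ "\<lambda>_. 0"]) (auto simp: indicator_def)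

lemma primitive_1: "primitive g 1 = (\<integral>y. g y \<partial>I01)"
  unfolding primitive_def by (rule Bochner_Integration.integral_cong) (auto simp: indicator_def)

lemma primitive_cong_AE:
  assumes "f \<in> L2 I01" "g \<in> L2 I01" "AE x in I01. f x = g x"
  shows "primitive f = primitive g"
proof
  show "primitive f x = primitive g x" for x
    unfolding primitive_def
    using assms L2_measurable[OF L2_indicator[OF assms(1)]] L2_measurable[OF L2_indicator[OF assms(2)]]
    by (intro integral_cong_AE) (auto elim: eventually_mono)
qed

lemma continuous_primitive:
  assumes g: "g \<in> L2 I01"
  shows "continuous_on A (primitive g)"
proof (rule continuous_on_subset[OF _ subset_UNIV], unfold continuous_on_sequentially, intro allI ballI impI)
  fix x :: "nat \<Rightarrow> real" and a :: real
  assume "(\<forall>n. x n \<in> UNIV) \<and> x \<longlonglongrightarrow> a"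
  then have x: "x \<longlonglongrightarrow> a" by simp
  show "(primitive g \<circ> x) \<longlonglongrightarrow> primitive g a"
    unfolding primitive_def comp_def
  proof (rule integral_dominated_convergence)
    show "integrable I01 (\<lambda>y. norm (g y))"
      using L2_imp_integrable[OF g] by simp
    show "AE y in I01. (\<lambda>n. indicator {..<x n} y *\<^sub>R g y) \<longlonglongrightarrow> indicator {..<a} y *\<^sub>R g y"
      using AE_I01_neq[of a]
    proof eventually_elim
      case (elim y)
      then have "\<forall>\<^sub>F n in sequentially. indicator {..<x n} y *\<^sub>R g y = indicator {..<a} y *\<^sub>R g y"
        using order_tendstoD[OF x, of y] by (cases y a rule: linorder_cases) (auto elim!: eventually_mono)
      then show ?case by (rule tendsto_eventually)
    qed
  qed (use L2_measurable[OF L2_indicator[OF g]] in \<open>auto simp: indicator_def\<close>)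
qed

lemma L2norm_le_bound:
  assumes "f \<in> borel_measurable I01" "\<And>x. 0 < x \<Longrightarrow> x < 1 \<Longrightarrow> cmod (f x) \<le> B" "0 \<le> B"
  shows "L2norm I01 f \<le> B"
proof -
  have f: "f \<in> L2 I01" using assms by (intro bounded_L2_I01[where B = B])
  have "(L2norm I01 f)\<^sup>2 \<le> (\<integral>x. B\<^sup>2 \<partial>I01)"
    unfolding L2norm_square using L2_integrable_square[OF f] assms
    by (intro integral_mono power_mono) auto
  then show ?thesis using assms(3) by (simp add: power2_le_iff_abs_le)
qed

lemma cmod_primitive_le:
  assumes g: "g \<in> L2 I01"
  shows "cmod (primitive g x) \<le> L2norm I01 g"
proof -
  have "cmod (primitive g x) \<le> L2norm I01 (\<lambda>y. indicator {..<x} y *\<^sub>R g y)"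
    unfolding primitive_def by (rule cmod_integral_le_L2norm[OF L2_indicator[OF g]])
  also have "\<dots> \<le> L2norm I01 g"
  proof (rule power2_le_imp_le)
    show "(L2norm I01 (\<lambda>y. indicator {..<x} y *\<^sub>R g y))\<^sup>2 \<le> (L2norm I01 g)\<^sup>2"
      unfolding L2norm_square
      using L2_integrable_square[OF L2_indicator[OF g]] L2_integrable_square[OF g]
      by (intro integral_mono) (auto simp: indicator_def)
  qed simp
  finally show ?thesis .
qed

lemma primitive_eq_diff:
  assumes F: "\<And>x. x \<in> {0..1} \<Longrightarrow> (F has_vector_derivative f x) (at x within {0..1})"
    and f: "continuous_on {0..1} f" and y: "y \<in> {0..1}"
  shows "primitive f y = F y - F 0"
proof -
  have "primitive f y = (\<integral>x. indicator {0<..<1} x *\<^sub>R (indicator {..<y} x *\<^sub>R f x) \<partial>lborel)"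
    unfolding primitive_def lborel_on_def by (rule integral_restrict_space) simp
  also have "\<dots> = (\<integral>x. indicator {0..y} x *\<^sub>R f x \<partial>lborel)"
    by (rule integral_discrete_difference[of "{0, y}"]) (use y in \<open>auto simp: indicator_def\<close>)
  also have "\<dots> = F y - F 0"
  proof (rule integral_FTC_Icc)
    show "(F has_vector_derivative f x) (at x within {0..y})" if "0 \<le> x" "x \<le> y" for x
      using F[of x] that y by (intro has_vector_derivative_within_subset[OF F]) auto
    show "continuous_on {0..y} f" using y by (intro continuous_on_subset[OF f]) auto
  qed (use y in auto)
  finally show ?thesis .
qed

lemma integral_eq_diff:
  fixes F f :: "real \<Rightarrow> complex"
  assumes "\<And>x. x \<in> {0..1} \<Longrightarrow> (F has_vector_derivative f x) (at x within {0..1})"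
    and "continuous_on {0..1} f"
  shows "(\<integral>x. f x \<partial>I01) = F 1 - F 0"
  using primitive_eq_diff[OF assms, of 1] by (simp add: primitive_1)

lemma primitive_has_vector_derivative:
  assumes g: "continuous_on {0..1} g" and x: "x \<in> {0..1}"
  shows "(primitive g has_vector_derivative g x) (at x within {0..1})"
proof -
  obtain F where F: "\<And>x. x \<in> {0..1} \<Longrightarrow> (F has_vector_derivative g x) (at x within {0..1})"
    using antiderivative_continuous[OF g] by blast
  have "((\<lambda>y. F y - F 0) has_vector_derivative g x) (at x within {0..1})"
    using F[OF x] by (auto intro!: derivative_eq_intros)
  then show ?thesis
    by (rule has_vector_derivative_transform[OF x, rotated]) (rule primitive_eq_diff[OF F g])
qed

text \<open>Integration by parts against a primitive of an \<open>L\<^sup>2\<close> function, which need not be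
  differentiable anywhere: the integral of \<open>\<phi>'(x) g(y)\<close> over the triangle \<open>y < x\<close> is evaluated in both
  orders.\<close>

lemma integral_by_parts_primitive:
  assumes g: "g \<in> L2 I01"
    and \<phi>: "\<And>x. x \<in> {0..1} \<Longrightarrow> (\<phi> has_vector_derivative \<phi>' x) (at x within {0..1})"
    and \<phi>': "continuous_on {0..1} \<phi>'"
  shows "(\<integral>x. \<phi>' x * (c + primitive g x) \<partial>I01)
    = \<phi> 1 * (c + primitive g 1) - \<phi> 0 * c - (\<integral>x. \<phi> x * g x \<partial>I01)"
proof -
  have cont\<phi>: "continuous_on {0..1} \<phi>"
    using \<phi> has_vector_derivative_continuous continuous_on_eq_continuous_within by blast
  note L\<phi> = continuous_L2_I01[OF cont\<phi>] and L\<phi>' = continuous_L2_I01[OF \<phi>']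
  note Lprim = continuous_L2_I01[OF continuous_primitive[OF g]]
  note int = L2_imp_integrable[OF L\<phi>'] L2_imp_integrable[OF g] L2_mult_integrable[OF L\<phi>' Lprim] L2_mult_integrable[OF L\<phi> g]
  let ?K = "\<lambda>x y. indicator {..<x} y *\<^sub>R (\<phi>' x * g y)"
  have K_int: "integrable (I01 \<Otimes>\<^sub>M I01) (case_prod ?K)"
  proof (rule I01_pair.Fubini_integrable)
    have id: "(\<lambda>x. x) \<in> borel_measurable I01"
      by (rule borel_measurable_imp_I01) simp
    have [measurable]: "\<phi>' \<in> borel_measurable I01" "g \<in> borel_measurable I01"
      using L2_measurable[OF L\<phi>'] L2_measurable[OF g] .
    have [measurable]: "(\<lambda>p. fst p) \<in> borel_measurable (I01 \<Otimes>\<^sub>M I01)" "(\<lambda>p. snd p) \<in> borel_measurable (I01 \<Otimes>\<^sub>M I01)"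
      using measurable_compose[OF measurable_fst id] measurable_compose[OF measurable_snd id] .
    have "case_prod ?K = (\<lambda>p. if snd p < fst p then \<phi>' (fst p) * g (snd p) else 0)"
      by (auto simp: fun_eq_iff indicator_def)
    also have "\<dots> \<in> borel_measurable (I01 \<Otimes>\<^sub>M I01)"
      by measurable
    finally show meas: "case_prod ?K \<in> borel_measurable (I01 \<Otimes>\<^sub>M I01)" .
    have int_y: "integrable I01 (\<lambda>y. ?K x y)" for x
      using L2_imp_integrable[OF L2_indicator[OF L2_scale[OF g]]] .
    then show "AE x in I01. integrable I01 (\<lambda>y. case (x, y) of (x, y) \<Rightarrow> ?K x y)" by simp
    show "integrable I01 (\<lambda>x. \<integral>y. norm (case (x, y) of (x, y) \<Rightarrow> ?K x y) \<partial>I01)"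
    proof (rule Bochner_Integration.integrable_bound)
      show "integrable I01 (\<lambda>x. norm (\<phi>' x) * (\<integral>y. norm (g y) \<partial>I01))"
        using int by (intro integrable_mult_left integrable_norm)
      have "(\<lambda>(x, y). norm (?K x y)) \<in> borel_measurable (I01 \<Otimes>\<^sub>M I01)"
        using measurable_compose[OF meas borel_measurable_norm] by (simp only: split_beta')
      from I01.borel_measurable_lebesgue_integral[OF this]
      show "(\<lambda>x. \<integral>y. norm (case (x, y) of (x, y) \<Rightarrow> ?K x y) \<partial>I01) \<in> borel_measurable I01"
        by (simp only: prod.case)
      have "(\<integral>y. norm (?K x y) \<partial>I01) \<le> (\<integral>y. norm (\<phi>' x) * norm (g y) \<partial>I01)" for x
        using int_y int by (intro integral_mono integrable_norm integrable_mult_right)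
          (auto simp: indicator_def norm_mult)
      then show "AE x in I01. norm (\<integral>y. norm (case (x, y) of (x, y) \<Rightarrow> ?K x y) \<partial>I01)
          \<le> norm (norm (\<phi>' x) * (\<integral>y. norm (g y) \<partial>I01))"
        by (intro AE_I2) (simp add: integral_nonneg abs_mult)
    qed
  qed
  have inner1: "(\<integral>y. ?K x y \<partial>I01) = \<phi>' x * primitive g x" for x
    unfolding primitive_def by (simp flip: integral_mult_right_zero add: mult_scaleR_right)
  have inner2: "(\<integral>x. ?K x y \<partial>I01) = (\<phi> 1 - \<phi> y) * g y" if y: "y \<in> space I01" for y
  proof -
    have "(\<integral>x. ?K x y \<partial>I01) = (\<integral>x. (\<phi>' x - indicator {..<y} x *\<^sub>R \<phi>' x) * g y \<partial>I01)"
    proof (rule integral_discrete_difference[of "{y}"])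
      show "emeasure I01 {x} = 0" "{x} \<in> sets I01" if "x \<in> {y}" for x
        using that y by (auto simp: lborel_on_def emeasure_restrict_space sets_restrict_space_iff)
    qed (auto simp: indicator_def)
    also have "\<dots> = ((\<integral>x. \<phi>' x \<partial>I01) - primitive \<phi>' y) * g y"
      using int L2_imp_integrable[OF L2_indicator[OF L\<phi>']] by (simp add: primitive_def)
    also have "\<dots> = (\<phi> 1 - \<phi> y) * g y"
      using integral_eq_diff[OF \<phi> \<phi>'] primitive_eq_diff[OF \<phi> \<phi>', of y] y by simp
    finally show ?thesis .
  qed
  have "(\<integral>x. \<phi>' x * primitive g x \<partial>I01) = (\<integral>x. \<integral>y. ?K x y \<partial>I01 \<partial>I01)"
    by (simp only: inner1)
  also have "\<dots> = (\<integral>y. \<integral>x. ?K x y \<partial>I01 \<partial>I01)"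
    by (rule I01_pair.Fubini_integral[OF K_int, symmetric])
  also have "\<dots> = (\<integral>y. (\<phi> 1 - \<phi> y) * g y \<partial>I01)"
    by (rule Bochner_Integration.integral_cong[OF refl inner2])
  also have "\<dots> = \<phi> 1 * primitive g 1 - (\<integral>y. \<phi> y * g y \<partial>I01)"
    using int by (simp add: left_diff_distrib primitive_1)
  finally have main: "(\<integral>x. \<phi>' x * primitive g x \<partial>I01) = \<phi> 1 * primitive g 1 - (\<integral>y. \<phi> y * g y \<partial>I01)" .
  have total: "(\<integral>x. \<phi>' x \<partial>I01) = \<phi> 1 - \<phi> 0"
    by (rule integral_eq_diff[OF \<phi> \<phi>'])
  have "(\<integral>x. \<phi>' x * (c + primitive g x) \<partial>I01) = (\<integral>x. \<phi>' x \<partial>I01) * c + (\<integral>x. \<phi>' x * primitive g x \<partial>I01)"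
    using int by (simp add: distrib_left)
  also have "\<dots> = (\<phi> 1 - \<phi> 0) * c + (\<phi> 1 * primitive g 1 - (\<integral>y. \<phi> y * g y \<partial>I01))"
    by (simp only: main total)
  finally show ?thesis
    by (simp add: algebra_simps)
qed

text \<open>The primitive of the difference vanishes identically, hence so does its derivative, up to and
  including the end points.\<close>

lemma continuous_AE_unique:
  fixes V W :: "real \<Rightarrow> complex"
  assumes "continuous_on {0..1} V" "continuous_on {0..1} W" "AE y in I01. V y = W y" "x \<in> {0..1}"
  shows "V x = W x"
proof -
  let ?d = "\<lambda>x. V x - W x"
  have d: "continuous_on {0..1} ?d" using assms by (intro continuous_intros)
  have "primitive ?d = primitive (\<lambda>_. 0)"
    using assms(3) by (intro primitive_cong_AE continuous_L2_I01 d) auto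
  then have "primitive ?d = (\<lambda>_. 0)" by (simp add: primitive_def fun_eq_iff)
  then have "((\<lambda>_. 0) has_vector_derivative ?d x) (at x within {0..1})"
    using primitive_has_vector_derivative[OF d assms(4)] by simp
  moreover have "((\<lambda>_. 0 :: complex) has_vector_derivative 0) (at x within {0..1})"
    by (rule has_vector_derivative_const)
  ultimately have "?d x = 0"
    using vector_derivative_within_closed_interval[of 0 1 x] assms(4)
    by (metis zero_less_one)
  then show ?thesis by simp
qed

lemma cont_rep_eq:
  assumes "continuous_on {0..1} V" "AE y in I01. V y = v y" "x \<in> {0..1}"
  shows "cont_rep v x = V x"
  unfolding cont_rep_def
proof (rule the_equality)
  show "\<exists>V'. continuous_on {0..1} V' \<and> (AE y in I01. V' y = v y) \<and> V x = V' x"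
    using assms by blast
  fix c assume "\<exists>V'. continuous_on {0..1} V' \<and> (AE y in I01. V' y = v y) \<and> c = V' x"
  then obtain W where W: "continuous_on {0..1} W" "AE y in I01. W y = v y" "c = W x" by blast
  have "AE y in I01. W y = V y" using W(2) assms(2) by eventually_elim simp
  then show "c = V x" using continuous_AE_unique[OF W(1) assms(1) _ assms(3)] W(3) by simp
qed

lemma point_deriv_eq:
  assumes "\<And>x. x \<in> {0..1} \<Longrightarrow> (V has_vector_derivative V' x) (at x within {0..1})"
    and "AE y in I01. V y = v y" "x \<in> {0..1}"
  shows "point_deriv v x = V' x"
proof -
  have V: "continuous_on {0..1} V"
    using assms(1) has_vector_derivative_continuous continuous_on_eq_continuous_within by blast
  have "(cont_rep v has_vector_derivative V' x) (at x within {0..1})"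
    by (rule has_vector_derivative_transform[OF assms(3) _ assms(1)[OF assms(3)]])
      (rule cont_rep_eq[OF V assms(2)])
  then show ?thesis
    unfolding point_deriv_def using assms(3) by (intro vector_derivative_within_closed_interval) auto
qed

definition compactly_supported :: "(real \<Rightarrow> real) \<Rightarrow> bool" where
  "compactly_supported h \<longleftrightarrow> continuous_on UNIV h \<and> (\<exists>a b. 0 < a \<and> b < 1 \<and> (\<forall>x. x \<notin> {a..b} \<longrightarrow> h x = 0))"

text \<open>The primitive vanishes to the left of the support, and to the right of it because the total integral is
  zero; so it is itself a test function.\<close>

lemma test_function_primitive:
  assumes h: "compactly_supported h" and zero: "(\<integral>x. complex_of_real (h x) \<partial>I01) = 0"
  shows "\<exists>\<phi>\<in>test_functions. deriv \<phi> = h"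
proof -
  obtain a b where ab: "0 < a" "b < 1" "\<And>x. x \<notin> {a..b} \<Longrightarrow> h x = 0" and cont: "continuous_on UNIV h"
    using h unfolding compactly_supported_def by blast
  let ?h = "\<lambda>x. complex_of_real (h x)"
  define \<phi> where "\<phi> x = Re (primitive ?h x)" for x
  have left: "\<phi> x = 0" if "x \<le> a" for x
  proof -
    have "indicator {..<x} y *\<^sub>R ?h y = 0" for y
      using ab(3)[of y] that by (auto simp: indicator_def)
    then show ?thesis by (simp only: \<phi>_def primitive_def integral_zero zero_complex.sel)
  qed
  have right: "\<phi> x = 0" if "b < x" for x
  proof -
    have "indicator {..<x} y *\<^sub>R ?h y = ?h y" for y
      using ab(3)[of y] that by (auto simp: indicator_def)
    then show ?thesis by (simp only: \<phi>_def primitive_def zero zero_complex.sel)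
  qed
  have der: "(\<phi> has_vector_derivative h x) (at x)" for x
  proof -
    consider "x < a" | "b < x" | "x \<in> {0<..<1}" using ab by fastforce
    then show ?thesis
    proof cases
      case 1
      have "(\<phi> has_vector_derivative 0) (at x)"
        by (rule has_vector_derivative_transform_within_open[OF has_vector_derivative_const open_lessThan[of a]])
          (use 1 left in auto)
      then show ?thesis using ab(3)[of x] 1 by simp
    next
      case 2
      have "(\<phi> has_vector_derivative 0) (at x)"
        by (rule has_vector_derivative_transform_within_open[OF has_vector_derivative_const open_greaterThan[of b]])
          (use 2 right in auto)
      then show ?thesis using ab(3)[of x] 2 by simp
    next
      case 3
      have "continuous_on {0..1} ?h"
        using cont by (intro continuous_on_of_real) (rule continuous_on_subset, auto)
      then have "(primitive ?h has_vector_derivative ?h x) (at x within {0..1})"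
        using 3 by (intro primitive_has_vector_derivative) auto
      then have "(primitive ?h has_vector_derivative ?h x) (at x)"
        using 3 by (simp add: at_within_Icc_at)
      from bounded_linear.has_vector_derivative[OF bounded_linear_Re this]
      show ?thesis by (simp add: \<phi>_def[abs_def])
    qed
  qed
  have "\<phi> C1_differentiable_on UNIV"
    unfolding C1_differentiable_on_def using der cont by blast
  moreover have "\<exists>K. compact K \<and> K \<subseteq> {0<..<1} \<and> (\<forall>x. x \<notin> K \<longrightarrow> \<phi> x = 0)"
    using ab left right by (intro exI[of _ "{a..b}"]) force
  moreover have "deriv \<phi> = h"
    using der by (auto simp: fun_eq_iff has_real_derivative_iff_has_vector_derivative intro: DERIV_imp_deriv)
  ultimately show ?thesis unfolding test_functions_def by blast
qed

lemma compactly_supported_diff_scale: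
  assumes "compactly_supported h" "compactly_supported k"
  shows "compactly_supported (\<lambda>x. h x - r * k x)"
proof -
  obtain a b c d where *: "0 < a" "b < 1" "\<And>x. x \<notin> {a..b} \<Longrightarrow> h x = 0"
    "0 < c" "d < 1" "\<And>x. x \<notin> {c..d} \<Longrightarrow> k x = 0"
    using assms unfolding compactly_supported_def by metis
  have "h x - r * k x = 0" if "x \<notin> {min a c..max b d}" for x
  proof -
    have "x \<notin> {a..b}" "x \<notin> {c..d}" using that by auto
    then show ?thesis using * by simp
  qed
  then have "\<exists>a b. 0 < a \<and> b < 1 \<and> (\<forall>x. x \<notin> {a..b} \<longrightarrow> h x - r * k x = 0)"
    using * by (intro exI[of _ "min a c"] exI[of _ "max b d"]) simp
  moreover have "continuous_on UNIV (\<lambda>x. h x - r * k x)"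
    using assms unfolding compactly_supported_def by (intro continuous_intros) auto
  ultimately show ?thesis unfolding compactly_supported_def by blast
qed

lemma compactly_supported_L2:
  assumes "compactly_supported h"
  shows "(\<lambda>x. complex_of_real (h x)) \<in> L2 I01"
proof (rule continuous_L2_I01, rule continuous_on_of_real)
  show "continuous_on {0..1} h"
    using assms unfolding compactly_supported_def by (metis continuous_on_subset subset_UNIV)
qed

lemma compactly_supported_Re_Im:
  assumes "g \<in> bump_functions"
  shows "compactly_supported (\<lambda>x. Re (g x))" "compactly_supported (\<lambda>x. Im (g x))"
proof -
  obtain a b where "0 < a" "b < 1" "\<And>x. x \<notin> {a..b} \<Longrightarrow> g x = 0" and "continuous_on UNIV g"
    using assms smooth_continuous unfolding bump_functions_def by blast
  moreover from this have "\<forall>x. x \<notin> {a..b} \<longrightarrow> Re (g x) = 0" "\<forall>x. x \<notin> {a..b} \<longrightarrow> Im (g x) = 0"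
    by simp_all
  ultimately show "compactly_supported (\<lambda>x. Re (g x))" "compactly_supported (\<lambda>x. Im (g x))"
    unfolding compactly_supported_def by (blast intro: continuous_on_Re continuous_on_Im)+
qed

lemma orthogonal_to_bumps_imp_zero:
  assumes "\<And>g. g \<in> bump_functions \<Longrightarrow> inner F (cls g) = 0"
  shows "F = 0"
proof -
  have "closed {H. inner F H = 0}"
    by (intro closed_Collect_eq continuous_intros)
  then have "closure (cls ` bump_functions) \<subseteq> {H. inner F H = 0}"
    using assms by (intro closure_minimal) auto
  then have "F \<in> {H. inner F H = 0}" unfolding bump_functions_dense by blast
  then show ?thesis by simp
qed

text \<open>Otherwise the constant \<open>1\<close> would be orthogonal to all bump functions, which are dense.\<close>

lemma exists_normalised_compactly_supported:
  "\<exists>h. compactly_supported h \<and> (\<integral>x. complex_of_real (h x) \<partial>I01) = 1"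
proof -
  let ?one = "\<lambda>x::real. 1 :: complex"
  have "cls ?one \<noteq> 0"
  proof
    assume "cls ?one = 0"
    then have "norm (cls ?one) = 0" by simp
    then show False by (simp add: norm_cls const_L2_I01 L2norm_def)
  qed
  then obtain g where g: "g \<in> bump_functions" "inner (cls ?one) (cls g) \<noteq> 0"
    using orthogonal_to_bumps_imp_zero by blast
  note h = compactly_supported_Re_Im(1)[OF g(1)]
  define r where "r = (\<integral>x. Re (g x) \<partial>I01)"
  have "inner (cls ?one) (cls g) = r"
    by (simp add: inner_cls const_L2_I01 bump_L2[OF g(1)] r_def)
  then have r: "r \<noteq> 0" using g(2) by simp
  \<comment> \<open>Division by \<open>r\<close>, in the form of the linear combination known to keep the support compact.\<close>
  have "compactly_supported (\<lambda>x. Re (g x) - (1 - 1 / r) * Re (g x))"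
    by (rule compactly_supported_diff_scale[OF h h])
  moreover have "Re (g x) - (1 - 1 / r) * Re (g x) = Re (g x) / r" for x
    using r by (simp add: field_simps)
  ultimately have "compactly_supported (\<lambda>x. Re (g x) / r)" by simp
  moreover have "(\<integral>x. complex_of_real (Re (g x) / r) \<partial>I01) = 1"
    using r by (simp only: integral_complex_of_real) (simp add: r_def)
  ultimately show ?thesis by blast
qed

text \<open>Compactly supported functions of mean zero are derivatives of test functions, hence orthogonal to \<open>f\<close>.
  Splitting off the mass of an arbitrary one along a fixed \<open>k\<close> shows that \<open>f - c\<close> is orthogonal to all
  of them, in particular to the real and imaginary parts of bump functions, and these are dense.\<close>

lemma du_Bois_Reymond:
  assumes f: "f \<in> L2 I01" and zero: "\<And>\<phi>. \<phi> \<in> test_functions \<Longrightarrow> (\<integral>x. deriv \<phi> x *\<^sub>R f x \<partial>I01) = 0"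
  shows "\<exists>c. AE x in I01. f x = c"
proof -
  obtain k where k: "compactly_supported k" "(\<integral>x. complex_of_real (k x) \<partial>I01) = 1"
    using exists_normalised_compactly_supported by blast
  define c where "c = (\<integral>x. complex_of_real (k x) * f x \<partial>I01)"
  have key: "(\<integral>x. complex_of_real (h x) * (f x - c) \<partial>I01) = 0" if h: "compactly_supported h" for h
  proof -
    define r where "r = (\<integral>x. h x \<partial>I01)"
    note Lh = compactly_supported_L2[OF h] and Lk = compactly_supported_L2[OF k(1)]
    note int = L2_imp_integrable[OF Lh] L2_imp_integrable[OF Lk] L2_mult_integrable[OF Lh f] L2_mult_integrable[OF Lk f]
    have r: "(\<integral>x. complex_of_real (h x) \<partial>I01) = complex_of_real r"
      by (simp add: r_def)
    \<comment> \<open>Subtracting from \<open>h\<close> its mass times \<open>k\<close> leaves mean zero.\<close>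
    have "(\<integral>x. complex_of_real (h x - r * k x) \<partial>I01) = (\<integral>x. complex_of_real (h x) - complex_of_real r * complex_of_real (k x) \<partial>I01)"
      by simp
    also have "\<dots> = 0"
      using int k(2) r by (subst Bochner_Integration.integral_diff) simp_all
    finally obtain \<phi> where \<phi>: "\<phi> \<in> test_functions" "deriv \<phi> = (\<lambda>x. h x - r * k x)"
      using test_function_primitive[OF compactly_supported_diff_scale[OF h k(1)]] by blast
    have "0 = (\<integral>x. complex_of_real (h x) * f x - complex_of_real r * (complex_of_real (k x) * f x) \<partial>I01)"
      using zero[OF \<phi>(1)] unfolding \<phi>(2) by (simp add: scaleR_conv_of_real algebra_simps)
    also have "\<dots> = (\<integral>x. complex_of_real (h x) * f x \<partial>I01) - complex_of_real r * c"
      unfolding c_def using int by (subst Bochner_Integration.integral_diff) simp_all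
    also have "\<dots> = (\<integral>x. complex_of_real (h x) * f x - complex_of_real (h x) * c \<partial>I01)"
      using int by (subst Bochner_Integration.integral_diff) (simp_all add: r[symmetric])
    finally show ?thesis by (simp add: right_diff_distrib)
  qed
  have fc: "(\<lambda>x. f x - c) \<in> L2 I01" by (intro L2_diff f const_L2_I01)
  have "cls (\<lambda>x. f x - c) = 0"
  proof (rule orthogonal_to_bumps_imp_zero)
    fix g assume g: "g \<in> bump_functions"
    note LRe = compactly_supported_L2[OF compactly_supported_Re_Im(1)[OF g]]
      and LIm = compactly_supported_L2[OF compactly_supported_Re_Im(2)[OF g]]
    have "(\<integral>x. (f x - c) * cnj (g x) \<partial>I01)
        = (\<integral>x. complex_of_real (Re (g x)) * (f x - c) - \<i> * (complex_of_real (Im (g x)) * (f x - c)) \<partial>I01)"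
      by (intro Bochner_Integration.integral_cong refl) (simp add: complex_eq_iff)
    also have "\<dots> = 0"
      using L2_mult_integrable[OF LRe fc] L2_mult_integrable[OF LIm fc]
        key[OF compactly_supported_Re_Im(1)[OF g]] key[OF compactly_supported_Re_Im(2)[OF g]]
      by (subst Bochner_Integration.integral_diff) simp_all
    finally show "inner (cls (\<lambda>x. f x - c)) (cls g) = 0"
      using L2_mult_integrable[OF fc L2_cnj[OF bump_L2[OF g]]]
      unfolding inner_cls[OF fc bump_L2[OF g]] by (subst integral_Re) simp_all
  qed
  then have "AE x in I01. f x - c = 0"
    using cls_eq_iff[OF fc L2_0] by (simp add: cls_zero)
  then show ?thesis by (auto elim!: eventually_mono intro!: exI[of _ c])
qed

lemma test_function_derivative:
  assumes "\<phi> \<in> test_functions"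
  shows "(\<phi> has_vector_derivative deriv \<phi> x) (at x)" "continuous_on UNIV (deriv \<phi>)" "\<phi> 0 = 0" "\<phi> 1 = 0"
proof -
  obtain D where D: "\<And>x. (\<phi> has_vector_derivative D x) (at x)" "continuous_on UNIV D"
    using assms unfolding test_functions_def C1_differentiable_on_def by auto
  have "deriv \<phi> = D"
    using D by (auto simp: fun_eq_iff has_real_derivative_iff_has_vector_derivative intro: DERIV_imp_deriv)
  then show "(\<phi> has_vector_derivative deriv \<phi> x) (at x)" "continuous_on UNIV (deriv \<phi>)" using D by auto
  obtain K where "K \<subseteq> {0<..<1}" "\<And>x. x \<notin> K \<Longrightarrow> \<phi> x = 0"
    using assms unfolding test_functions_def by auto
  then show "\<phi> 0 = 0" "\<phi> 1 = 0" by force+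
qed

lemma integral_test_function_primitive:
  assumes \<phi>: "\<phi> \<in> test_functions" and g: "g \<in> L2 I01"
  shows "(\<integral>x. deriv \<phi> x *\<^sub>R (c + primitive g x) \<partial>I01) = - (\<integral>x. \<phi> x *\<^sub>R g x \<partial>I01)"
proof -
  have "(\<integral>x. complex_of_real (deriv \<phi> x) * (c + primitive g x) \<partial>I01)
    = complex_of_real (\<phi> 1) * (c + primitive g 1) - complex_of_real (\<phi> 0) * c - (\<integral>x. complex_of_real (\<phi> x) * g x \<partial>I01)"
  proof (rule integral_by_parts_primitive[OF g])
    show "((\<lambda>x. complex_of_real (\<phi> x)) has_vector_derivative complex_of_real (deriv \<phi> x)) (at x within {0..1})" for x
      using test_function_derivative(1)[OF \<phi>, of x, THEN has_vector_derivative_at_within]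
      by (intro has_vector_derivative_of_real) (simp add: has_real_derivative_iff_has_vector_derivative)
    show "continuous_on {0..1} (\<lambda>x. complex_of_real (deriv \<phi> x))"
      by (intro continuous_on_of_real continuous_on_subset[OF test_function_derivative(2)[OF \<phi>]]) auto
  qed
  then show ?thesis
    by (simp add: scaleR_conv_of_real test_function_derivative[OF \<phi>])
qed

lemma test_function_L2:
  assumes "\<phi> \<in> test_functions"
  shows "(\<lambda>x. complex_of_real (deriv \<phi> x)) \<in> L2 I01"
  by (intro continuous_L2_I01 continuous_on_of_real continuous_on_subset[OF test_function_derivative(2)[OF assms]]) auto

text \<open>Weakly differentiable functions are the primitives of their weak derivatives: subtracting the
  primitive leaves a function with weak derivative zero.\<close>

lemma weak_deriv_iff_primitive:
  "weak_deriv f g \<longleftrightarrow> f \<in> L2 I01 \<and> g \<in> L2 I01 \<and> (\<exists>c. AE x in I01. f x = c + primitive g x)"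
proof (cases "f \<in> L2 I01 \<and> g \<in> L2 I01")
  case True
  then have f: "f \<in> L2 I01" and g: "g \<in> L2 I01" by auto
  note prim = continuous_L2_I01[OF continuous_primitive[OF g]]
  have "(\<exists>c. AE x in I01. f x = c + primitive g x) \<longleftrightarrow>
    (\<forall>\<phi>\<in>test_functions. (\<integral>x. deriv \<phi> x *\<^sub>R f x \<partial>I01) = - (\<integral>x. \<phi> x *\<^sub>R g x \<partial>I01))"
  proof safe
    fix c \<phi> assume ae: "AE x in I01. f x = c + primitive g x" and \<phi>: "\<phi> \<in> test_functions"
    have "(\<integral>x. deriv \<phi> x *\<^sub>R f x \<partial>I01) = (\<integral>x. deriv \<phi> x *\<^sub>R (c + primitive g x) \<partial>I01)"
    proof (rule integral_cong_AE)
      show "(\<lambda>x. deriv \<phi> x *\<^sub>R f x) \<in> borel_measurable I01"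
        "(\<lambda>x. deriv \<phi> x *\<^sub>R (c + primitive g x)) \<in> borel_measurable I01"
        unfolding scaleR_conv_of_real
        using test_function_L2[OF \<phi>] f prim L2_measurable by (auto intro!: borel_measurable_times borel_measurable_add)
    qed (use ae in \<open>auto elim: eventually_mono\<close>)
    then show "(\<integral>x. deriv \<phi> x *\<^sub>R f x \<partial>I01) = - (\<integral>x. \<phi> x *\<^sub>R g x \<partial>I01)"
      using integral_test_function_primitive[OF \<phi> g, of c] by simp
  next
    assume weak: "\<forall>\<phi>\<in>test_functions. (\<integral>x. deriv \<phi> x *\<^sub>R f x \<partial>I01) = - (\<integral>x. \<phi> x *\<^sub>R g x \<partial>I01)"
    have "\<exists>c. AE x in I01. f x - primitive g x = c"
    proof (rule du_Bois_Reymond[OF L2_diff[OF f prim]])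
      fix \<phi> assume \<phi>: "\<phi> \<in> test_functions"
      have "(\<integral>x. deriv \<phi> x *\<^sub>R (f x - primitive g x) \<partial>I01)
          = (\<integral>x. deriv \<phi> x *\<^sub>R f x \<partial>I01) - (\<integral>x. deriv \<phi> x *\<^sub>R (0 + primitive g x) \<partial>I01)"
        using L2_mult_integrable[OF test_function_L2[OF \<phi>] f] L2_mult_integrable[OF test_function_L2[OF \<phi>] prim]
        by (simp add: scaleR_conv_of_real right_diff_distrib)
      then show "(\<integral>x. deriv \<phi> x *\<^sub>R (f x - primitive g x) \<partial>I01) = 0"
        using weak \<phi> integral_test_function_primitive[OF \<phi> g, of 0] by simp
    qed
    then show "\<exists>c. AE x in I01. f x = c + primitive g x"
      by (auto elim!: eventually_mono simp: algebra_simps)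
  qed
  then show ?thesis using True by (simp add: weak_deriv_def)
qed (auto simp: weak_deriv_def)

section \<open>The domain of the operator\<close>

text \<open>The continuous representative of an element of the domain together with its derivatives:
  \<open>V1 = V0'\<close> and \<open>V2 = V0''\<close> are classical, whereas the third derivative \<open>w\<close> is only in \<open>L\<^sup>2\<close> and
  enters through its primitive.\<close>

locale third_order_profile =
  fixes \<beta> :: real and V0 V1 V2 w :: "real \<Rightarrow> complex"
  assumes \<beta>: "0 \<le> \<beta>" "\<beta> < 1"
    and w: "w \<in> L2 I01"
    and deriv_V0: "\<And>x. x \<in> {0..1} \<Longrightarrow> (V0 has_vector_derivative V1 x) (at x within {0..1})"
    and deriv_V1: "\<And>x. x \<in> {0..1} \<Longrightarrow> (V1 has_vector_derivative V2 x) (at x within {0..1})"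
    and V2_eq: "\<And>x. V2 x = V2 0 + primitive w x"
    and boundary: "V0 0 = 0" "V0 1 = 0" "V1 1 = complex_of_real \<beta> * V1 0"
begin

lemma continuous: "continuous_on {0..1} V0" "continuous_on {0..1} V1" "continuous_on {0..1} V2"
proof -
  show "continuous_on {0..1} V0"
    using deriv_V0 has_vector_derivative_continuous continuous_on_eq_continuous_within by blast
  show "continuous_on {0..1} V1"
    using deriv_V1 has_vector_derivative_continuous continuous_on_eq_continuous_within by blast
  have "V2 = (\<lambda>x. V2 0 + primitive w x)" using V2_eq by blast
  then show "continuous_on {0..1} V2"
    using continuous_on_add[OF continuous_on_const continuous_primitive[OF w]] by metis
qed

lemma deriv_cnj_V0: "x \<in> {0..1} \<Longrightarrow> ((\<lambda>x. cnj (V0 x)) has_vector_derivative cnj (V1 x)) (at x within {0..1})"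
  and deriv_cnj_V1: "x \<in> {0..1} \<Longrightarrow> ((\<lambda>x. cnj (V1 x)) has_vector_derivative cnj (V2 x)) (at x within {0..1})"
  by (rule has_vector_derivative_cnj[OF deriv_V0] has_vector_derivative_cnj[OF deriv_V1], assumption)+

lemma real_integrable: "continuous_on {0..1} f \<Longrightarrow> integrable I01 (\<lambda>x. Re (f x))"
  by (intro integrable_Re L2_imp_integrable continuous_L2_I01)

lemma integral_Re_eq_diff:
  assumes "\<And>x. x \<in> {0..1} \<Longrightarrow> (F has_vector_derivative f x) (at x within {0..1})"
    and "continuous_on {0..1} f"
  shows "(\<integral>x. Re (f x) \<partial>I01) = Re (F 1) - Re (F 0)"
  using integral_eq_diff[OF assms] L2_imp_integrable[OF continuous_L2_I01[OF assms(2)]]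
  by (subst integral_Re) simp_all

lemma V1_1_sq: "(cmod (V1 1))\<^sup>2 = \<beta>\<^sup>2 * (cmod (V1 0))\<^sup>2"
  by (simp add: boundary norm_mult power_mult_distrib)

text \<open>Testing the equation with the solution: two integrations by parts leave only the boundary
  values of \<open>\<bar>V1\<bar>\<^sup>2\<close>.\<close>

lemma integral_w_V0:
  "(\<integral>x. Re (w x * cnj (V0 x)) \<partial>I01) = (1 - \<beta>\<^sup>2) / 2 * (cmod (V1 0))\<^sup>2"
proof -
  have "(\<integral>x. cnj (V1 x) * (V2 0 + primitive w x) \<partial>I01) = - (\<integral>x. cnj (V0 x) * w x \<partial>I01)"
    using integral_by_parts_primitive[OF w deriv_cnj_V0, of "V2 0"] continuous
    by (simp add: boundary continuous_on_cnj)
  then have "(\<integral>x. w x * cnj (V0 x) \<partial>I01) = - (\<integral>x. cnj (V1 x) * V2 x \<partial>I01)"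
    by (simp only: V2_eq[symmetric] mult.commute[of "w _"]) simp
  then have "Re (\<integral>x. w x * cnj (V0 x) \<partial>I01) = - Re (\<integral>x. cnj (V1 x) * V2 x \<partial>I01)"
    by simp
  then have 1: "(\<integral>x. Re (w x * cnj (V0 x)) \<partial>I01) = - (\<integral>x. Re (cnj (V1 x) * V2 x) \<partial>I01)"
    using L2_mult_integrable[OF w L2_cnj[OF continuous_L2_I01[OF continuous(1)]]]
      L2_mult_integrable[OF L2_cnj[OF continuous_L2_I01[OF continuous(2)]] continuous_L2_I01[OF continuous(3)]]
    by (simp only: integral_Re)
  have "(\<integral>x. Re (cnj (V1 x) * V2 x + cnj (V2 x) * V1 x) \<partial>I01) = Re (cnj (V1 1) * V1 1) - Re (cnj (V1 0) * V1 0)"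
    by (rule integral_Re_eq_diff[where F = "\<lambda>x. cnj (V1 x) * V1 x"])
      (intro has_vector_derivative_mult deriv_cnj_V1 deriv_V1 continuous_intros continuous; assumption)+
  also have "(\<integral>x. Re (cnj (V1 x) * V2 x + cnj (V2 x) * V1 x) \<partial>I01) = (\<integral>x. 2 * Re (cnj (V1 x) * V2 x) \<partial>I01)"
    by (intro Bochner_Integration.integral_cong refl) simp
  finally have "2 * (\<integral>x. Re (cnj (V1 x) * V2 x) \<partial>I01) = (cmod (V1 1))\<^sup>2 - (cmod (V1 0))\<^sup>2"
    by (simp only: integral_mult_right_zero mult.commute[of "cnj _"] Re_mult_cnj_self)
  then show ?thesis
    unfolding 1 V1_1_sq by (simp add: field_simps)
qed

text \<open>The same computation with the multiplier \<open>x\<close>, which makes the interior term \<open>\<bar>V1\<bar>\<^sup>2\<close> appear.\<close>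

lemma integral_weight_w_V0:
  "(\<integral>x. x * Re (w x * cnj (V0 x)) \<partial>I01)
    = 3 / 2 * (\<integral>x. (cmod (V1 x))\<^sup>2 \<partial>I01) - \<beta>\<^sup>2 / 2 * (cmod (V1 0))\<^sup>2"
proof -
  have id: "continuous_on {0..1} (\<lambda>x. complex_of_real x)" by (intro continuous_intros)
  have did: "((\<lambda>x. complex_of_real x) has_vector_derivative 1) (at x within {0..1})" for x
    by (rule has_vector_derivative_of_real[where D = 1, simplified]) (rule DERIV_ident)
  note c = continuous id continuous_on_cnj[OF continuous(1)] continuous_on_cnj[OF continuous(2)] continuous_on_cnj[OF continuous(3)]
  define A where "A = (\<integral>x. Re (cnj (V0 x) * V2 x) \<partial>I01)"
  define J where "J = (\<integral>x. Re (cnj (V1 x) * V1 x) \<partial>I01)"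
  define B where "B = (\<integral>x. Re (complex_of_real x * cnj (V1 x) * V2 x) \<partial>I01)"
  have int: "integrable I01 (\<lambda>x. Re (cnj (V0 x) * V2 x))" "integrable I01 (\<lambda>x. Re (cnj (V1 x) * V1 x))"
    "integrable I01 (\<lambda>x. Re (complex_of_real x * cnj (V1 x) * V2 x))"
    by (intro real_integrable continuous_on_mult c)+
  have "(\<integral>x. Re (cnj (V0 x) * V2 x + cnj (V1 x) * V1 x) \<partial>I01) = Re (cnj (V0 1) * V1 1) - Re (cnj (V0 0) * V1 0)"
    by (rule integral_Re_eq_diff[where F = "\<lambda>x. cnj (V0 x) * V1 x"])
      (intro has_vector_derivative_mult deriv_cnj_V0 deriv_V1 continuous_on_mult continuous_on_add c; assumption)+
  then have AJ: "A + J = 0"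
    unfolding A_def J_def boundary plus_complex.sel
    using int by (subst Bochner_Integration.integral_add[symmetric]) simp_all
  have "(\<integral>x. Re (complex_of_real x * (cnj (V1 x) * V2 x + cnj (V2 x) * V1 x) + 1 * (cnj (V1 x) * V1 x)) \<partial>I01)
      = Re (complex_of_real 1 * (cnj (V1 1) * V1 1)) - Re (complex_of_real 0 * (cnj (V1 0) * V1 0))"
    by (rule integral_Re_eq_diff[where F = "\<lambda>x. complex_of_real x * (cnj (V1 x) * V1 x)"])
      (intro has_vector_derivative_mult did deriv_cnj_V1 deriv_V1 continuous_on_mult continuous_on_add continuous_on_const c; assumption)+
  also have "(\<integral>x. Re (complex_of_real x * (cnj (V1 x) * V2 x + cnj (V2 x) * V1 x) + 1 * (cnj (V1 x) * V1 x)) \<partial>I01)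
      = (\<integral>x. 2 * Re (complex_of_real x * cnj (V1 x) * V2 x) + Re (cnj (V1 x) * V1 x) \<partial>I01)"
    by (intro Bochner_Integration.integral_cong refl) (simp add: algebra_simps)
  also have "\<dots> = 2 * B + J"
    unfolding B_def J_def
    using Bochner_Integration.integral_add[OF integrable_mult_right[OF int(3), of 2] int(2)]
    by (simp only: integral_mult_right_zero)
  finally have BJ: "2 * B + J = (cmod (V1 1))\<^sup>2"
    by (simp only: of_real_1 of_real_0 mult_1 mult_zero_left zero_complex.sel diff_0_right mult.commute[of "cnj _"] Re_mult_cnj_self)
  let ?\<phi>' = "\<lambda>x. complex_of_real x * cnj (V1 x) + 1 * cnj (V0 x)"
  have "(\<integral>x. ?\<phi>' x * (V2 0 + primitive w x) \<partial>I01)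
      = complex_of_real 1 * cnj (V0 1) * (V2 0 + primitive w 1) - complex_of_real 0 * cnj (V0 0) * V2 0
        - (\<integral>x. (complex_of_real x * cnj (V0 x)) * w x \<partial>I01)"
    by (rule integral_by_parts_primitive[OF w])
      (intro has_vector_derivative_mult did deriv_cnj_V0 continuous_on_mult continuous_on_add continuous_on_const c; assumption)+
  then have "(\<integral>x. ?\<phi>' x * V2 x \<partial>I01) = - (\<integral>x. (complex_of_real x * cnj (V0 x)) * w x \<partial>I01)"
    by (simp only: V2_eq[symmetric]) (simp add: boundary)
  then have "Re (\<integral>x. ?\<phi>' x * V2 x \<partial>I01) = - Re (\<integral>x. (complex_of_real x * cnj (V0 x)) * w x \<partial>I01)"
    by simp
  moreover have "Re (\<integral>x. ?\<phi>' x * V2 x \<partial>I01) = (\<integral>x. Re (?\<phi>' x * V2 x) \<partial>I01)"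
    by (intro integral_Re[symmetric] L2_imp_integrable continuous_L2_I01 continuous_on_mult continuous_on_add continuous_on_const c)
  moreover have "Re (\<integral>x. (complex_of_real x * cnj (V0 x)) * w x \<partial>I01) = (\<integral>x. Re ((complex_of_real x * cnj (V0 x)) * w x) \<partial>I01)"
    by (intro integral_Re[symmetric] L2_mult_integrable w continuous_L2_I01 continuous_on_mult c)
  moreover have "(\<integral>x. Re (?\<phi>' x * V2 x) \<partial>I01) = (\<integral>x. Re (complex_of_real x * cnj (V1 x) * V2 x) + Re (cnj (V0 x) * V2 x) \<partial>I01)"
    by (intro Bochner_Integration.integral_cong refl) (simp add: algebra_simps)
  moreover have "\<dots> = B + A"
    unfolding A_def B_def by (rule Bochner_Integration.integral_add[OF int(3,1)])
  moreover have "(\<integral>x. Re ((complex_of_real x * cnj (V0 x)) * w x) \<partial>I01) = (\<integral>x. x * Re (w x * cnj (V0 x)) \<partial>I01)"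
    by (intro Bochner_Integration.integral_cong refl) (simp add: algebra_simps)
  ultimately have "(\<integral>x. x * Re (w x * cnj (V0 x)) \<partial>I01) = - (B + A)" by linarith
  moreover have "J = (\<integral>x. (cmod (V1 x))\<^sup>2 \<partial>I01)"
    unfolding J_def by (simp only: mult.commute[of "cnj _"] Re_mult_cnj_self)
  ultimately show ?thesis
    using AJ BJ unfolding V1_1_sq by (simp add: field_simps)
qed

text \<open>\<open>V0\<close> vanishes at \<open>0\<close>, so it is a primitive of \<open>V1\<close>, and a primitive is bounded pointwise by the norm of
  its integrand.\<close>

lemma poincare: "(\<integral>x. (cmod (V0 x))\<^sup>2 \<partial>I01) \<le> (\<integral>x. (cmod (V1 x))\<^sup>2 \<partial>I01)"
proof -
  note L = continuous_L2_I01[OF continuous(2)]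
  have "cmod (V0 x) \<le> L2norm I01 V1" if "0 < x" "x < 1" for x
    using cmod_primitive_le[OF L, of x] primitive_eq_diff[OF deriv_V0 continuous(2), of x] that
    by (simp add: boundary)
  then have "L2norm I01 V0 \<le> L2norm I01 V1"
    using L2_measurable[OF continuous_L2_I01[OF continuous(1)]] by (intro L2norm_le_bound) auto
  then have "(L2norm I01 V0)\<^sup>2 \<le> (L2norm I01 V1)\<^sup>2" by (intro power_mono) auto
  then show ?thesis by (simp only: L2norm_square)
qed

text \<open>The boundary condition fixes the mean of \<open>V2\<close> and thereby the constant of integration; so \<open>V2\<close>,
  and then \<open>V1\<close>, is bounded by \<open>V1 0\<close> and \<open>w\<close>.\<close>

lemma cmod_V1_le:
  assumes x: "x \<in> {0..1}"
  shows "cmod (V1 x) \<le> 2 * cmod (V1 0) + 2 * L2norm I01 w"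
proof -
  note L2 = continuous_L2_I01[OF continuous(3)] and Lp = continuous_L2_I01[OF continuous_primitive[OF w]]
  have prim_bound: "cmod (\<integral>x. primitive w x \<partial>I01) \<le> L2norm I01 w"
    by (rule order_trans[OF cmod_integral_le_L2norm[OF Lp]], rule L2norm_le_bound)
      (use L2_measurable[OF Lp] cmod_primitive_le[OF w] in auto)
  have "V1 1 - V1 0 = (\<integral>x. V2 0 + primitive w x \<partial>I01)"
    using integral_eq_diff[OF deriv_V1 continuous(3)] by (simp only: V2_eq[symmetric])
  also have "\<dots> = V2 0 + (\<integral>x. primitive w x \<partial>I01)"
    using L2_imp_integrable[OF Lp] by (subst Bochner_Integration.integral_add) simp_all
  finally have "V2 0 = (V1 1 - V1 0) - (\<integral>x. primitive w x \<partial>I01)" by simp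
  then have "cmod (V2 0) \<le> cmod (V1 1 - V1 0) + cmod (\<integral>x. primitive w x \<partial>I01)"
    by (simp only: norm_triangle_ineq4)
  also have "cmod (V1 1 - V1 0) \<le> cmod (V1 0)"
  proof -
    have "V1 1 - V1 0 = complex_of_real (\<beta> - 1) * V1 0" by (simp add: boundary algebra_simps)
    then have "cmod (V1 1 - V1 0) = \<bar>\<beta> - 1\<bar> * cmod (V1 0)" by (simp only: norm_mult norm_of_real)
    then show ?thesis using \<beta> by (simp add: mult_left_le_one_le)
  qed
  finally have V20: "cmod (V2 0) \<le> cmod (V1 0) + L2norm I01 w" using prim_bound by simp
  have V2_bound: "cmod (V2 y) \<le> cmod (V1 0) + 2 * L2norm I01 w" for y
    using norm_triangle_ineq[of "V2 0" "primitive w y"] V20 cmod_primitive_le[OF w, of y] V2_eq[of y] by simp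
  have "cmod (primitive V2 x) \<le> cmod (V1 0) + 2 * L2norm I01 w"
    by (rule order_trans[OF cmod_primitive_le[OF L2]], rule L2norm_le_bound)
      (use V2_bound L2_measurable[OF L2] in auto)
  moreover have "V1 x = V1 0 + primitive V2 x"
    using primitive_eq_diff[OF deriv_V1 continuous(3) x] by simp
  ultimately show ?thesis
    using norm_triangle_ineq[of "V1 0" "primitive V2 x"] by simp
qed

end

text \<open>Integrating three times replaces the weak derivatives, known up to null sets, by a classical \<open>C\<^sup>2\<close>
  function.\<close>

lemma weak_third_derivative:
  assumes "weak_nth_deriv 3 v w"
  obtains V0 V1 V2 where "w \<in> L2 I01" "v \<in> L2 I01" "AE x in I01. V0 x = v x"
    "\<And>x. x \<in> {0..1} \<Longrightarrow> (V0 has_vector_derivative V1 x) (at x within {0..1})"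
    "\<And>x. x \<in> {0..1} \<Longrightarrow> (V1 has_vector_derivative V2 x) (at x within {0..1})"
    "\<And>x. V2 x = V2 0 + primitive w x"
proof -
  obtain v1 v2 v3 where d: "weak_deriv v v1" "weak_deriv v1 v2" "weak_deriv v2 v3"
    and w: "v3 \<in> L2 I01" "w \<in> L2 I01" "AE x in I01. v3 x = w x"
    using assms by (auto simp: eval_nat_numeral)
  obtain c0 c1 c2 where c: "AE x in I01. v x = c0 + primitive v1 x" "AE x in I01. v1 x = c1 + primitive v2 x"
    "AE x in I01. v2 x = c2 + primitive v3 x" and L: "v \<in> L2 I01" "v1 \<in> L2 I01" "v2 \<in> L2 I01"
    using d unfolding weak_deriv_iff_primitive by blast
  define V2 where "V2 x = c2 + primitive w x" for x
  define V1 where "V1 x = c1 + primitive V2 x" for x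
  define V0 where "V0 x = c0 + primitive V1 x" for x
  have "V2 = (\<lambda>x. c2 + primitive w x)" by (simp add: V2_def fun_eq_iff)
  then have cV2: "continuous_on {0..1} V2"
    using continuous_on_add[OF continuous_on_const continuous_primitive[OF w(2)]] by metis
  have "V1 = (\<lambda>x. c1 + primitive V2 x)" by (simp add: V1_def fun_eq_iff)
  then have cV1: "continuous_on {0..1} V1"
    using continuous_on_add[OF continuous_on_const continuous_primitive[OF continuous_L2_I01[OF cV2]]] by metis
  have "AE x in I01. v2 x = V2 x"
    using c(3) primitive_cong_AE[OF w] by (simp add: V2_def)
  then have p2: "primitive v2 = primitive V2" by (rule primitive_cong_AE[OF L(3) continuous_L2_I01[OF cV2]])
  have "AE x in I01. v1 x = V1 x"
    using c(2) p2 by (simp add: V1_def)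
  then have p1: "primitive v1 = primitive V1" by (rule primitive_cong_AE[OF L(2) continuous_L2_I01[OF cV1]])
  show thesis
  proof
    show "AE x in I01. V0 x = v x" using c(1) p1 by (auto simp: V0_def elim: eventually_mono)
    show "(V0 has_vector_derivative V1 x) (at x within {0..1})" if "x \<in> {0..1}" for x
      unfolding V0_def[abs_def] using primitive_has_vector_derivative[OF cV1 that]
      by (auto intro!: derivative_eq_intros)
    show "(V1 has_vector_derivative V2 x) (at x within {0..1})" if "x \<in> {0..1}" for x
      unfolding V1_def[abs_def] using primitive_has_vector_derivative[OF cV2 that]
      by (auto intro!: derivative_eq_intros)
    show "V2 x = V2 0 + primitive w x" for x by (simp add: V2_def)
  qed (use w L in auto)
qed

lemma D_beta_profile:
  assumes v: "v \<in> D_beta \<beta>" and w: "weak_nth_deriv 3 v w" and \<beta>: "0 \<le> \<beta>" "\<beta> < 1"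
  obtains V0 V1 V2 where "third_order_profile \<beta> V0 V1 V2 w" "AE x in I01. V0 x = v x"
    "\<And>x. x \<in> {0..1} \<Longrightarrow> point_deriv v x = V1 x"
proof (rule weak_third_derivative[OF w])
  fix V0 V1 V2
  assume V: "w \<in> L2 I01" "v \<in> L2 I01" "AE x in I01. V0 x = v x"
    "\<And>x. x \<in> {0..1} \<Longrightarrow> (V0 has_vector_derivative V1 x) (at x within {0..1})"
    "\<And>x. x \<in> {0..1} \<Longrightarrow> (V1 has_vector_derivative V2 x) (at x within {0..1})"
    "\<And>x. V2 x = V2 0 + primitive w x"
  have "continuous_on {0..1} V0"
    using V(4) has_vector_derivative_continuous continuous_on_eq_continuous_within by blast
  then have c: "cont_rep v x = V0 x" if "x \<in> {0..1}" for x using cont_rep_eq[OF _ V(3) that] by blast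
  have p: "point_deriv v x = V1 x" if "x \<in> {0..1}" for x using point_deriv_eq[OF V(4,3) that] .
  have "third_order_profile \<beta> V0 V1 V2 w"
  proof
    show "V0 0 = 0" "V0 1 = 0" "V1 1 = complex_of_real \<beta> * V1 0"
      using v c[of 0] c[of 1] p[of 0] p[of 1] by (auto simp: D_beta_def)
  qed (fact \<beta> V)+
  then show thesis by (rule that[OF _ V(3) p])
qed

lemma D_beta_L2: "v \<in> D_beta \<beta> \<Longrightarrow> v \<in> L2 I01"
  by (auto simp: D_beta_def sobolev_H_def eval_nat_numeral weak_deriv_def)

lemma smooth_imp_weak_nth_deriv:
  assumes "smooth k f"
  shows "\<exists>g. weak_nth_deriv k f g"
  using assms
proof (induction k arbitrary: f)
  case 0
  then have "f \<in> L2 I01" by (auto intro!: continuous_L2_I01 intro: continuous_on_subset)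
  then show ?case by auto
next
  case (Suc k)
  then obtain f' where f': "\<And>x. (f has_vector_derivative f' x) (at x)" "smooth k f'" by auto
  then obtain g where g: "weak_nth_deriv k f' g" using Suc.IH by blast
  have c: "continuous_on {0..1} f" "continuous_on {0..1} f'"
    using smooth_continuous[OF Suc.prems] smooth_continuous[OF f'(2)] continuous_on_subset by blast+
  have "f x = f 0 + primitive f' x" if "0 < x \<and> x < 1" for x
    using primitive_eq_diff[OF has_vector_derivative_at_within[OF f'(1)] c(2), of x] that by simp
  then have "AE x in I01. f x = f 0 + primitive f' x"
    using AE_I01_bounds by (auto elim: eventually_mono)
  then have "weak_deriv f f'"
    unfolding weak_deriv_iff_primitive using c by (auto intro: continuous_L2_I01)
  then show ?case using g by auto
qed

text \<open>Vanishing near both end points, a bump function satisfies the boundary conditions for every \<open>\<beta>\<close>.\<close>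

lemma bump_in_D_beta:
  assumes "f \<in> bump_functions"
  shows "f \<in> D_beta \<beta>"
proof -
  obtain a b where ab: "0 < a" "b < 1" "\<And>x. x \<notin> {a..b} \<Longrightarrow> f x = 0" and smooth: "smooth 3 f"
    using assms unfolding bump_functions_def by blast
  obtain f' where f': "\<And>x. (f has_vector_derivative f' x) (at x)"
    using smooth by (auto simp: eval_nat_numeral)
  have cont: "continuous_on {0..1} f"
    using smooth_continuous[OF smooth] continuous_on_subset by blast
  have p: "point_deriv f x = f' x" if "x \<in> {0..1}" for x
    using that f' by (intro point_deriv_eq[where V = f]) (auto intro: has_vector_derivative_at_within)
  have "(f has_vector_derivative 0) (at 0)"
    by (rule has_vector_derivative_transform_within_open[OF has_vector_derivative_const open_lessThan[of a]])
      (use ab in auto)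
  then have "f' 0 = 0" using f' vector_derivative_unique_at by blast
  moreover have "(f has_vector_derivative 0) (at 1)"
    by (rule has_vector_derivative_transform_within_open[OF has_vector_derivative_const open_greaterThan[of b]])
      (use ab in auto)
  then have "f' 1 = 0" using f' vector_derivative_unique_at by blast
  moreover have "f 0 = 0" "f 1 = 0" using ab by auto
  moreover have "cont_rep f x = f x" if "x \<in> {0..1}" for x using cont_rep_eq[OF cont _ that] by auto
  ultimately show ?thesis
    using p smooth_imp_weak_nth_deriv[OF smooth] by (auto simp: D_beta_def sobolev_H_def)
qed

lemma third_order_profile_diff:
  assumes "third_order_profile \<beta> V0 V1 V2 w" "third_order_profile \<beta> W0 W1 W2 z"
  shows "third_order_profile \<beta> (\<lambda>x. V0 x - W0 x) (\<lambda>x. V1 x - W1 x) (\<lambda>x. V2 x - W2 x) (\<lambda>x. w x - z x)"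
proof -
  interpret V: third_order_profile \<beta> V0 V1 V2 w by fact
  interpret W: third_order_profile \<beta> W0 W1 W2 z by fact
  have prim: "primitive (\<lambda>x. w x - z x) x = primitive w x - primitive z x" for x
    unfolding primitive_def
    using L2_imp_integrable[OF L2_indicator[OF V.w]] L2_imp_integrable[OF L2_indicator[OF W.w]]
    by (simp add: scaleR_diff_right)
  show ?thesis
  proof
    show "V2 x - W2 x = V2 0 - W2 0 + primitive (\<lambda>x. w x - z x) x" for x
      unfolding prim using V.V2_eq[of x] W.V2_eq[of x] by simp
  qed (auto intro!: L2_diff has_vector_derivative_diff V.w W.w V.deriv_V0 V.deriv_V1 W.deriv_V0 W.deriv_V1
      simp: V.\<beta> V.boundary W.boundary right_diff_distrib)
qed

lemma third_order_profile_cnj: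
  assumes "third_order_profile \<beta> V0 V1 V2 w"
  shows "third_order_profile \<beta> (\<lambda>x. cnj (V0 x)) (\<lambda>x. cnj (V1 x)) (\<lambda>x. cnj (V2 x)) (\<lambda>x. cnj (w x))"
proof -
  interpret V: third_order_profile \<beta> V0 V1 V2 w by fact
  have prim: "primitive (\<lambda>x. cnj (w x)) x = cnj (primitive w x)" for x
    unfolding primitive_def by (subst Bochner_Integration.integral_cnj[symmetric]) (simp only: complex_cnj_scaleR)
  show ?thesis
  proof
    show "cnj (V2 x) = cnj (V2 0) + primitive (\<lambda>x. cnj (w x)) x" for x
      unfolding prim using V.V2_eq[of x] by (metis complex_cnj_add)
  qed (auto intro!: L2_cnj V.w V.deriv_cnj_V0 V.deriv_cnj_V1 simp: V.\<beta> V.boundary)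
qed

lemma cont_rep_cong_AE:
  assumes "AE x in I01. v x = v' x"
  shows "cont_rep v = cont_rep v'"
proof -
  have "(AE y in I01. V y = v y) \<longleftrightarrow> (AE y in I01. V y = v' y)" for V
  proof
    assume "AE y in I01. V y = v y" with assms show "AE y in I01. V y = v' y" by eventually_elim simp
  next
    assume "AE y in I01. V y = v' y" with assms show "AE y in I01. V y = v y" by eventually_elim simp
  qed
  then show ?thesis by (simp add: cont_rep_def fun_eq_iff)
qed

text \<open>The pointwise derivative depends on the class only; for the generator's domain it is the value of a
  continuous function.\<close>

definition slope :: "l2 \<Rightarrow> real \<Rightarrow> complex" where
  "slope F x = point_deriv (rep F) x"

lemma point_deriv_eq_slope: "v \<in> L2 I01 \<Longrightarrow> point_deriv v x = slope (cls v) x"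
  unfolding slope_def point_deriv_def using cont_rep_cong_AE[OF rep_cls] by simp

text \<open>The graph of \<open>F \<mapsto> - F'''\<close> on the domain. Stating it through a classical representative, rather than
  through the semigroup, lets it apply to conjugates and differences of solutions.\<close>

definition airy_pair :: "real \<Rightarrow> l2 \<Rightarrow> l2 \<Rightarrow> bool" where
  "airy_pair \<beta> F G \<longleftrightarrow> (\<exists>V0 V1 V2 w. third_order_profile \<beta> V0 V1 V2 w \<and> F = cls V0 \<and> G = - cls w)"

lemma slope_profile:
  assumes "third_order_profile \<beta> V0 V1 V2 w" "x \<in> {0..1}"
  shows "slope (cls V0) x = V1 x"
proof -
  interpret V: third_order_profile \<beta> V0 V1 V2 w by fact
  show ?thesis
    using point_deriv_eq_slope[OF continuous_L2_I01[OF V.continuous(1)], of x] point_deriv_eq[OF V.deriv_V0 _ assms(2)]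
    by auto
qed

lemma airy_pair_diff:
  assumes "airy_pair \<beta> F G" "airy_pair \<beta> F' G'"
  shows "airy_pair \<beta> (F - F') (G - G')" "x \<in> {0..1} \<Longrightarrow> slope (F - F') x = slope F x - slope F' x"
proof -
  obtain V0 V1 V2 w where V: "third_order_profile \<beta> V0 V1 V2 w" "F = cls V0" "G = - cls w"
    using assms(1) unfolding airy_pair_def by blast
  obtain W0 W1 W2 z where W: "third_order_profile \<beta> W0 W1 W2 z" "F' = cls W0" "G' = - cls z"
    using assms(2) unfolding airy_pair_def by blast
  interpret V: third_order_profile \<beta> V0 V1 V2 w by fact
  interpret W: third_order_profile \<beta> W0 W1 W2 z by fact
  note D = third_order_profile_diff[OF V(1) W(1)]
  have eq: "F - F' = cls (\<lambda>x. V0 x - W0 x)" "G - G' = - cls (\<lambda>x. w x - z x)"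
    using V W continuous_L2_I01[OF V.continuous(1)] continuous_L2_I01[OF W.continuous(1)] V.w W.w
    by (simp_all add: cls_diff)
  show "airy_pair \<beta> (F - F') (G - G')"
    unfolding airy_pair_def using D eq by blast
  show "slope (F - F') x = slope F x - slope F' x" if "x \<in> {0..1}"
    using slope_profile[OF D that] slope_profile[OF V(1) that] slope_profile[OF W(1) that] by (metis eq(1) V(2) W(2))
qed

lemma airy_pair_conj:
  assumes "airy_pair \<beta> F G"
  shows "airy_pair \<beta> (conj_l2 F) (conj_l2 G)" "x \<in> {0..1} \<Longrightarrow> slope (conj_l2 F) x = cnj (slope F x)"
proof -
  obtain V0 V1 V2 w where V: "third_order_profile \<beta> V0 V1 V2 w" "F = cls V0" "G = - cls w"
    using assms(1) unfolding airy_pair_def by blast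
  interpret V: third_order_profile \<beta> V0 V1 V2 w by fact
  note D = third_order_profile_cnj[OF V(1)]
  have eq: "conj_l2 F = cls (\<lambda>x. cnj (V0 x))" "conj_l2 G = - cls (\<lambda>x. cnj (w x))"
    using V(2,3) continuous_L2_I01[OF V.continuous(1)] V.w
    by (simp_all add: cls_cnj linear_neg[OF bounded_linear.linear[OF bounded_linear_conj_l2]])
  show "airy_pair \<beta> (conj_l2 F) (conj_l2 G)"
    unfolding airy_pair_def using D eq by blast
  show "slope (conj_l2 F) x = cnj (slope F x)" if "x \<in> {0..1}"
    using slope_profile[OF D that] slope_profile[OF V(1) that] by (metis eq(1) V(2))
qed

lemma airy_pair_identities:
  assumes "airy_pair \<beta> F G"
  shows dissipation: "inner G F = - (1 - \<beta>\<^sup>2) / 2 * (cmod (slope F 0))\<^sup>2"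
    and weighted_dissipation: "inner (weight_l2 F) G
      = - 3 / 2 * (\<integral>x. (cmod (slope F x))\<^sup>2 \<partial>I01) + \<beta>\<^sup>2 / 2 * (cmod (slope F 0))\<^sup>2"
    and norm_le_slope: "(norm F)\<^sup>2 \<le> (\<integral>x. (cmod (slope F x))\<^sup>2 \<partial>I01)"
    and slope_bound: "x \<in> {0..1} \<Longrightarrow> cmod (slope F x) \<le> 2 * cmod (slope F 0) + 2 * norm G"
    and continuous_slope: "continuous_on {0..1} (slope F)"
proof -
  obtain V0 V1 V2 w where V: "third_order_profile \<beta> V0 V1 V2 w" "F = cls V0" "G = - cls w"
    using assms(1) unfolding airy_pair_def by blast
  interpret V: third_order_profile \<beta> V0 V1 V2 w by fact
  have s: "slope F x = V1 x" if "x \<in> {0..1}" for x using slope_profile[OF V(1) that] V(2) by simp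
  note L0 = continuous_L2_I01[OF V.continuous(1)]
  have J: "(\<integral>x. (cmod (slope F x))\<^sup>2 \<partial>I01) = (\<integral>x. (cmod (V1 x))\<^sup>2 \<partial>I01)"
    by (rule Bochner_Integration.integral_cong) (auto simp: s)
  show "inner G F = - (1 - \<beta>\<^sup>2) / 2 * (cmod (slope F 0))\<^sup>2"
    unfolding V(2,3) inner_minus_left inner_cls[OF V.w L0] V.integral_w_V0
    using s[of 0] V(2) by (simp add: field_simps)
  have "inner (weight_l2 F) G = - inner (weight_l2 (cls w)) (cls V0)"
    unfolding V(2,3) inner_minus_right by (simp only: inner_weight_l2_commute[of "cls V0"])
  then have "inner (weight_l2 F) G
      = - (3 / 2 * (\<integral>x. (cmod (V1 x))\<^sup>2 \<partial>I01) - \<beta>\<^sup>2 / 2 * (cmod (V1 0))\<^sup>2)"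
    by (simp only: inner_weight_l2[OF V.w L0] V.integral_weight_w_V0)
  then show "inner (weight_l2 F) G
      = - 3 / 2 * (\<integral>x. (cmod (slope F x))\<^sup>2 \<partial>I01) + \<beta>\<^sup>2 / 2 * (cmod (slope F 0))\<^sup>2"
    unfolding J using s[of 0] by simp
  show "(norm F)\<^sup>2 \<le> (\<integral>x. (cmod (slope F x))\<^sup>2 \<partial>I01)"
    unfolding J using V.poincare by (simp add: V(2) norm_cls[OF L0] L2norm_square)
  show "cmod (slope F x) \<le> 2 * cmod (slope F 0) + 2 * norm G" if "x \<in> {0..1}"
    using V.cmod_V1_le[OF that] s[OF that] s[of 0] by (simp add: V(3) norm_cls[OF V.w])
  show "continuous_on {0..1} (slope F)"
    using V.continuous(2) s continuous_on_cong[OF refl, of "{0..1}" "slope F" V1] by blast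
qed

lemma i_T_beta_imp_airy_pair:
  assumes "(v, g) \<in> i_T_beta \<beta>" "0 \<le> \<beta>" "\<beta> < 1"
  shows "v \<in> L2 I01" "airy_pair \<beta> (cls v) (cls g)"
proof -
  obtain w where v: "v \<in> D_beta \<beta>" and w: "weak_nth_deriv 3 v w" and g: "g = (\<lambda>x. \<i> * ((- \<i>) ^ 3 * w x))"
    using assms(1) unfolding i_T_beta_def T_beta_def by blast
  show "v \<in> L2 I01" using D_beta_L2[OF v] .
  obtain V0 V1 V2 where V: "third_order_profile \<beta> V0 V1 V2 w" "AE x in I01. V0 x = v x"
    using D_beta_profile[OF v w assms(2,3)] by blast
  interpret V: third_order_profile \<beta> V0 V1 V2 w by fact
  have "g = (\<lambda>x. complex_of_real (- 1) * w x)"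
    unfolding g by (simp add: eval_nat_numeral fun_eq_iff mult.assoc[symmetric])
  then have "cls g = - cls w" using cls_scaleR[OF V.w, of "- 1"] by simp
  moreover have "cls v = cls V0"
    using cls_eq_iff[OF continuous_L2_I01[OF V.continuous(1)] D_beta_L2[OF v]] V(2) by simp
  ultimately show "airy_pair \<beta> (cls v) (cls g)"
    unfolding airy_pair_def using V(1) by blast
qed

lemma D_beta_imp_i_T_beta: "v \<in> D_beta \<beta> \<Longrightarrow> \<exists>g. (v, g) \<in> i_T_beta \<beta>"
  unfolding i_T_beta_def T_beta_def by (auto simp: D_beta_def sobolev_H_def)

section \<open>The semigroup on classes and its generator\<close>

text \<open>The difference of the arguments has norm zero, and therefore so has its image.\<close>

lemma bounded_operator_cong_AE:
  assumes B: "bounded_operator_L2 M B" and f: "f \<in> L2 M" and g: "g \<in> L2 M" and eq: "AE x in M. f x = g x"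
  shows "AE x in M. B f x = B g x"
proof -
  have g': "(\<lambda>y. - 1 * g y) \<in> L2 M" by (rule L2_scale[OF g])
  let ?h = "\<lambda>y. f y + - 1 * g y"
  have h: "?h \<in> L2 M" by (rule L2_add[OF f g'])
  obtain C where C: "\<And>f. f \<in> L2 M \<Longrightarrow> L2norm M (B f) \<le> C * L2norm M f"
    using B unfolding bounded_operator_L2_def by blast
  have "L2norm M ?h = L2norm M (\<lambda>_. 0)"
    using L2_measurable[OF h] eq by (intro L2norm_cong_AE) (auto elim: eventually_mono)
  then have "L2norm M ?h = 0" by (simp add: L2norm_def)
  then have "L2norm M (B ?h) = 0" using C[OF h] by (intro antisym) (simp_all del: minus_mult_left)
  moreover have "B ?h \<in> L2 M" using B h unfolding bounded_operator_L2_def by blast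
  ultimately have "AE x in M. B ?h x = 0" by (intro L2norm_eq_0D)
  moreover have "AE x in M. B ?h x = B f x + B (\<lambda>y. - 1 * g y) x"
    using B f g' unfolding bounded_operator_L2_def by fast
  moreover have "AE x in M. B (\<lambda>y. - 1 * g y) x = - 1 * B g x"
    using B g unfolding bounded_operator_L2_def by blast
  ultimately show ?thesis by eventually_elim simp
qed

lemma bounded_operator_cls:
  assumes B: "bounded_operator_L2 I01 B"
  shows "f \<in> L2 I01 \<Longrightarrow> cls (B (rep (cls f))) = cls (B f)"
    and "bounded_linear (\<lambda>F. cls (B (rep F)))"
proof -
  have BL: "f \<in> L2 I01 \<Longrightarrow> B f \<in> L2 I01" for f using B unfolding bounded_operator_L2_def by blast
  have cong: "cls (B f) = cls (B g)" if "f \<in> L2 I01" "g \<in> L2 I01" "AE x in I01. f x = g x" for f g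
    using bounded_operator_cong_AE[OF B that] cls_eq_iff BL that by blast
  show resp: "cls (B (rep (cls f))) = cls (B f)" if "f \<in> L2 I01" for f
    using that by (intro cong rep_L2 rep_cls)
  obtain C where C: "\<And>f. f \<in> L2 I01 \<Longrightarrow> L2norm I01 (B f) \<le> C * L2norm I01 f"
    using B unfolding bounded_operator_L2_def by blast
  show "bounded_linear (\<lambda>F. cls (B (rep F)))"
  proof (rule bounded_linear_intro[where K = C])
    fix F G :: l2 and r :: real
    have "cls (B (rep (F + G))) = cls (B (\<lambda>y. rep F y + rep G y))"
      using resp[OF L2_add[OF rep_L2 rep_L2], of F G] cls_add[OF rep_L2 rep_L2, of F G] by simp
    also have "\<dots> = cls (\<lambda>y. B (rep F) y + B (rep G) y)"
      by (rule cls_eq_iff[THEN iffD2, OF BL[OF L2_add[OF rep_L2 rep_L2]] L2_add[OF BL[OF rep_L2] BL[OF rep_L2]]])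
        (use B rep_L2 in \<open>simp add: bounded_operator_L2_def\<close>)
    also have "\<dots> = cls (B (rep F)) + cls (B (rep G))" by (intro cls_add BL rep_L2)
    finally show "cls (B (rep (F + G))) = cls (B (rep F)) + cls (B (rep G))" .
    have "cls (B (rep (r *\<^sub>R F))) = cls (B (\<lambda>y. complex_of_real r * rep F y))"
      using resp[OF L2_scale[OF rep_L2], of "complex_of_real r" F] cls_scaleR[OF rep_L2, of r F] by simp
    also have "\<dots> = cls (\<lambda>y. complex_of_real r * B (rep F) y)"
      by (rule cls_eq_iff[THEN iffD2, OF BL[OF L2_scale[OF rep_L2]] L2_scale[OF BL[OF rep_L2]]])
        (use B rep_L2 in \<open>simp add: bounded_operator_L2_def\<close>)
    also have "\<dots> = r *\<^sub>R cls (B (rep F))" by (intro cls_scaleR BL rep_L2)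
    finally show "cls (B (rep (r *\<^sub>R F))) = r *\<^sub>R cls (B (rep F))" .
    show "norm (cls (B (rep F))) \<le> norm F * C"
      using C[OF rep_L2, of F] norm_cls[OF BL[OF rep_L2], of F] norm_cls[OF rep_L2, of F] by (simp add: mult.commute)
  qed
qed

locale airy_semigroup =
  fixes \<beta> :: real and S :: "real \<Rightarrow> (real \<Rightarrow> complex) \<Rightarrow> (real \<Rightarrow> complex)"
  assumes \<beta>: "0 \<le> \<beta>" "\<beta> < 1"
    and semigroup: "C0_semigroup I01 S"
    and generator: "generator I01 S = i_T_beta \<beta>"
begin

definition T :: "real \<Rightarrow> l2 \<Rightarrow> l2" where
  "T t F = cls (S t (rep F))"

lemma S_L2: "0 \<le> t \<Longrightarrow> f \<in> L2 I01 \<Longrightarrow> S t f \<in> L2 I01"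
  using semigroup unfolding C0_semigroup_def bounded_operator_L2_def by blast

lemma T_cls: "0 \<le> t \<Longrightarrow> f \<in> L2 I01 \<Longrightarrow> T t (cls f) = cls (S t f)"
  unfolding T_def using semigroup bounded_operator_cls(1) unfolding C0_semigroup_def by blast

sublocale strongly_continuous_semigroup T
proof (rule strongly_continuous_semigroup.intro)
  show "bounded_linear (T t)" if "0 \<le> t" for t
    unfolding T_def using semigroup that bounded_operator_cls(2) unfolding C0_semigroup_def by blast
  show "T 0 F = F" for F
  proof -
    have "cls (S 0 (rep F)) = cls (rep F)"
      using semigroup S_L2[of 0 "rep F"] rep_L2[of F] unfolding C0_semigroup_def by (subst cls_eq_iff) auto
    then show ?thesis by (simp add: T_def)
  qed
  show "T (s + t) F = T s (T t F)" if "0 \<le> s" "0 \<le> t" for s t F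
  proof -
    have "T s (T t F) = cls (S s (S t (rep F)))"
      using T_cls[OF that(1) S_L2[OF that(2) rep_L2]] by (simp add: T_def)
    moreover have "AE x in I01. S (s + t) (rep F) x = S s (S t (rep F)) x"
      using semigroup that rep_L2 unfolding C0_semigroup_def by blast
    then have "cls (S (s + t) (rep F)) = cls (S s (S t (rep F)))"
      using that by (subst cls_eq_iff) (simp_all add: S_L2)
    ultimately show ?thesis
      by (simp add: T_def)
  qed
  show "((\<lambda>h. T h F) \<longlongrightarrow> F) (at_right 0)" for F
  proof -
    have "L2_tendsto I01 (\<lambda>h. S h (rep F)) (rep F) (at_right 0)"
      using semigroup rep_L2 unfolding C0_semigroup_def by blast
    from L2_tendsto_imp_cls_tendsto[OF this] show ?thesis by (simp add: T_def)
  qed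
qed

definition generates :: "l2 \<Rightarrow> l2 \<Rightarrow> bool" where
  "generates F G \<longleftrightarrow> ((\<lambda>h. (T h F - F) /\<^sub>R h) \<longlongrightarrow> G) (at_right 0)"

lemma difference_quotient:
  assumes "0 < h" "f \<in> L2 I01"
  shows "(\<lambda>x. (S h f x - f x) / complex_of_real h) \<in> L2 I01"
    and "cls (\<lambda>x. (S h f x - f x) / complex_of_real h) = (T h (cls f) - cls f) /\<^sub>R h"
proof -
  have eq: "(\<lambda>x. (S h f x - f x) / complex_of_real h) = (\<lambda>x. complex_of_real (inverse h) * (S h f x - f x))"
    by (simp add: divide_inverse mult.commute)
  have d: "(\<lambda>x. S h f x - f x) \<in> L2 I01" using assms by (intro L2_diff S_L2) auto
  show "(\<lambda>x. (S h f x - f x) / complex_of_real h) \<in> L2 I01"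
    unfolding eq by (rule L2_scale[OF d])
  show "cls (\<lambda>x. (S h f x - f x) / complex_of_real h) = (T h (cls f) - cls f) /\<^sub>R h"
    unfolding eq cls_scaleR[OF d] using assms by (simp add: cls_diff S_L2 T_cls)
qed

lemma i_T_beta_imp_generates:
  assumes "(v, g) \<in> i_T_beta \<beta>"
  shows "generates (cls v) (cls g)"
proof -
  have v: "v \<in> L2 I01" using i_T_beta_imp_airy_pair[OF assms \<beta>] by blast
  have "L2_tendsto I01 (\<lambda>h x. (S h v x - v x) / complex_of_real h) g (at_right 0)"
    using assms unfolding generator[symmetric] generator_def by blast
  from L2_tendsto_imp_cls_tendsto[OF this] show ?thesis
    unfolding generates_def
    by (rule Lim_transform_eventually)
      (use eventually_at_right_less[of "0::real"] in eventually_elim, simp add: difference_quotient v)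
qed

text \<open>Here the domain of the generator must not be larger than \<open>D_beta\<close>. Since the domain is invariant
  under the semigroup, orbits that start in it satisfy the boundary conditions at all times.\<close>

lemma generates_imp_airy_pair:
  assumes "generates F G"
  shows "airy_pair \<beta> F G"
proof -
  let ?Q = "\<lambda>h x. (S h (rep F) x - rep F x) / complex_of_real h"
  have ev: "\<forall>\<^sub>F h in at_right 0. ?Q h \<in> L2 I01"
    using eventually_at_right_less[of "0::real"] by eventually_elim (simp add: difference_quotient)
  have "((\<lambda>h. norm ((T h F - F) /\<^sub>R h - G)) \<longlongrightarrow> 0) (at_right 0)"
    using assms unfolding generates_def by (simp add: LIM_zero_iff tendsto_norm_zero)
  then have "((\<lambda>h. L2norm I01 (\<lambda>x. ?Q h x - rep G x)) \<longlongrightarrow> 0) (at_right 0)"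
  proof (rule Lim_transform_eventually)
    show "\<forall>\<^sub>F h in at_right 0. norm ((T h F - F) /\<^sub>R h - G) = L2norm I01 (\<lambda>x. ?Q h x - rep G x)"
      using eventually_at_right_less[of "0::real"]
    proof eventually_elim
      case (elim h)
      from norm_cls_diff[OF difference_quotient(1)[OF elim rep_L2] rep_L2, of F G]
      show ?case by (simp add: difference_quotient(2)[OF elim rep_L2])
    qed
  qed
  then have "(rep F, rep G) \<in> generator I01 S"
    using ev by (simp add: generator_def L2_tendsto_def)
  then show ?thesis
    using i_T_beta_imp_airy_pair(2)[OF _ \<beta>, of "rep F" "rep G"] by (simp add: generator)
qed

lemma generates_orbit: "generates F G \<Longrightarrow> 0 \<le> t \<Longrightarrow> generates (T t F) (T t G)"
  unfolding generates_def by (rule generator_invariant)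

lemma generates_derivative:
  "generates F G \<Longrightarrow> 0 \<le> t \<Longrightarrow> ((\<lambda>s. T s F) has_vector_derivative T t G) (at t within {0..})"
  unfolding generates_def by (rule orbit_has_vector_derivative)

lemma orbit_airy_pair: "generates F G \<Longrightarrow> 0 \<le> t \<Longrightarrow> airy_pair \<beta> (T t F) (T t G)"
  by (intro generates_imp_airy_pair generates_orbit)

end

section \<open>Energy identities along solutions\<close>

lemma integrable_lborel_on_continuous:
  fixes f :: "real \<Rightarrow> real"
  assumes "continuous_on {a..b} f"
  shows "integrable (lborel_on a b) f"
proof -
  have "set_integrable lborel {a<..<b} f"
    by (rule set_integrable_subset[OF borel_integrable_atLeastAtMost'[OF assms]]) auto
  then show ?thesis
    unfolding lborel_on_def set_integrable_def by (subst integrable_restrict_space) auto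
qed

lemma integral_lborel_on_eq_diff:
  fixes F f :: "real \<Rightarrow> real"
  assumes "a \<le> b" and F: "\<And>x. x \<in> {a..b} \<Longrightarrow> (F has_vector_derivative f x) (at x within {a..b})"
    and f: "continuous_on {a..b} f"
  shows "(\<integral>x. f x \<partial>lborel_on a b) = F b - F a"
proof -
  have "(\<integral>x. f x \<partial>lborel_on a b) = (\<integral>x. indicator {a<..<b} x *\<^sub>R f x \<partial>lborel)"
    unfolding lborel_on_def by (rule integral_restrict_space) simp
  also have "\<dots> = (\<integral>x. indicator {a..b} x *\<^sub>R f x \<partial>lborel)"
    by (rule integral_discrete_difference[of "{a, b}"]) (auto simp: indicator_def)
  also have "\<dots> = F b - F a"
    by (rule integral_FTC_Icc[OF assms(1) F f]) auto
  finally show ?thesis .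
qed

lemma measure_lborel_on: "a \<le> b \<Longrightarrow> measure (lborel_on a b) {a<..<b} = b - a"
  by (simp add: lborel_on_def measure_restrict_space)

definition gain :: "real \<Rightarrow> real" where "gain \<beta> = 1 / (1 - \<beta>)"

text \<open>Classical solutions, described without reference to a semigroup so that conjugates and differences
  of solutions are covered.\<close>

locale airy_curve =
  fixes \<beta> :: real and U U' :: "real \<Rightarrow> l2"
  assumes \<beta>: "0 \<le> \<beta>" "\<beta> < 1"
    and deriv_U: "\<And>t. 0 \<le> t \<Longrightarrow> (U has_vector_derivative U' t) (at t within {0..})"
    and continuous_U': "continuous_on {0..} U'"
    and pair: "\<And>t. 0 \<le> t \<Longrightarrow> airy_pair \<beta> (U t) (U' t)"
begin

lemma gain_facts: "1 \<le> gain \<beta>" "1 / (1 - \<beta>\<^sup>2) \<le> gain \<beta>" "0 < 1 - \<beta>\<^sup>2" "1 + \<beta>\<^sup>2 / (1 - \<beta>\<^sup>2) = 1 / (1 - \<beta>\<^sup>2)"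
proof -
  have "\<beta>\<^sup>2 \<le> \<beta>" using \<beta> by (simp add: power2_eq_square mult_left_le_one_le)
  then show "0 < 1 - \<beta>\<^sup>2" "1 / (1 - \<beta>\<^sup>2) \<le> gain \<beta>" "1 + \<beta>\<^sup>2 / (1 - \<beta>\<^sup>2) = 1 / (1 - \<beta>\<^sup>2)"
    using \<beta> by (auto simp: gain_def field_simps)
  show "1 \<le> gain \<beta>" using \<beta> by (simp add: gain_def)
qed

lemma continuous_U: "continuous_on {0..} U"
  using has_vector_derivative_continuous[OF deriv_U] by (auto simp: continuous_on_eq_continuous_within)

text \<open>Continuity in time of the boundary slope is itself a consequence of the dissipation identity,
  applied to the difference of the solution at two times.\<close>

lemma continuous_slope_zero: "continuous_on {0..} (\<lambda>t. slope (U t) 0)"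
  unfolding continuous_on_def
proof
  fix t :: real assume t: "t \<in> {0..}"
  let ?r = "\<lambda>s. sqrt (- 2 / (1 - \<beta>\<^sup>2) * inner (U' s - U' t) (U s - U t))"
  have "((\<lambda>s. ?r s) \<longlongrightarrow> ?r t) (at t within {0..})"
    using continuous_U continuous_U' t unfolding continuous_on_def by (intro tendsto_intros) auto
  then have lim: "((\<lambda>s. ?r s) \<longlongrightarrow> 0) (at t within {0..})" by simp
  have "\<forall>\<^sub>F s in at t within {0..}. norm (slope (U s) 0 - slope (U t) 0) \<le> ?r s"
    unfolding eventually_at_filter
  proof (intro always_eventually allI impI)
    fix s :: real assume "s \<in> {0..}"
    then have st: "0 \<le> s" "0 \<le> t" using t by auto
    note D = airy_pair_diff[OF pair[OF st(1)] pair[OF st(2)]]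
    have "(cmod (slope (U s) 0 - slope (U t) 0))\<^sup>2 = - 2 / (1 - \<beta>\<^sup>2) * inner (U' s - U' t) (U s - U t)"
      using dissipation[OF D(1)] D(2)[of 0] gain_facts(3) by (simp add: field_simps)
    then show "norm (slope (U s) 0 - slope (U t) 0) \<le> ?r s" by (metis real_sqrt_pow2_iff norm_ge_zero real_sqrt_unique order_refl)
  qed
  from Lim_null_comparison[OF this lim]
  show "((\<lambda>t. slope (U t) 0) \<longlongrightarrow> slope (U t) 0) (at t within {0..})"
    by (simp add: LIM_zero_iff)
qed

text \<open>Uniformly in \<open>x\<close>, the slopes at two times are as close as the boundary slopes and the time derivatives at
  these times, up to a factor \<open>2\<close>, by \<open>slope_bound\<close> for the difference.\<close>

lemma continuous_slope_joint: "continuous_on ({0..1} \<times> {0..}) (\<lambda>(x, s). slope (U s) x)"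
  unfolding continuous_on_def
proof
  fix z :: "real \<times> real" assume z: "z \<in> {0..1} \<times> {0..}"
  obtain y t where yt: "z = (y, t)" "y \<in> {0..1}" "0 \<le> t" using z by auto
  let ?h = "\<lambda>z. 2 * cmod (slope (U (snd z)) 0 - slope (U t) 0) + 2 * norm (U' (snd z) - U' t)
      + cmod (slope (U t) (fst z) - slope (U t) y)"
  have "continuous_on ({0..1} \<times> {0..}) (\<lambda>z. slope (U (snd z)) 0)"
    by (rule continuous_on_compose2[OF continuous_slope_zero continuous_on_snd]) (auto intro: continuous_on_id)
  moreover have "continuous_on ({0..1} \<times> {0..}) (\<lambda>z. U' (snd z))"
    by (rule continuous_on_compose2[OF continuous_U' continuous_on_snd]) (auto intro: continuous_on_id)
  moreover have "continuous_on ({0..1} \<times> {0..}) (\<lambda>z. slope (U t) (fst z))"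
    by (rule continuous_on_compose2[OF continuous_slope[OF pair[OF yt(3)]] continuous_on_fst]) (auto intro: continuous_on_id)
  ultimately have "continuous_on ({0..1} \<times> {0..}) ?h" by (intro continuous_intros)
  then have "(?h \<longlongrightarrow> ?h z) (at z within {0..1} \<times> {0..})"
    using z unfolding continuous_on_def by blast
  then have lim: "(?h \<longlongrightarrow> 0) (at z within {0..1} \<times> {0..})" by (simp add: yt(1))
  have "\<forall>\<^sub>F w in at z within {0..1} \<times> {0..}. norm ((case w of (x, s) \<Rightarrow> slope (U s) x) - slope (U t) y) \<le> ?h w"
    unfolding eventually_at_filter
  proof (intro always_eventually allI impI)
    fix w :: "real \<times> real" assume "w \<in> {0..1} \<times> {0..}"
    then obtain x s where w: "w = (x, s)" "x \<in> {0..1}" "0 \<le> s" by auto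
    note D = airy_pair_diff[OF pair[OF w(3)] pair[OF yt(3)]]
    have "norm (slope (U s) x - slope (U t) x) \<le> 2 * cmod (slope (U s) 0 - slope (U t) 0) + 2 * norm (U' s - U' t)"
      using slope_bound[OF D(1) w(2)] D(2)[OF w(2)] D(2)[of 0] by simp
    then show "norm ((case w of (x, s) \<Rightarrow> slope (U s) x) - slope (U t) y) \<le> ?h w"
      using norm_triangle_ineq[of "slope (U s) x - slope (U t) x" "slope (U t) x - slope (U t) y"] by (simp add: w(1))
  qed
  from Lim_null_comparison[OF this lim]
  show "((\<lambda>(x, s). slope (U s) x) \<longlongrightarrow> (case z of (x, s) \<Rightarrow> slope (U s) x)) (at z within {0..1} \<times> {0..})"
    by (simp add: LIM_zero_iff yt(1))
qed

definition slope_energy :: "real \<Rightarrow> real" where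
  "slope_energy t = (\<integral>x. (cmod (slope (U t) x))\<^sup>2 \<partial>I01)"

lemma continuous_weight_U: "continuous_on {0..} (\<lambda>t. weight_l2 (U t))"
  using bounded_linear.continuous_on[OF bounded_linear_weight_l2 continuous_U] .

text \<open>The weighted identity expresses the energy of the slope through quantities whose continuity in time
  is already known.\<close>

lemma slope_energy_eq:
  "0 \<le> t \<Longrightarrow> slope_energy t = \<beta>\<^sup>2 / 3 * (cmod (slope (U t) 0))\<^sup>2 - 2 / 3 * inner (weight_l2 (U t)) (U' t)"
  using weighted_dissipation[OF pair, of t] by (simp add: slope_energy_def field_simps)

lemma continuous_slope_energy: "continuous_on {0..} slope_energy"
proof -
  have "continuous_on {0..} (\<lambda>t. \<beta>\<^sup>2 / 3 * (cmod (slope (U t) 0))\<^sup>2 - 2 / 3 * inner (weight_l2 (U t)) (U' t))"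
    by (intro continuous_intros continuous_slope_zero continuous_weight_U continuous_U')
  then show ?thesis by (rule continuous_on_eq) (simp add: slope_energy_eq)
qed

lemma slope_energy_nonneg: "0 \<le> slope_energy t"
  unfolding slope_energy_def by (intro Bochner_Integration.integral_nonneg) simp

lemma integrable_boundary: "0 \<le> a \<Longrightarrow> integrable (lborel_on a b) (\<lambda>t. (cmod (slope (U t) 0))\<^sup>2)"
  by (intro integrable_lborel_on_continuous continuous_on_power continuous_on_norm
      continuous_on_subset[OF continuous_slope_zero]) auto

lemma integrable_slope_energy: "0 \<le> a \<Longrightarrow> integrable (lborel_on a b) slope_energy"
  by (intro integrable_lborel_on_continuous continuous_on_subset[OF continuous_slope_energy]) auto

lemma energy_identity:
  assumes "0 \<le> a" "a \<le> b"
  shows "(norm (U b))\<^sup>2 + (1 - \<beta>\<^sup>2) * (\<integral>t. (cmod (slope (U t) 0))\<^sup>2 \<partial>lborel_on a b) = (norm (U a))\<^sup>2"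
proof -
  have "(\<integral>t. - (1 - \<beta>\<^sup>2) * (cmod (slope (U t) 0))\<^sup>2 \<partial>lborel_on a b) = inner (U b) (U b) - inner (U a) (U a)"
  proof (rule integral_lborel_on_eq_diff[OF assms(2)])
    fix t assume t: "t \<in> {a..b}"
    have "(U has_vector_derivative U' t) (at t within {a..b})"
      using t assms by (intro has_vector_derivative_within_subset[OF deriv_U]) auto
    from bounded_bilinear.has_vector_derivative[OF bounded_bilinear_inner this this]
    have "((\<lambda>t. inner (U t) (U t)) has_vector_derivative 2 * inner (U' t) (U t)) (at t within {a..b})"
      by (simp add: inner_commute)
    moreover have "2 * inner (U' t) (U t) = - (1 - \<beta>\<^sup>2) * (cmod (slope (U t) 0))\<^sup>2"
      using dissipation[OF pair, of t] t assms by simp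
    ultimately show "((\<lambda>t. inner (U t) (U t)) has_vector_derivative - (1 - \<beta>\<^sup>2) * (cmod (slope (U t) 0))\<^sup>2) (at t within {a..b})"
      by simp
  next
    show "continuous_on {a..b} (\<lambda>t. - (1 - \<beta>\<^sup>2) * (cmod (slope (U t) 0))\<^sup>2)"
      using assms by (intro continuous_intros continuous_on_subset[OF continuous_slope_zero]) auto
  qed
  then show ?thesis by (simp only: integral_mult_right_zero power2_norm_eq_inner)
qed

lemma weighted_energy_identity:
  assumes "0 \<le> t"
  shows "inner (weight_l2 (U t)) (U t) + 3 * (\<integral>s. slope_energy s \<partial>lborel_on 0 t)
    = inner (weight_l2 (U 0)) (U 0) + \<beta>\<^sup>2 * (\<integral>s. (cmod (slope (U s) 0))\<^sup>2 \<partial>lborel_on 0 t)"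
proof -
  have "(\<integral>s. \<beta>\<^sup>2 * (cmod (slope (U s) 0))\<^sup>2 - 3 * slope_energy s \<partial>lborel_on 0 t)
    = inner (weight_l2 (U t)) (U t) - inner (weight_l2 (U 0)) (U 0)"
  proof (rule integral_lborel_on_eq_diff[OF assms])
    fix s assume s: "s \<in> {0..t}"
    have d: "(U has_vector_derivative U' s) (at s within {0..t})"
      using s by (intro has_vector_derivative_within_subset[OF deriv_U]) auto
    from bounded_bilinear.has_vector_derivative[OF bounded_bilinear_inner
        bounded_linear.has_vector_derivative[OF bounded_linear_weight_l2 d] d]
    have "((\<lambda>s. inner (weight_l2 (U s)) (U s)) has_vector_derivative 2 * inner (weight_l2 (U s)) (U' s)) (at s within {0..t})"
      by (simp add: inner_weight_l2_commute[of "U' s"])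
    moreover have "2 * inner (weight_l2 (U s)) (U' s) = \<beta>\<^sup>2 * (cmod (slope (U s) 0))\<^sup>2 - 3 * slope_energy s"
      using slope_energy_eq[of s] s by simp
    ultimately show "((\<lambda>s. inner (weight_l2 (U s)) (U s)) has_vector_derivative
        \<beta>\<^sup>2 * (cmod (slope (U s) 0))\<^sup>2 - 3 * slope_energy s) (at s within {0..t})" by simp
  next
    show "continuous_on {0..t} (\<lambda>s. \<beta>\<^sup>2 * (cmod (slope (U s) 0))\<^sup>2 - 3 * slope_energy s)"
      by (intro continuous_intros continuous_on_subset[OF continuous_slope_zero] continuous_on_subset[OF continuous_slope_energy]) auto
  qed
  then show ?thesis
    using integrable_boundary[of 0 t] integrable_slope_energy[of 0 t] by simp
qed

lemma norm_antimono: "0 \<le> a \<Longrightarrow> a \<le> b \<Longrightarrow> norm (U b) \<le> norm (U a)"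
proof (rule power2_le_imp_le)
  assume ab: "0 \<le> a" "a \<le> b"
  have "0 \<le> (1 - \<beta>\<^sup>2) * (\<integral>t. (cmod (slope (U t) 0))\<^sup>2 \<partial>lborel_on a b)"
    using gain_facts(3) by (intro mult_nonneg_nonneg Bochner_Integration.integral_nonneg) auto
  then show "(norm (U b))\<^sup>2 \<le> (norm (U a))\<^sup>2" using energy_identity[OF ab] by linarith
qed simp

lemma sharp_boundary_bound:
  assumes "0 \<le> t"
  shows "(\<integral>s. (cmod (slope (U s) 0))\<^sup>2 \<partial>lborel_on 0 t) \<le> (norm (U 0))\<^sup>2 / (1 - \<beta>\<^sup>2)"
proof -
  have "(\<integral>s. (cmod (slope (U s) 0))\<^sup>2 \<partial>lborel_on 0 t) * (1 - \<beta>\<^sup>2) \<le> (norm (U 0))\<^sup>2"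
    using energy_identity[of 0 t] assms zero_le_power2[of "norm (U t)"]
    unfolding mult.commute[of _ "1 - \<beta>\<^sup>2"] by linarith
  then show ?thesis by (simp add: pos_le_divide_eq[OF gain_facts(3)])
qed

lemma boundary_bound:
  assumes "0 \<le> t"
  shows "(\<integral>s. (cmod (slope (U s) 0))\<^sup>2 \<partial>lborel_on 0 t) \<le> gain \<beta> * (norm (U 0))\<^sup>2"
  using sharp_boundary_bound[OF assms] mult_right_mono[OF gain_facts(2) zero_le_power2[of "norm (U 0)"]] by simp

text \<open>The boundary term is absorbed by the first identity, and \<open>0 \<le> x \<le> 1\<close> bounds the weighted initial
  energy.\<close>

lemma weighted_bound:
  assumes "0 \<le> t"
  shows "inner (weight_l2 (U t)) (U t) + 3 * (\<integral>s. slope_energy s \<partial>lborel_on 0 t) \<le> gain \<beta> * (norm (U 0))\<^sup>2"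
proof -
  have "inner (weight_l2 (U t)) (U t) + 3 * (\<integral>s. slope_energy s \<partial>lborel_on 0 t)
      \<le> (norm (U 0))\<^sup>2 + \<beta>\<^sup>2 * ((norm (U 0))\<^sup>2 / (1 - \<beta>\<^sup>2))"
    unfolding weighted_energy_identity[OF assms]
    by (intro add_mono weight_l2_le mult_left_mono sharp_boundary_bound assms) simp
  also have "\<dots> = (1 + \<beta>\<^sup>2 / (1 - \<beta>\<^sup>2)) * (norm (U 0))\<^sup>2" by (simp add: algebra_simps)
  also have "\<dots> \<le> gain \<beta> * (norm (U 0))\<^sup>2" unfolding gain_facts(4) by (intro mult_right_mono gain_facts) simp
  finally show ?thesis .
qed

lemma slope_energy_bound:
  assumes "0 \<le> t"
  shows "(\<integral>s. slope_energy s \<partial>lborel_on 0 t) \<le> gain \<beta> * (norm (U 0))\<^sup>2"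
proof -
  have "0 \<le> (\<integral>s. slope_energy s \<partial>lborel_on 0 t)"
    by (intro Bochner_Integration.integral_nonneg slope_energy_nonneg)
  then show ?thesis using weighted_bound[OF assms] weight_l2_le(1)[of "U t"] by linarith
qed

text \<open>Decay: by monotonicity \<open>t \<parallel>U t\<parallel>\<^sup>2\<close> is at most the integral of \<open>\<parallel>U s\<parallel>\<^sup>2\<close> up to time \<open>t\<close>, which the
  Poincare inequality and the weighted identity bound uniformly in \<open>t\<close>.\<close>

lemma decay:
  assumes "0 \<le> t"
  shows "t * (norm (U t))\<^sup>2 \<le> gain \<beta> * (norm (U 0))\<^sup>2"
proof -
  have fin: "finite_measure (lborel_on 0 t)" by (rule finite_measure_lborel_on)
  have "t * (norm (U t))\<^sup>2 = (\<integral>s. (norm (U t))\<^sup>2 \<partial>lborel_on 0 t)"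
    using measure_lborel_on[OF assms] by simp
  also have "\<dots> \<le> (\<integral>s. slope_energy s \<partial>lborel_on 0 t)"
  proof (rule integral_mono)
    show "integrable (lborel_on 0 t) (\<lambda>s. (norm (U t))\<^sup>2)" by (rule finite_measure.integrable_const[OF fin])
    show "integrable (lborel_on 0 t) slope_energy" by (rule integrable_slope_energy) simp
    fix s assume "s \<in> space (lborel_on 0 t)"
    then have s: "0 \<le> s" "s \<le> t" by auto
    have "(norm (U t))\<^sup>2 \<le> (norm (U s))\<^sup>2" using norm_antimono[OF s] by (intro power_mono) auto
    also have "\<dots> \<le> slope_energy s" unfolding slope_energy_def by (rule norm_le_slope[OF pair[OF s(1)]])
    finally show "(norm (U t))\<^sup>2 \<le> slope_energy s" .
  qed
  also have "\<dots> \<le> gain \<beta> * (norm (U 0))\<^sup>2" by (rule slope_energy_bound[OF assms])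
  finally show ?thesis .
qed

end

lemma airy_curve_diff:
  assumes "airy_curve \<beta> U U'" "airy_curve \<beta> W W'"
  shows "airy_curve \<beta> (\<lambda>t. U t - W t) (\<lambda>t. U' t - W' t)"
proof -
  interpret U: airy_curve \<beta> U U' by fact
  interpret W: airy_curve \<beta> W W' by fact
  show ?thesis
    by (rule airy_curve.intro)
      (auto intro!: U.\<beta> has_vector_derivative_diff U.deriv_U W.deriv_U continuous_on_diff
        U.continuous_U' W.continuous_U' airy_pair_diff(1) U.pair W.pair)
qed

lemma airy_curve_conj:
  assumes "airy_curve \<beta> U U'"
  shows "airy_curve \<beta> (\<lambda>t. conj_l2 (U t)) (\<lambda>t. conj_l2 (U' t))"
proof -
  interpret U: airy_curve \<beta> U U' by fact
  show ?thesis
    by (rule airy_curve.intro)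
      (auto intro!: U.\<beta> bounded_linear.has_vector_derivative[OF bounded_linear_conj_l2] U.deriv_U
        bounded_linear.continuous_on[OF bounded_linear_conj_l2] U.continuous_U' airy_pair_conj(1) U.pair)
qed

section \<open>Slopes as functions of space and time\<close>

text \<open>The limits are constructed on the whole half line of times at once, so that one function serves
  all time intervals; this is possible because the bounds are uniform in time.\<close>

definition half_line :: "real measure" where
  "half_line = restrict_space lborel {0<..}"

lemma space_half_line [simp]: "space half_line = {0<..}"
  by (simp add: half_line_def)

lemma sigma_finite_half_line: "sigma_finite_measure half_line"
  unfolding half_line_def by (intro sigma_finite_measure_restrict_space sigma_finite_lborel) simp

lemma sigma_finite_lborel_on: "sigma_finite_measure (lborel_on a b)"
  using finite_measure.axioms(1)[OF finite_measure_lborel_on] .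

lemma measurable_half_line_lborel_on: "f \<in> measurable half_line N \<Longrightarrow> f \<in> measurable (lborel_on 0 t) N"
  unfolding half_line_def lborel_on_def by (rule measurable_restrict_mono) auto

lemma measurable_half_line_continuous:
  assumes "continuous_on {0<..} f"
  shows "f \<in> borel_measurable half_line"
proof -
  have "sets half_line = sets (restrict_space borel {0<..})"
    unfolding half_line_def by (rule sets_restrict_space_cong) simp
  then show ?thesis
    using borel_measurable_continuous_on_restrict[OF assms] measurable_cong_sets by blast
qed

lemma nn_integral_lborel_on_le_half_line:
  "f \<in> borel_measurable half_line \<Longrightarrow> (\<integral>\<^sup>+x. f x \<partial>lborel_on 0 t) \<le> (\<integral>\<^sup>+x. f x \<partial>half_line)"
  unfolding half_line_def lborel_on_def
  by (subst (1 2) nn_integral_restrict_space) (auto intro!: nn_integral_mono simp: indicator_def)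

text \<open>Monotone convergence along the intervals from \<open>0\<close> to \<open>n\<close>.\<close>

lemma nn_integral_half_line_le:
  fixes f :: "real \<Rightarrow> ennreal"
  assumes f: "f \<in> borel_measurable half_line" and le: "\<And>n::nat. (\<integral>\<^sup>+x. f x \<partial>lborel_on 0 (real n)) \<le> c"
  shows "(\<integral>\<^sup>+x. f x \<partial>half_line) \<le> c"
proof -
  let ?f = "\<lambda>n x. f x * indicator {0<..<real n} x"
  have "?f n \<in> borel_measurable lborel" for n
    using measurable_half_line_lborel_on[OF f, of "real n"] unfolding lborel_on_def
    by (subst (asm) borel_measurable_restrict_space_iff_ennreal) auto
  moreover have "incseq ?f"
    by (auto simp: incseq_def le_fun_def indicator_def)
  ultimately have mc: "(\<integral>\<^sup>+x. (SUP n. ?f n x) \<partial>lborel) = (SUP n. \<integral>\<^sup>+x. ?f n x \<partial>lborel)"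
    by (intro nn_integral_monotone_convergence_SUP) auto
  have "(SUP n. ?f n x) = f x * indicator {0<..} x" for x
  proof (cases "0 < x")
    case True
    obtain n where n: "x < real n" using reals_Archimedean2 by blast
    show ?thesis
    proof (rule antisym)
      show "(SUP n. ?f n x) \<le> f x * indicator {0<..} x"
        by (rule SUP_least) (auto simp: indicator_def)
      have "f x * indicator {0<..} x = ?f n x" using True n by (simp add: indicator_def)
      also have "\<dots> \<le> (SUP n. ?f n x)" by (rule SUP_upper) simp
      finally show "f x * indicator {0<..} x \<le> (SUP n. ?f n x)" .
    qed
  qed (simp add: indicator_def)
  then have "(\<integral>\<^sup>+x. f x \<partial>half_line) = (SUP n. \<integral>\<^sup>+x. ?f n x \<partial>lborel)"
    unfolding half_line_def using mc by (subst nn_integral_restrict_space) simp_all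
  also have "\<dots> \<le> c"
    using le unfolding lborel_on_def by (intro SUP_least) (simp add: nn_integral_restrict_space)
  finally show ?thesis .
qed

lemma measurable_id_product: "(\<lambda>z. z) \<in> measurable (I01 \<Otimes>\<^sub>M lborel_on 0 t) (I01 \<Otimes>\<^sub>M half_line)"
proof -
  have "(\<lambda>s. s) \<in> measurable (lborel_on 0 t) half_line"
    by (rule measurable_half_line_lborel_on) simp
  then have "(\<lambda>z. (fst z, snd z)) \<in> measurable (I01 \<Otimes>\<^sub>M lborel_on 0 t) (I01 \<Otimes>\<^sub>M half_line)"
    by (intro measurable_Pair measurable_fst measurable_compose[OF measurable_snd])
  then show ?thesis by simp
qed

lemma nn_integral_product_le_half_line:
  fixes f :: "real \<times> real \<Rightarrow> ennreal"
  assumes f: "f \<in> borel_measurable (I01 \<Otimes>\<^sub>M half_line)"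
  shows "(\<integral>\<^sup>+z. f z \<partial>(I01 \<Otimes>\<^sub>M lborel_on 0 t)) \<le> (\<integral>\<^sup>+z. f z \<partial>(I01 \<Otimes>\<^sub>M half_line))"
proof -
  interpret H: sigma_finite_measure half_line by (rule sigma_finite_half_line)
  interpret L: sigma_finite_measure "lborel_on 0 t" by (rule sigma_finite_lborel_on)
  have f': "f \<in> borel_measurable (I01 \<Otimes>\<^sub>M lborel_on 0 t)"
    using measurable_compose[OF measurable_id_product f] by simp
  have "(\<integral>\<^sup>+z. f z \<partial>(I01 \<Otimes>\<^sub>M lborel_on 0 t)) = (\<integral>\<^sup>+x. \<integral>\<^sup>+s. f (x, s) \<partial>lborel_on 0 t \<partial>I01)"
    by (rule L.nn_integral_fst[OF f', symmetric])
  also have "\<dots> \<le> (\<integral>\<^sup>+x. \<integral>\<^sup>+s. f (x, s) \<partial>half_line \<partial>I01)"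
    using f by (intro nn_integral_mono nn_integral_lborel_on_le_half_line) (rule measurable_compose[OF measurable_Pair1'], auto)
  also have "\<dots> = (\<integral>\<^sup>+z. f z \<partial>(I01 \<Otimes>\<^sub>M half_line))"
    by (rule H.nn_integral_fst[OF f])
  finally show ?thesis .
qed

lemma L2norm_product_square:
  assumes "f \<in> L2 (I01 \<Otimes>\<^sub>M lborel_on 0 t)"
  shows "(L2norm (I01 \<Otimes>\<^sub>M lborel_on 0 t) f)\<^sup>2 = (\<integral>s. \<integral>x. (cmod (f (x, s)))\<^sup>2 \<partial>I01 \<partial>lborel_on 0 t)"
proof -
  interpret P: pair_sigma_finite I01 "lborel_on 0 t"
    by (simp add: pair_sigma_finite_def sigma_finite_lborel_on)
  have "integrable (I01 \<Otimes>\<^sub>M lborel_on 0 t) (case_prod (\<lambda>x s. (cmod (f (x, s)))\<^sup>2))"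
    using L2_integrable_square[OF assms] by (simp add: split_beta')
  from P.integral_snd[OF this] show ?thesis
    by (simp add: L2norm_square split_beta')
qed

definition boundary_trace :: "(real \<Rightarrow> l2) \<Rightarrow> real \<Rightarrow> complex" where
  "boundary_trace U s = slope (U s) 0"

definition interior_trace :: "(real \<Rightarrow> l2) \<Rightarrow> real \<times> real \<Rightarrow> complex" where
  "interior_trace U z = slope (U (snd z)) (fst z)"

context airy_curve
begin

lemma boundary_trace_L2:
  "boundary_trace U \<in> L2 half_line \<and> L2norm half_line (boundary_trace U) \<le> sqrt (gain \<beta>) * norm (U 0)"
proof (subst L2norm_le_iff_nn_integral)
  have c: "continuous_on {0..} (boundary_trace U)"
    unfolding boundary_trace_def[abs_def] by (rule continuous_slope_zero)
  show m: "boundary_trace U \<in> borel_measurable half_line"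
    by (rule measurable_half_line_continuous[OF continuous_on_subset[OF c]]) auto
  show "0 \<le> sqrt (gain \<beta>) * norm (U 0)" using gain_facts(1) by simp
  have sq: "(sqrt (gain \<beta>) * norm (U 0))\<^sup>2 = gain \<beta> * (norm (U 0))\<^sup>2"
    using gain_facts(1) by (simp add: power_mult_distrib)
  show "(\<integral>\<^sup>+s. ennreal ((cmod (boundary_trace U s))\<^sup>2) \<partial>half_line) \<le> ennreal ((sqrt (gain \<beta>) * norm (U 0))\<^sup>2)"
    unfolding sq
  proof (rule nn_integral_half_line_le)
    show "(\<integral>\<^sup>+s. ennreal ((cmod (boundary_trace U s))\<^sup>2) \<partial>lborel_on 0 (real n)) \<le> ennreal (gain \<beta> * (norm (U 0))\<^sup>2)" for n
      unfolding boundary_trace_def using integrable_boundary[of 0 "real n"] boundary_bound[of "real n"]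
      by (subst nn_integral_eq_integral) (auto intro: ennreal_leI)
  qed (use m in measurable)
qed

text \<open>By Tonelli's theorem the norm is the integral in time of \<open>slope_energy\<close>.\<close>

lemma interior_trace_L2:
  "interior_trace U \<in> L2 (I01 \<Otimes>\<^sub>M half_line)
    \<and> L2norm (I01 \<Otimes>\<^sub>M half_line) (interior_trace U) \<le> sqrt (gain \<beta>) * norm (U 0)"
proof (subst L2norm_le_iff_nn_integral)
  interpret P: pair_sigma_finite I01 half_line
    by (simp add: pair_sigma_finite_def sigma_finite_lborel_on sigma_finite_half_line)
  show m: "interior_trace U \<in> borel_measurable (I01 \<Otimes>\<^sub>M half_line)"
  proof -
    have "continuous_on ({0<..<1} \<times> {0<..}) (interior_trace U)"
      using continuous_slope_joint unfolding interior_trace_def[abs_def] split_beta'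
      by (rule continuous_on_subset) auto
    then have 1: "interior_trace U \<in> borel_measurable (restrict_space borel ({0<..<1} \<times> {0<..}))"
      by (rule borel_measurable_continuous_on_restrict)
    have id: "(\<lambda>x. x) \<in> measurable I01 borel" "(\<lambda>x. x) \<in> measurable half_line borel"
      by (intro measurable_lborel_on_continuous measurable_half_line_continuous continuous_on_id)+
    have "(\<lambda>z. (fst z, snd z)) \<in> measurable (I01 \<Otimes>\<^sub>M half_line) (borel \<Otimes>\<^sub>M borel)"
      using measurable_compose[OF measurable_fst id(1)] measurable_compose[OF measurable_snd id(2)]
      by (rule measurable_Pair)
    then have "(\<lambda>z. z) \<in> measurable (I01 \<Otimes>\<^sub>M half_line) borel"
      by (simp add: borel_prod)
    then have "(\<lambda>z. z) \<in> measurable (I01 \<Otimes>\<^sub>M half_line) (restrict_space borel ({0<..<1} \<times> {0<..}))"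
      by (intro measurable_restrict_space2) (auto simp: space_pair_measure)
    from measurable_compose[OF this 1] show ?thesis by simp
  qed
  show "0 \<le> sqrt (gain \<beta>) * norm (U 0)" using gain_facts(1) by simp
  have sq: "(sqrt (gain \<beta>) * norm (U 0))\<^sup>2 = gain \<beta> * (norm (U 0))\<^sup>2"
    using gain_facts(1) by (simp add: power_mult_distrib)
  have inner: "(\<integral>\<^sup>+x. ennreal ((cmod (interior_trace U (x, s)))\<^sup>2) \<partial>I01) = ennreal (slope_energy s)" if "0 \<le> s" for s
    unfolding interior_trace_def slope_energy_def fst_conv snd_conv
    by (rule nn_integral_eq_integral)
      (use L2_integrable_square[OF continuous_L2_I01[OF continuous_slope[OF pair[OF that]]]] in auto)
  have "(\<integral>\<^sup>+z. ennreal ((cmod (interior_trace U z))\<^sup>2) \<partial>(I01 \<Otimes>\<^sub>M half_line))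
      = (\<integral>\<^sup>+s. \<integral>\<^sup>+x. ennreal ((cmod (interior_trace U (x, s)))\<^sup>2) \<partial>I01 \<partial>half_line)"
    using m by (intro P.nn_integral_snd[symmetric]) measurable
  also have "\<dots> = (\<integral>\<^sup>+s. ennreal (slope_energy s) \<partial>half_line)"
    by (intro nn_integral_cong inner) simp
  also have "\<dots> \<le> ennreal (gain \<beta> * (norm (U 0))\<^sup>2)"
  proof (rule nn_integral_half_line_le)
    have "slope_energy \<in> borel_measurable half_line"
      by (rule measurable_half_line_continuous[OF continuous_on_subset[OF continuous_slope_energy]]) auto
    then show "(\<lambda>s. ennreal (slope_energy s)) \<in> borel_measurable half_line" by measurable
    show "(\<integral>\<^sup>+s. ennreal (slope_energy s) \<partial>lborel_on 0 (real n)) \<le> ennreal (gain \<beta> * (norm (U 0))\<^sup>2)" for n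
      using integrable_slope_energy[of 0 "real n"] slope_energy_bound[of "real n"] slope_energy_nonneg
      by (subst nn_integral_eq_integral) (auto intro: ennreal_leI)
  qed
  finally show "(\<integral>\<^sup>+z. ennreal ((cmod (interior_trace U z))\<^sup>2) \<partial>(I01 \<Otimes>\<^sub>M half_line))
      \<le> ennreal ((sqrt (gain \<beta>) * norm (U 0))\<^sup>2)"
    unfolding sq .
qed

end

section \<open>Passage to the limit\<close>

context airy_semigroup
begin

lemma generates_curve: "generates F G \<Longrightarrow> airy_curve \<beta> (\<lambda>t. T t F) (\<lambda>t. T t G)"
  by (rule airy_curve.intro) (auto intro: \<beta> generates_derivative continuous_orbit orbit_airy_pair)

lemma D_beta_generates: "v \<in> D_beta \<beta> \<Longrightarrow> \<exists>G. generates (cls v) G"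
  using D_beta_imp_i_T_beta i_T_beta_imp_generates by blast

text \<open>Real data stay real: the difference between a solution and its complex conjugate solves the
  same problem with zero initial data, and its norm does not increase.\<close>

lemma conj_orbit_generates:
  assumes F: "generates F G" "conj_l2 F = F" and t: "0 \<le> t"
  shows "conj_l2 (T t F) = T t F"
proof -
  interpret D: airy_curve \<beta> "\<lambda>t. T t F - conj_l2 (T t F)" "\<lambda>t. T t G - conj_l2 (T t G)"
    by (intro airy_curve_diff airy_curve_conj generates_curve F)
  show ?thesis using D.norm_antimono[OF order_refl t] F by simp
qed

lemma T_tendsto: "0 \<le> t \<Longrightarrow> X \<longlonglongrightarrow> F \<Longrightarrow> (\<lambda>n. T t (X n)) \<longlonglongrightarrow> T t F"
  by (rule bounded_linear.tendsto[OF bounded_linear_T])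

lemma conj_orbit:
  assumes F: "conj_l2 F = F" and t: "0 \<le> t"
  shows "conj_l2 (T t F) = T t F"
proof -
  obtain b where b: "\<And>n. b n \<in> bump_functions" "\<And>n. conj_l2 (cls (b n)) = cls (b n)" "(\<lambda>n. cls (b n)) \<longlonglongrightarrow> F"
    using real_bump_approximation[OF F] by blast
  have "conj_l2 (T t (cls (b n))) = T t (cls (b n))" for n
    using D_beta_generates[OF bump_in_D_beta[OF b(1)]] conj_orbit_generates b(2) t by blast
  moreover have "(\<lambda>n. conj_l2 (T t (cls (b n)))) \<longlonglongrightarrow> conj_l2 (T t F)"
    by (intro bounded_linear.tendsto[OF bounded_linear_conj_l2] T_tendsto b t)
  ultimately show ?thesis
    using T_tendsto[OF t b(3)] LIMSEQ_unique by simp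
qed

text \<open>Applied to differences of solutions, the bound makes the traces along one approximating sequence a
  Cauchy sequence, and brings those along any other sequence arbitrarily close to them.\<close>

lemma trace_limit:
  fixes \<Phi> :: "(real \<Rightarrow> l2) \<Rightarrow> 'c \<Rightarrow> complex"
  assumes bound: "\<And>U U'. airy_curve \<beta> U U' \<Longrightarrow> \<Phi> U \<in> L2 M \<and> L2norm M (\<Phi> U) \<le> c * norm (U 0)"
    and diff: "\<And>U U' W W' z. airy_curve \<beta> U U' \<Longrightarrow> airy_curve \<beta> W W' \<Longrightarrow> z \<in> space M
      \<Longrightarrow> \<Phi> (\<lambda>t. U t - W t) z = \<Phi> U z - \<Phi> W z"
    and real: "\<And>U U' z. airy_curve \<beta> U U' \<Longrightarrow> (\<And>t. 0 \<le> t \<Longrightarrow> conj_l2 (U t) = U t) \<Longrightarrow> z \<in> space M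
      \<Longrightarrow> Im (\<Phi> U z) = 0"
    and F: "conj_l2 F = F"
  shows "\<exists>P. \<forall>X. (\<forall>n. \<exists>G. generates (X n) G) \<longrightarrow> X \<longlonglongrightarrow> F \<longrightarrow>
    L2_tendsto M (\<lambda>n. \<Phi> (\<lambda>t. T t (X n))) (\<lambda>z. complex_of_real (P z)) sequentially"
proof -
  have close: "L2norm M (\<lambda>z. \<Phi> (\<lambda>t. T t A) z - \<Phi> (\<lambda>t. T t B) z) \<le> c * norm (A - B)"
    if A: "generates A A'" and B: "generates B B'" for A A' B B'
  proof -
    have "L2norm M (\<lambda>z. \<Phi> (\<lambda>t. T t A) z - \<Phi> (\<lambda>t. T t B) z) = L2norm M (\<Phi> (\<lambda>t. T t A - T t B))"
      by (rule L2_cong_space(2)) (simp add: diff[OF generates_curve[OF A] generates_curve[OF B]])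
    also have "\<dots> \<le> c * norm (A - B)"
      using bound[OF airy_curve_diff[OF generates_curve[OF A] generates_curve[OF B]]] by simp
    finally show ?thesis .
  qed
  obtain b where b: "\<And>n. b n \<in> bump_functions" "\<And>n. conj_l2 (cls (b n)) = cls (b n)" "(\<lambda>n. cls (b n)) \<longlonglongrightarrow> F"
    using real_bump_approximation[OF F] by blast
  from D_beta_generates[OF bump_in_D_beta[OF b(1)]]
  obtain G where G: "\<And>n. generates (cls (b n)) (G n)" by metis
  define \<Psi> where "\<Psi> n = \<Phi> (\<lambda>t. T t (cls (b n)))" for n
  have L: "\<Psi> n \<in> L2 M" for n unfolding \<Psi>_def using bound[OF generates_curve[OF G]] by blast
  have "\<exists>p. L2_tendsto M \<Psi> p sequentially"
  proof (rule L2_complete[OF L])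
    fix e :: real assume e: "0 < e"
    have "Cauchy (\<lambda>n. cls (b n))" using b(3) by (rule LIMSEQ_imp_Cauchy)
    moreover have "0 < e / (\<bar>c\<bar> + 1)" using e by (simp add: add_nonneg_pos)
    ultimately obtain N where N: "\<And>m n. m \<ge> N \<Longrightarrow> n \<ge> N \<Longrightarrow> norm (cls (b m) - cls (b n)) < e / (\<bar>c\<bar> + 1)"
      unfolding Cauchy_iff by meson
    show "\<exists>N. \<forall>m\<ge>N. \<forall>n\<ge>N. L2norm M (\<lambda>x. \<Psi> m x - \<Psi> n x) < e"
    proof (intro exI allI impI)
      fix m n assume mn: "N \<le> m" "N \<le> n"
      have "L2norm M (\<lambda>x. \<Psi> m x - \<Psi> n x) \<le> c * norm (cls (b m) - cls (b n))"
        unfolding \<Psi>_def by (rule close[OF G G])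
      also have "\<dots> \<le> (\<bar>c\<bar> + 1) * norm (cls (b m) - cls (b n))" by (intro mult_right_mono) auto
      also have "\<dots> < (\<bar>c\<bar> + 1) * (e / (\<bar>c\<bar> + 1))"
        using N[OF mn] by (intro mult_strict_left_mono) (auto simp: add_nonneg_pos)
      also have "\<dots> = e" by simp
      finally show "L2norm M (\<lambda>x. \<Psi> m x - \<Psi> n x) < e" .
    qed
  qed
  then obtain p where p: "L2_tendsto M \<Psi> p sequentially" by blast
  have "Im (\<Psi> n z) = 0" if "z \<in> space M" for n z
    unfolding \<Psi>_def using real[OF generates_curve[OF G] _ that] conj_orbit_generates[OF G b(2)] by blast
  from L2_tendsto_Re[OF p this]
  have p': "L2_tendsto M \<Psi> (\<lambda>z. complex_of_real (Re (p z))) sequentially" .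
  show ?thesis
  proof (intro exI[of _ "\<lambda>z. Re (p z)"] allI impI)
    fix X assume X: "\<forall>n. \<exists>G. generates (X n) G" "X \<longlonglongrightarrow> F"
    from X(1) obtain H where H: "\<And>n. generates (X n) (H n)" by metis
    show "L2_tendsto M (\<lambda>n. \<Phi> (\<lambda>t. T t (X n))) (\<lambda>z. complex_of_real (Re (p z))) sequentially"
    proof (rule L2_tendsto_transfer[OF p'])
      show "\<Phi> (\<lambda>t. T t (X n)) \<in> L2 M" for n using bound[OF generates_curve[OF H]] by blast
      have "(\<lambda>n. c * norm (X n - cls (b n))) \<longlonglongrightarrow> c * norm (F - F)"
        by (intro tendsto_intros X b)
      then have lim: "(\<lambda>n. c * norm (X n - cls (b n))) \<longlonglongrightarrow> 0" by simp
      show "(\<lambda>n. L2norm M (\<lambda>z. \<Phi> (\<lambda>t. T t (X n)) z - \<Psi> n z)) \<longlonglongrightarrow> 0"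
        by (rule Lim_null_comparison[OF _ lim]) (simp add: \<Psi>_def close[OF H G])
    qed
  qed
qed

lemma approx_data_classes:
  assumes "approx_data \<beta> f v"
  shows "v n \<in> L2 I01" "\<exists>G. generates (cls (v n)) G" "(\<lambda>n. cls (v n)) \<longlonglongrightarrow> cls f"
  using assms D_beta_L2 D_beta_generates L2_tendsto_imp_cls_tendsto unfolding approx_data_def by blast+

lemma point_deriv_orbit:
  "0 \<le> s \<Longrightarrow> v \<in> L2 I01 \<Longrightarrow> point_deriv (S s v) x = slope (T s (cls v)) x"
  by (simp add: point_deriv_eq_slope S_L2 T_cls)

lemma approx_data_exists:
  assumes f: "f \<in> L2 I01"
  shows "\<exists>v. approx_data \<beta> f v"
proof -
  have "cls f \<in> closure (cls ` bump_functions)" by (simp add: bump_functions_dense)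
  then obtain X where X: "\<And>n. X n \<in> cls ` bump_functions" "X \<longlonglongrightarrow> cls f"
    unfolding closure_sequential by blast
  from X(1) obtain v where v: "\<And>n. v n \<in> bump_functions" "\<And>n. X n = cls (v n)"
    unfolding image_iff by metis
  have "X = (\<lambda>n. cls (v n))" using v(2) by auto
  then have "L2_tendsto I01 v f sequentially"
    using X(2) by (intro cls_tendsto_imp_L2_tendsto bump_L2 v f) simp
  then show ?thesis using bump_in_D_beta[OF v(1)] unfolding approx_data_def by blast
qed

text \<open>Both slopes are instances of \<open>trace_limit\<close>; what remains is to restrict the limits from the half line
  to bounded time intervals and to read off a real version of the solution itself.\<close>

lemma real_solution_exists:
  assumes u0: "(\<lambda>x. complex_of_real (u0 x)) \<in> L2 I01"
  shows "\<exists>u p q. real_solution \<beta> S u0 u p q"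
proof -
  let ?f = "\<lambda>x. complex_of_real (u0 x)"
  have F: "conj_l2 (cls ?f) = cls ?f" by (rule conj_l2_cls_real[OF u0])
  have slope_real: "Im (slope (U t) x) = 0"
    if "airy_curve \<beta> U U'" "\<And>t. 0 \<le> t \<Longrightarrow> conj_l2 (U t) = U t" "0 \<le> t" "x \<in> {0..1}" for U U' t x
  proof -
    have "slope (U t) x = cnj (slope (U t) x)"
      using airy_pair_conj(2)[OF airy_curve.pair[OF that(1,3)] that(4)] that(2,3) by simp
    then show ?thesis by (metis Reals_cnj_iff complex_is_Real_iff)
  qed
  have "\<exists>P. \<forall>X. (\<forall>n. \<exists>G. generates (X n) G) \<longrightarrow> X \<longlonglongrightarrow> cls ?f \<longrightarrow>
    L2_tendsto half_line (\<lambda>n. boundary_trace (\<lambda>t. T t (X n))) (\<lambda>z. complex_of_real (P z)) sequentially"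
  proof (rule trace_limit[OF _ _ _ F])
    fix U U' assume U: "airy_curve \<beta> U U'"
    show "boundary_trace U \<in> L2 half_line \<and> L2norm half_line (boundary_trace U) \<le> sqrt (gain \<beta>) * norm (U 0)"
      by (rule airy_curve.boundary_trace_L2[OF U])
    show "Im (boundary_trace U z) = 0" if "\<And>t. 0 \<le> t \<Longrightarrow> conj_l2 (U t) = U t" "z \<in> space half_line" for z
      unfolding boundary_trace_def using that by (intro slope_real[OF U]) auto
    fix W W' z assume W: "airy_curve \<beta> W W'" and z: "z \<in> space half_line"
    show "boundary_trace (\<lambda>t. U t - W t) z = boundary_trace U z - boundary_trace W z"
      unfolding boundary_trace_def using z
      by (intro airy_pair_diff(2)[OF airy_curve.pair[OF U] airy_curve.pair[OF W]]) auto
  qed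
  then obtain p where p: "\<And>X. (\<forall>n. \<exists>G. generates (X n) G) \<Longrightarrow> X \<longlonglongrightarrow> cls ?f \<Longrightarrow>
    L2_tendsto half_line (\<lambda>n. boundary_trace (\<lambda>t. T t (X n))) (\<lambda>z. complex_of_real (p z)) sequentially"
    by blast
  have "\<exists>P. \<forall>X. (\<forall>n. \<exists>G. generates (X n) G) \<longrightarrow> X \<longlonglongrightarrow> cls ?f \<longrightarrow>
    L2_tendsto (I01 \<Otimes>\<^sub>M half_line) (\<lambda>n. interior_trace (\<lambda>t. T t (X n))) (\<lambda>z. complex_of_real (P z)) sequentially"
  proof (rule trace_limit[OF _ _ _ F])
    fix U U' assume U: "airy_curve \<beta> U U'"
    show "interior_trace U \<in> L2 (I01 \<Otimes>\<^sub>M half_line) \<and> L2norm (I01 \<Otimes>\<^sub>M half_line) (interior_trace U) \<le> sqrt (gain \<beta>) * norm (U 0)"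
      by (rule airy_curve.interior_trace_L2[OF U])
    show "Im (interior_trace U z) = 0" if "\<And>t. 0 \<le> t \<Longrightarrow> conj_l2 (U t) = U t" "z \<in> space (I01 \<Otimes>\<^sub>M half_line)" for z
      unfolding interior_trace_def using that by (intro slope_real[OF U]) (auto simp: space_pair_measure)
    fix W W' z assume W: "airy_curve \<beta> W W'" and z: "z \<in> space (I01 \<Otimes>\<^sub>M half_line)"
    show "interior_trace (\<lambda>t. U t - W t) z = interior_trace U z - interior_trace W z"
      unfolding interior_trace_def using z
      by (intro airy_pair_diff(2)[OF airy_curve.pair[OF U] airy_curve.pair[OF W]]) (auto simp: space_pair_measure)
  qed
  then obtain q where q: "\<And>X. (\<forall>n. \<exists>G. generates (X n) G) \<Longrightarrow> X \<longlonglongrightarrow> cls ?f \<Longrightarrow>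
    L2_tendsto (I01 \<Otimes>\<^sub>M half_line) (\<lambda>n. interior_trace (\<lambda>t. T t (X n))) (\<lambda>z. complex_of_real (q z)) sequentially"
    by blast
  have boundary: "boundary_slope \<beta> S ?f (\<lambda>s. complex_of_real (p s))"
    unfolding boundary_slope_def
  proof (intro conjI approx_data_exists[OF u0] allI impI)
    fix v and t :: real assume v: "approx_data \<beta> ?f v" and t: "0 < t"
    note c = approx_data_classes[OF v]
    have "L2_tendsto (lborel_on 0 t) (\<lambda>n. boundary_trace (\<lambda>t. T t (cls (v n)))) (\<lambda>z. complex_of_real (p z)) sequentially"
      by (rule L2_tendsto_mono_measure[OF measurable_half_line_lborel_on nn_integral_lborel_on_le_half_line p])
        (use c in auto)
    then show "L2_tendsto (lborel_on 0 t) (\<lambda>n s. point_deriv (S s (v n)) 0) (\<lambda>s. complex_of_real (p s)) sequentially"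
      by (subst L2_tendsto_cong_space[where G = "\<lambda>n. boundary_trace (\<lambda>t. T t (cls (v n)))"])
        (simp_all add: boundary_trace_def point_deriv_orbit c)
  qed
  have interior: "interior_slope \<beta> S ?f (\<lambda>(x, s). complex_of_real (q (x, s)))"
    unfolding interior_slope_def
  proof (intro conjI approx_data_exists[OF u0] allI impI)
    fix v and t :: real assume v: "approx_data \<beta> ?f v" and t: "0 < t"
    note c = approx_data_classes[OF v]
    have "L2_tendsto (I01 \<Otimes>\<^sub>M lborel_on 0 t) (\<lambda>n. interior_trace (\<lambda>t. T t (cls (v n)))) (\<lambda>z. complex_of_real (q z)) sequentially"
    proof (rule L2_tendsto_mono_measure[OF _ nn_integral_product_le_half_line q])
      show "f \<in> borel_measurable (I01 \<Otimes>\<^sub>M lborel_on 0 t)" if "f \<in> borel_measurable (I01 \<Otimes>\<^sub>M half_line)" for f :: "real \<times> real \<Rightarrow> complex"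
        using measurable_compose[OF measurable_id_product that] by simp
    qed (use c in auto)
    then have "L2_tendsto (I01 \<Otimes>\<^sub>M lborel_on 0 t) (\<lambda>n (x, s). point_deriv (S s (v n)) x) (\<lambda>z. complex_of_real (q z)) sequentially"
      by (subst L2_tendsto_cong_space[where G = "\<lambda>n. interior_trace (\<lambda>t. T t (cls (v n)))"])
        (auto simp: space_pair_measure interior_trace_def point_deriv_orbit c)
    then show "L2_tendsto (I01 \<Otimes>\<^sub>M lborel_on 0 t) (\<lambda>n (x, s). point_deriv (S s (v n)) x) (\<lambda>(x, s). complex_of_real (q (x, s))) sequentially"
      by (simp add: split_beta')
  qed
  have "(\<lambda>x. complex_of_real (Re (S t ?f x))) \<in> L2 I01 \<and> (AE x in I01. S t ?f x = complex_of_real (Re (S t ?f x)))"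
    if t: "0 \<le> t" for t
  proof -
    note L = S_L2[OF t u0]
    have "cls (\<lambda>x. cnj (S t ?f x)) = cls (S t ?f)"
      using conj_orbit[OF F t] by (simp add: cls_cnj[OF L] T_cls[OF t u0])
    then have "AE x in I01. cnj (S t ?f x) = S t ?f x"
      using cls_eq_iff[OF L2_cnj[OF L] L] by simp
    then have ae: "AE x in I01. S t ?f x = complex_of_real (Re (S t ?f x))"
      by eventually_elim (simp add: complex_eq_iff)
    moreover have "(\<lambda>x. complex_of_real (Re (S t ?f x))) \<in> borel_measurable I01"
      using L2_measurable[OF L] by measurable
    ultimately show ?thesis using L2_cong_AE[OF L] by blast
  qed
  then show ?thesis
    unfolding real_solution_def using boundary interior
    by (intro exI[of _ "\<lambda>x t. Re (S t ?f x)"] exI[of _ p] exI[of _ "\<lambda>x s. q (x, s)"]) auto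
qed

lemma integral_real_square: "(\<integral>x. (f x)\<^sup>2 \<partial>M) = (L2norm M (\<lambda>x. complex_of_real (f x)))\<^sup>2"
  by (simp add: L2norm_square)

lemma integral_lborel_on_empty: "(\<integral>s. (f s :: real) \<partial>lborel_on t t) = 0"
proof -
  have "(\<integral>s. f s \<partial>lborel_on t t) = (\<integral>s. 0 \<partial>lborel_on t t)"
    by (rule Bochner_Integration.integral_cong) auto
  then show ?thesis by simp
qed

text \<open>Each estimate holds for the classical solutions that approximate \<open>u\<close> and is continuous in \<open>L\<^sup>2\<close>. The
  quantities at \<open>t = 0\<close> need a separate look, because the slopes are defined as limits on intervals of
  positive length.\<close>

lemma real_solution_estimates:
  assumes u0: "(\<lambda>x. complex_of_real (u0 x)) \<in> L2 I01" and sol: "real_solution \<beta> S u0 u p q" and t: "0 \<le> t"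
  shows "(\<integral>x. (u x t)\<^sup>2 \<partial>I01) \<le> (\<integral>x. (u0 x)\<^sup>2 \<partial>I01)"
    and "(\<integral>s. (p s)\<^sup>2 \<partial>lborel_on 0 t) \<le> gain \<beta> * (\<integral>x. (u0 x)\<^sup>2 \<partial>I01)"
    and "(\<integral>x. x * (u x t)\<^sup>2 \<partial>I01) + 3 * (\<integral>s. (\<integral>x. (q x s)\<^sup>2 \<partial>I01) \<partial>lborel_on 0 t)
      \<le> gain \<beta> * (\<integral>x. (u0 x)\<^sup>2 \<partial>I01)"
    and "t * (\<integral>x. (u x t)\<^sup>2 \<partial>I01) \<le> gain \<beta> * (\<integral>x. (u0 x)\<^sup>2 \<partial>I01)"
proof -
  let ?f = "\<lambda>x. complex_of_real (u0 x)"
  let ?u = "\<lambda>x. complex_of_real (u x t)"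
  define F where "F = cls ?f"
  have u: "?u \<in> L2 I01" and ae: "AE x in I01. S t ?f x = ?u x"
    using sol t unfolding real_solution_def by blast+
  have clsu: "cls ?u = T t F"
    using ae cls_eq_iff[OF S_L2[OF t u0] u] by (simp add: F_def T_cls[OF t u0])
  have nF: "(\<integral>x. (u0 x)\<^sup>2 \<partial>I01) = (norm F)\<^sup>2"
    unfolding F_def norm_cls[OF u0] by (rule integral_real_square)
  have nu: "(\<integral>x. (u x t)\<^sup>2 \<partial>I01) = (norm (T t F))\<^sup>2"
    unfolding clsu[symmetric] norm_cls[OF u] by (rule integral_real_square)
  have wu: "(\<integral>x. x * (u x t)\<^sup>2 \<partial>I01) = inner (weight_l2 (T t F)) (T t F)"
    unfolding clsu[symmetric] inner_weight_l2[OF u u] by (simp add: power2_eq_square)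
  obtain v where v: "approx_data \<beta> ?f v"
    using sol unfolding real_solution_def boundary_slope_def by blast
  note c = approx_data_classes[OF v, folded F_def]
  from c(2) obtain G where G: "\<And>n. generates (cls (v n)) (G n)" by metis
  note curve = generates_curve[OF G]
  have lim0: "(\<lambda>n. (norm (cls (v n)))\<^sup>2) \<longlonglongrightarrow> (norm F)\<^sup>2"
    by (intro tendsto_intros c(3))
  then have limg: "(\<lambda>n. gain \<beta> * (norm (cls (v n)))\<^sup>2) \<longlonglongrightarrow> gain \<beta> * (norm F)\<^sup>2"
    by (rule tendsto_mult[OF tendsto_const])
  have limt: "(\<lambda>n. (norm (T t (cls (v n))))\<^sup>2) \<longlonglongrightarrow> (norm (T t F))\<^sup>2"
    by (intro tendsto_intros T_tendsto c(3) t)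
  show "(\<integral>x. (u x t)\<^sup>2 \<partial>I01) \<le> (\<integral>x. (u0 x)\<^sup>2 \<partial>I01)"
    unfolding nu nF
  proof (rule LIMSEQ_le[OF limt lim0], intro exI allI impI)
    show "(norm (T t (cls (v n))))\<^sup>2 \<le> (norm (cls (v n)))\<^sup>2" for n
      using airy_curve.norm_antimono[OF curve order_refl t] by (intro power_mono) auto
  qed
  show "t * (\<integral>x. (u x t)\<^sup>2 \<partial>I01) \<le> gain \<beta> * (\<integral>x. (u0 x)\<^sup>2 \<partial>I01)"
    unfolding nu nF
  proof (rule LIMSEQ_le[OF tendsto_mult[OF tendsto_const limt] limg], intro exI allI impI)
    show "t * (norm (T t (cls (v n))))\<^sup>2 \<le> gain \<beta> * (norm (cls (v n)))\<^sup>2" for n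
      using airy_curve.decay[OF curve t] by simp
  qed
  have limw: "(\<lambda>n. inner (weight_l2 (T t (cls (v n)))) (T t (cls (v n)))) \<longlonglongrightarrow> inner (weight_l2 (T t F)) (T t F)"
    by (intro tendsto_inner bounded_linear.tendsto[OF bounded_linear_weight_l2] T_tendsto c(3) t)
  show "(\<integral>s. (p s)\<^sup>2 \<partial>lborel_on 0 t) \<le> gain \<beta> * (\<integral>x. (u0 x)\<^sup>2 \<partial>I01)"
  proof (cases "t = 0")
    case True
    have "0 \<le> gain \<beta>" using \<beta> by (simp add: gain_def)
    then show ?thesis unfolding True integral_lborel_on_empty nF by simp
  next
    case False
    let ?p = "\<lambda>n s. point_deriv (S s (v n)) 0"
    have "L2_tendsto (lborel_on 0 t) ?p (\<lambda>s. complex_of_real (p s)) sequentially"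
      using sol v t False unfolding real_solution_def boundary_slope_def by auto
    from tendsto_power[OF L2_tendsto_L2norm[OF this], of 2]
    have lim: "(\<lambda>n. (L2norm (lborel_on 0 t) (?p n))\<^sup>2) \<longlonglongrightarrow> (\<integral>s. (p s)\<^sup>2 \<partial>lborel_on 0 t)"
      by (simp only: integral_real_square)
    show ?thesis
      unfolding nF
    proof (rule LIMSEQ_le[OF lim limg], intro exI allI impI)
      fix n
      have "(L2norm (lborel_on 0 t) (?p n))\<^sup>2 = (\<integral>s. (cmod (slope (T s (cls (v n))) 0))\<^sup>2 \<partial>lborel_on 0 t)"
        unfolding L2norm_square
        by (intro Bochner_Integration.integral_cong refl) (simp add: point_deriv_orbit c)
      then show "(L2norm (lborel_on 0 t) (?p n))\<^sup>2 \<le> gain \<beta> * (norm (cls (v n)))\<^sup>2"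
        using airy_curve.boundary_bound[OF curve t] by simp
    qed
  qed
  show "(\<integral>x. x * (u x t)\<^sup>2 \<partial>I01) + 3 * (\<integral>s. (\<integral>x. (q x s)\<^sup>2 \<partial>I01) \<partial>lborel_on 0 t)
      \<le> gain \<beta> * (\<integral>x. (u0 x)\<^sup>2 \<partial>I01)"
  proof (cases "t = 0")
    case True
    have "inner (weight_l2 F) F \<le> 1 * (norm F)\<^sup>2" using weight_l2_le(2)[of F] by simp
    also have "\<dots> \<le> gain \<beta> * (norm F)\<^sup>2" using \<beta> by (intro mult_right_mono) (simp_all add: gain_def)
    finally show ?thesis unfolding wu nF by (simp add: True integral_lborel_on_empty)
  next
    case False
    let ?M = "I01 \<Otimes>\<^sub>M lborel_on 0 t"
    let ?q = "\<lambda>n (x, s). point_deriv (S s (v n)) x"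
    have lim: "L2_tendsto ?M ?q (\<lambda>(x, s). complex_of_real (q x s)) sequentially"
      using sol v t False unfolding real_solution_def interior_slope_def by auto
    have "(L2norm ?M (\<lambda>(x, s). complex_of_real (q x s)))\<^sup>2 = (\<integral>s. (\<integral>x. (q x s)\<^sup>2 \<partial>I01) \<partial>lborel_on 0 t)"
      using lim by (subst L2norm_product_square) (auto simp: L2_tendsto_def)
    with tendsto_power[OF L2_tendsto_L2norm[OF lim], of 2]
    have limq: "(\<lambda>n. (L2norm ?M (?q n))\<^sup>2) \<longlonglongrightarrow> (\<integral>s. (\<integral>x. (q x s)\<^sup>2 \<partial>I01) \<partial>lborel_on 0 t)"
      by simp
    have "\<forall>\<^sub>F n in sequentially. ?q n \<in> L2 ?M" using lim by (simp add: L2_tendsto_def)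
    then obtain N where N: "\<And>n. n \<ge> N \<Longrightarrow> ?q n \<in> L2 ?M" by (auto simp: eventually_sequentially)
    show ?thesis
      unfolding wu nF
    proof (rule LIMSEQ_le[OF tendsto_add[OF limw tendsto_mult[OF tendsto_const limq]] limg], intro exI allI impI)
      fix n assume n: "N \<le> n"
      have "(L2norm ?M (?q n))\<^sup>2 = (\<integral>s. \<integral>x. (cmod (point_deriv (S s (v n)) x))\<^sup>2 \<partial>I01 \<partial>lborel_on 0 t)"
        by (subst L2norm_product_square[OF N[OF n]]) simp
      also have "\<dots> = (\<integral>s. airy_curve.slope_energy (\<lambda>t. T t (cls (v n))) s \<partial>lborel_on 0 t)"
        unfolding airy_curve.slope_energy_def[OF curve]
        by (intro Bochner_Integration.integral_cong refl) (simp add: point_deriv_orbit c)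
      finally show "inner (weight_l2 (T t (cls (v n)))) (T t (cls (v n))) + 3 * (L2norm ?M (?q n))\<^sup>2
          \<le> gain \<beta> * (norm (cls (v n)))\<^sup>2"
        using airy_curve.weighted_bound[OF curve t] by simp
    qed
  qed
qed

lemma real_solution_decay:
  assumes u0: "(\<lambda>x. complex_of_real (u0 x)) \<in> L2 I01" and sol: "real_solution \<beta> S u0 u p q"
  shows "((\<lambda>t. \<integral>x. (u x t)\<^sup>2 \<partial>I01) \<longlongrightarrow> 0) at_top"
proof -
  define C where "C = gain \<beta> * (\<integral>x. (u0 x)\<^sup>2 \<partial>I01)"
  have lim: "((\<lambda>t. C / t) \<longlongrightarrow> 0) at_top"
    by (rule real_tendsto_divide_at_top[OF tendsto_const filterlim_ident])
  have "\<forall>\<^sub>F t in at_top. norm (\<integral>x. (u x t)\<^sup>2 \<partial>I01) \<le> C / t"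
    using eventually_gt_at_top[of 0]
  proof eventually_elim
    case (elim t)
    then have "t * (\<integral>x. (u x t)\<^sup>2 \<partial>I01) \<le> C"
      using real_solution_estimates(4)[OF u0 sol, of t] by (simp add: C_def)
    then show ?case using elim by (simp add: field_simps Bochner_Integration.integral_nonneg)
  qed
  from Lim_null_comparison[OF this lim] show ?thesis .
qed

end

theorem proposition1:
  fixes \<beta> :: real
    and S :: "real \<Rightarrow> (real \<Rightarrow> complex) \<Rightarrow> (real \<Rightarrow> complex)"
    and u0 :: "real \<Rightarrow> real"
  assumes "0 \<le> \<beta>" and "\<beta> < 1"
    and "C0_semigroup I01 S"
    and "generator I01 S = i_T_beta \<beta>"
    and "(\<lambda>x. complex_of_real (u0 x)) \<in> L2 I01"
  shows "(\<exists>u p q. real_solution \<beta> S u0 u p q) \<and>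
    (\<forall>u p q. real_solution \<beta> S u0 u p q \<longrightarrow>
      (\<forall>t\<ge>0.
        (\<integral>x. (u x t)\<^sup>2 \<partial>I01) \<le> (\<integral>x. (u0 x)\<^sup>2 \<partial>I01) \<and>
        (\<integral>s. (p s)\<^sup>2 \<partial>lborel_on 0 t) \<le> 1 / (1 - \<beta>) * (\<integral>x. (u0 x)\<^sup>2 \<partial>I01) \<and>
        (\<integral>x. x * (u x t)\<^sup>2 \<partial>I01) + 3 * (\<integral>s. (\<integral>x. (q x s)\<^sup>2 \<partial>I01) \<partial>lborel_on 0 t)
          \<le> 1 / (1 - \<beta>) * (\<integral>x. (u0 x)\<^sup>2 \<partial>I01)) \<and>
      ((\<lambda>t. \<integral>x. (u x t)\<^sup>2 \<partial>I01) \<longlongrightarrow> 0) at_top)"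
proof -
  interpret airy_semigroup \<beta> S
    using assms by unfold_locales
  show ?thesis
    using real_solution_exists[OF assms(5)] real_solution_estimates(1-3)[OF assms(5)]
      real_solution_decay[OF assms(5)] unfolding gain_def by blast
qed

end
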